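(* For every Dynkin quiver $Q$, the associated Lie algebra $\tilde{\mathfrak{n}}^{+}$ is a nilpotent Lie algebra.
   Context: A Dynkin quiver is a quiver $Q$ whose underlying graph $\Gamma$ is of type $\mathbb{A}_n$, $\mathbb{D}_n$ or $\mathbb{E}_{6,7,8}$; its vertex set is $I=\{1,\dots,n\}$. For a prime power $q$ let $A=A(q)=\mathbb{F}_qQ$; $\mathrm{mod}\,A$ is the category of finite-dimensional $A$-modules, $P_i$ the projective cover of the simple module $S_i$ at $i$; $\mathscr{P}$ is the category of finite-dimensional projective $A$-modules. $C^1(\mathscr{P})$ (1-cyclic complexes): objects are pairs $(M,d)$, $M\in\mathscr{P}$, $d\in\mathrm{End}_A(M)$, $d^2=0$; morphisms are $A$-homomorphisms commuting with the $d$'s. Conflations $Y\to Z\to X$ are sequences of complexes whose underlying sequences $0\to Y\to Z\to X\to0$ of modules are exact. For $M\in\mathrm{mod}\,A$ with minimal projective resolution $0\to\Omega_M\xrightarrow{\delta_M}P_M\to M\to0$ put $C_M=\left(P_M\oplus\Omega_M,\begin{pmatrix}0&\delta_M\\0&0\end{pmatrix}\right)$; for $P\in\mathscr{P}$ put $K_P=\left(P\oplus P,\begin{pmatrix}0&\mathrm{Id}\\0&0\end{pmatrix}\right)$. The indecomposable objects are, up to isomorphism, the $C_M$ ($M$ indecomposable; non-acyclic) and the $K_{P_i}$ (acyclic, i.e. $\ker d/\operatorname{im}d=0$). Let $\Phi^+$ be the set of positive roots of the simple Lie algebra with Dynkin graph $\Gamma$, and $M_q(\alpha)$ the indecomposable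 $A(q)$-module with dimension vector $\alpha\in\Phi^+$. $\mathfrak{P}^1(\Gamma)$ is the set of functions $\lambda:\Phi^+\sqcup I\to\mathbb{N}$; $C_q(\lambda)=\bigoplus_{\alpha}\lambda(\alpha)C_{M_q(\alpha)}\oplus\bigoplus_i\lambda(i)K_{P_i}$; $\lambda$ is indecomposable if $C_q(\lambda)$ is. With $F_{XY}^Z=|\{\text{conflations }Y\to Z\to X\}|/(|\mathrm{Aut}X||\mathrm{Aut}Y|)$, there are Hall polynomials $\psi_{\mu\nu}^\lambda\in\mathbb{Z}[x]$ with $\psi_{\mu\nu}^\lambda(q)=F_{C_q(\mu)C_q(\nu)}^{C_q(\lambda)}$ for all prime powers $q$. $\tilde{\mathfrak{n}}$ is the complex Lie algebra with basis the (symbols of) isomorphism classes $[C_q(\mu)]$, $\mu$ indecomposable, and bracket $[[C_q(\mu)],[C_q(\nu)]]=\sum_{\lambda}(\psi_{\mu\nu}^\lambda(1)-\psi_{\nu\mu}^\lambda(1))[C_q(\lambda)]$ (terms with $\lambda$ decomposable have coefficient $0$). $\tilde{\mathfrak{n}}^{+}$ is its Lie subalgebra spanned by the classes of the non-acyclic indecomposables $C_M$, $M$ indecomposable. *)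

theory Defs
  imports
    "HOL-Algebra.Module"
    "HOL-Computational_Algebra.Polynomial"
    "HOL-Library.Poly_Mapping"
    "Graph_Theory.Arc_Walk"
begin

section \<open>Dynkin quivers and positive roots\<close>

text \<open>
  The branches are type A (a line), type D (the end vertex \<open>n\<close> attached to \<open>n - 2\<close>) and
  type E (the end vertex \<open>n\<close> attached to \<open>3\<close>).
\<close>

definition dynkin_diagram :: "nat \<Rightarrow> nat set set \<Rightarrow> bool" where
  "dynkin_diagram n E \<longleftrightarrow>
     1 \<le> n \<and> E = {{i, i + 1} | i. 1 \<le> i \<and> i < n} \<or>
     4 \<le> n \<and> E = insert {n - 2, n} {{i, i + 1} | i. 1 \<le> i \<and> i < n - 1} \<or>
     n \<in> {6, 7, 8} \<and> E = insert {3, n} {{i, i + 1} | i. 1 \<le> i \<and> i < n - 1}"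

text \<open>
  The vertices \<open>1, ..., n\<close> may be numbered in any way, hence the permutation \<open>\<sigma>\<close>. Injectivity of
  the second map says that there are no multiple arrows.
\<close>

definition dynkin_quiver :: "(nat, 'e) pre_digraph \<Rightarrow> bool" where
  "dynkin_quiver Q \<longleftrightarrow> wf_digraph Q \<and>
     (\<exists>n E \<sigma>. dynkin_diagram n E \<and> verts Q = {1..n} \<and> bij_betw \<sigma> {1..n} {1..n} \<and>
        bij_betw (\<lambda>a. {\<sigma> (tail Q a), \<sigma> (head Q a)}) (arcs Q) E)"

definition cartan :: "(nat, 'e) pre_digraph \<Rightarrow> nat \<Rightarrow> nat \<Rightarrow> int" where
  "cartan Q i j =
     (if i = j then 2 else - int (card {a \<in> arcs Q. {tail Q a, head Q a} = {i, j}}))"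

definition simple_reflection ::
    "(nat, 'e) pre_digraph \<Rightarrow> nat \<Rightarrow> (nat \<Rightarrow> int) \<Rightarrow> (nat \<Rightarrow> int)" where
  "simple_reflection Q i \<alpha> = \<alpha>(i := \<alpha> i - (\<Sum>j\<in>verts Q. cartan Q i j * \<alpha> j))"

text \<open>
  A root is given by its coordinates with respect to the simple roots. The root system is the
  orbit of the simple roots under the Weyl group.
\<close>

inductive_set roots :: "(nat, 'e) pre_digraph \<Rightarrow> (nat \<Rightarrow> int) set"
  for Q :: "(nat, 'e) pre_digraph" where
    simple_root: "i \<in> verts Q \<Longrightarrow> (\<lambda>j. if j = i then 1 else 0) \<in> roots Q"
  | reflection: "\<alpha> \<in> roots Q \<Longrightarrow> i \<in> verts Q \<Longrightarrow> simple_reflection Q i \<alpha> \<in> roots Q"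

definition positive_roots :: "(nat, 'e) pre_digraph \<Rightarrow> (nat \<Rightarrow> int) set" where
  "positive_roots Q = {\<alpha> \<in> roots Q. \<forall>i. 0 \<le> \<alpha> i}"


section \<open>Modules over a not necessarily commutative ring\<close>

text \<open>
  The locale \<^locale>\<open>module\<close> is restricted to commutative rings. Its record type and the locale
  \<^locale>\<open>submodule\<close> are used here; the ring fields \<open>mult\<close> and \<open>one\<close> of a module are irrelevant.
\<close>

locale left_module = R?: ring R + M?: abelian_group M for R (structure) and M (structure) +
  assumes smult_closed:
      "\<lbrakk> a \<in> carrier R; x \<in> carrier M \<rbrakk> \<Longrightarrow> a \<odot>\<^bsub>M\<^esub> x \<in> carrier M"
    and smult_l_distr:
      "\<lbrakk> a \<in> carrier R; b \<in> carrier R; x \<in> carrier M \<rbrakk> \<Longrightarrow>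
        (a \<oplus> b) \<odot>\<^bsub>M\<^esub> x = a \<odot>\<^bsub>M\<^esub> x \<oplus>\<^bsub>M\<^esub> b \<odot>\<^bsub>M\<^esub> x"
    and smult_r_distr:
      "\<lbrakk> a \<in> carrier R; x \<in> carrier M; y \<in> carrier M \<rbrakk> \<Longrightarrow>
        a \<odot>\<^bsub>M\<^esub> (x \<oplus>\<^bsub>M\<^esub> y) = a \<odot>\<^bsub>M\<^esub> x \<oplus>\<^bsub>M\<^esub> a \<odot>\<^bsub>M\<^esub> y"
    and smult_assoc:
      "\<lbrakk> a \<in> carrier R; b \<in> carrier R; x \<in> carrier M \<rbrakk> \<Longrightarrow>
        (a \<otimes> b) \<odot>\<^bsub>M\<^esub> x = a \<odot>\<^bsub>M\<^esub> (b \<odot>\<^bsub>M\<^esub> x)"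
    and smult_one:
      "x \<in> carrier M \<Longrightarrow> \<one> \<odot>\<^bsub>M\<^esub> x = x"

text \<open>Homomorphisms are extensional functions, so that they can be counted.\<close>

definition mod_hom :: "'a ring \<Rightarrow> ('a, 'b) module \<Rightarrow> ('a, 'c) module \<Rightarrow> ('b \<Rightarrow> 'c) set" where
  "mod_hom R M N = {f \<in> hom (add_monoid M) (add_monoid N) \<inter> extensional (carrier M).
     \<forall>a\<in>carrier R. \<forall>x\<in>carrier M. f (a \<odot>\<^bsub>M\<^esub> x) = a \<odot>\<^bsub>N\<^esub> f x}"

definition mod_ker :: "('a, 'b) module \<Rightarrow> ('a, 'c) module \<Rightarrow> ('b \<Rightarrow> 'c) \<Rightarrow> 'b set" where
  "mod_ker M N f = {x \<in> carrier M. f x = \<zero>\<^bsub>N\<^esub>}"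

text \<open>A decomposition \<open>M = N \<oplus> N'\<close> into nonzero submodules that are stable under \<open>d\<close>.\<close>

definition decomposes :: "'a ring \<Rightarrow> ('a, 'b) module \<Rightarrow> ('b \<Rightarrow> 'b) \<Rightarrow> bool" where
  "decomposes R M d \<longleftrightarrow> (\<exists>N N'. submodule N R M \<and> submodule N' R M \<and>
     d ` N \<subseteq> N \<and> d ` N' \<subseteq> N' \<and> N \<noteq> {\<zero>\<^bsub>M\<^esub>} \<and> N' \<noteq> {\<zero>\<^bsub>M\<^esub>} \<and>
     N \<inter> N' = {\<zero>\<^bsub>M\<^esub>} \<and> carrier M = {x \<oplus>\<^bsub>M\<^esub> y | x y. x \<in> N \<and> y \<in> N'})"

definition indecomposable_module :: "'a ring \<Rightarrow> ('a, 'b) module \<Rightarrow> bool" where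
  "indecomposable_module R M \<longleftrightarrow>
     left_module R M \<and> carrier M \<noteq> {\<zero>\<^bsub>M\<^esub>} \<and> \<not> decomposes R M id"

text \<open>
  The carriers of test modules have to range over a fixed type. All rings used below are finite,
  and every finitely generated module over them is isomorphic to one with carrier in \<^typ>\<open>int\<close>.
\<close>

definition projective_module :: "'a ring \<Rightarrow> ('a, int) module \<Rightarrow> bool" where
  "projective_module R P \<longleftrightarrow> left_module R P \<and>
     (\<forall>(M :: ('a, int) module) (N :: ('a, int) module) g f.
        left_module R M \<and> left_module R N \<and> g \<in> mod_hom R M N \<and> g ` carrier M = carrier N \<and>
        f \<in> mod_hom R P N \<longrightarrow>
        (\<exists>h\<in>mod_hom R P M. \<forall>x\<in>carrier P. g (h x) = f x))"

definition projective_cover ::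
    "'a ring \<Rightarrow> ('a, int) module \<Rightarrow> ('a, int) module \<Rightarrow> (int \<Rightarrow> int) \<Rightarrow> bool" where
  "projective_cover R M P p \<longleftrightarrow> projective_module R P \<and> p \<in> mod_hom R P M \<and>
     p ` carrier P = carrier M \<and>
     (\<forall>N. submodule N R P \<and> p ` N = carrier M \<longrightarrow> N = carrier P)"

definition proj_cover :: "'a ring \<Rightarrow> ('a, int) module \<Rightarrow> ('a, int) module \<times> (int \<Rightarrow> int)" where
  "proj_cover R M = (SOME (P, p). projective_cover R M P p)"

definition mod_sum :: "('a, 'b) module \<Rightarrow> ('a, 'c) module \<Rightarrow> ('a, 'b \<times> 'c) module" where
  "mod_sum M N = \<lparr> carrier = carrier M \<times> carrier N, monoid.mult = undefined, monoid.one = undefined,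
     zero = (\<zero>\<^bsub>M\<^esub>, \<zero>\<^bsub>N\<^esub>),
     add = (\<lambda>x y. (fst x \<oplus>\<^bsub>M\<^esub> fst y, snd x \<oplus>\<^bsub>N\<^esub> snd y)),
     module.smult = (\<lambda>a x. (a \<odot>\<^bsub>M\<^esub> fst x, a \<odot>\<^bsub>N\<^esub> snd x)) \<rparr>"


section \<open>1-cyclic complexes\<close>

type_synonym ('a, 'b) cyclic_complex = "('a, 'b) module \<times> ('b \<Rightarrow> 'b)"

definition chain_hom ::
    "'a ring \<Rightarrow> ('a, 'b) cyclic_complex \<Rightarrow> ('a, 'c) cyclic_complex \<Rightarrow> ('b \<Rightarrow> 'c) set" where
  "chain_hom R X Y =
     {f \<in> mod_hom R (fst X) (fst Y). \<forall>x\<in>carrier (fst X). f (snd X x) = snd Y (f x)}"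

definition chain_aut :: "'a ring \<Rightarrow> ('a, 'b) cyclic_complex \<Rightarrow> ('b \<Rightarrow> 'b) set" where
  "chain_aut R X = {f \<in> chain_hom R X X. bij_betw f (carrier (fst X)) (carrier (fst X))}"

definition conflations ::
    "'a ring \<Rightarrow> ('a, 'b) cyclic_complex \<Rightarrow> ('a, 'c) cyclic_complex \<Rightarrow> ('a, 'd) cyclic_complex \<Rightarrow>
     (('b \<Rightarrow> 'c) \<times> ('c \<Rightarrow> 'd)) set" where
  "conflations R Y Z X = {(f, g). f \<in> chain_hom R Y Z \<and> g \<in> chain_hom R Z X \<and>
     inj_on f (carrier (fst Y)) \<and> f ` carrier (fst Y) = mod_ker (fst Z) (fst X) g \<and>
     g ` carrier (fst Z) = carrier (fst X)}"

text \<open>\<open>hall_number R X Y Z\<close> is $F_{XY}^Z$.\<close>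

definition hall_number ::
    "'a ring \<Rightarrow> ('a, 'b) cyclic_complex \<Rightarrow> ('a, 'c) cyclic_complex \<Rightarrow> ('a, 'd) cyclic_complex \<Rightarrow> rat"
  where
  "hall_number R X Y Z = of_nat (card (conflations R Y Z X)) /
     (of_nat (card (chain_aut R X)) * of_nat (card (chain_aut R Y)))"

definition acyclic_complex :: "('a, 'b) cyclic_complex \<Rightarrow> bool" where
  "acyclic_complex X \<longleftrightarrow> mod_ker (fst X) (fst X) (snd X) = snd X ` carrier (fst X)"

definition indecomposable_complex :: "'a ring \<Rightarrow> ('a, 'b) cyclic_complex \<Rightarrow> bool" where
  "indecomposable_complex R X \<longleftrightarrow>
     carrier (fst X) \<noteq> {\<zero>\<^bsub>fst X\<^esub>} \<and> \<not> decomposes R (fst X) (snd X)"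

text \<open>
  \<open>complex_C R M\<close> is $C_M$. The ring is hereditary below, so the kernel of the projective cover is
  projective and yields the minimal projective resolution; \<open>\<delta>\<^sub>M\<close> is the inclusion of the kernel.
\<close>

definition complex_C :: "'a ring \<Rightarrow> ('a, int) module \<Rightarrow> ('a, int \<times> int) cyclic_complex" where
  "complex_C R M =
     (let (P, p) = proj_cover R M; \<Omega> = P\<lparr>carrier := mod_ker P M p\<rparr>
      in (mod_sum P \<Omega>, \<lambda>(x, w). (w, \<zero>\<^bsub>\<Omega>\<^esub>)))"

definition complex_K :: "('a, int) module \<Rightarrow> ('a, int \<times> int) cyclic_complex" where
  "complex_K P = (mod_sum P P, \<lambda>(x, y). (y, \<zero>\<^bsub>P\<^esub>))"

text \<open>Direct sum of a finite family.\<close>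

definition complex_sum ::
    "'i set \<Rightarrow> ('i \<Rightarrow> ('a, 'b) cyclic_complex) \<Rightarrow> ('a, 'i \<Rightarrow> 'b) cyclic_complex" where
  "complex_sum J X =
     (\<lparr> carrier = (\<Pi>\<^sub>E i\<in>J. carrier (fst (X i))), monoid.mult = undefined, monoid.one = undefined,
        zero = (\<lambda>i\<in>J. \<zero>\<^bsub>fst (X i)\<^esub>),
        add = (\<lambda>x y. \<lambda>i\<in>J. x i \<oplus>\<^bsub>fst (X i)\<^esub> y i),
        module.smult = (\<lambda>a x. \<lambda>i\<in>J. a \<odot>\<^bsub>fst (X i)\<^esub> x i) \<rparr>,
      \<lambda>x. \<lambda>i\<in>J. snd (X i) (x i))"


section \<open>The path algebra and its modules\<close>

text \<open>
  A path is a pair of its start vertex and the list of its arrows, so \<open>(i, [])\<close> is the trivial path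
  at \<open>i\<close>. In a product \<open>x y\<close> of paths, \<open>y\<close> is traversed first; thus a left module is the same as a
  covariant representation of the quiver.
\<close>

definition paths :: "(nat, 'e) pre_digraph \<Rightarrow> (nat \<times> 'e list) set" where
  "paths Q = {(u, p). \<exists>v. pre_digraph.awalk Q u p v}"

definition path_algebra ::
    "(nat, 'e) pre_digraph \<Rightarrow> int ring \<Rightarrow> (nat \<times> 'e list \<Rightarrow> int) ring" where
  "path_algebra Q K =
     \<lparr> carrier = {f. (\<forall>x\<in>paths Q. f x \<in> carrier K) \<and> (\<forall>x. x \<notin> paths Q \<longrightarrow> f x = \<zero>\<^bsub>K\<^esub>) \<and>
                     finite {x. f x \<noteq> \<zero>\<^bsub>K\<^esub>}},
       monoid.mult = (\<lambda>f g (u, r). if (u, r) \<in> paths Q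
         then \<Oplus>\<^bsub>K\<^esub>k\<in>{..length r}.
                f (last (pre_digraph.awalk_verts Q u (take k r)), drop k r) \<otimes>\<^bsub>K\<^esub> g (u, take k r)
         else \<zero>\<^bsub>K\<^esub>),
       monoid.one = (\<lambda>(u, r). if u \<in> verts Q \<and> r = [] then \<one>\<^bsub>K\<^esub> else \<zero>\<^bsub>K\<^esub>),
       zero = (\<lambda>x. \<zero>\<^bsub>K\<^esub>),
       add = (\<lambda>f g x. f x \<oplus>\<^bsub>K\<^esub> g x) \<rparr>"

definition vertex_idempotent :: "int ring \<Rightarrow> nat \<Rightarrow> nat \<times> 'e list \<Rightarrow> int" where
  "vertex_idempotent K i = (\<lambda>x. if x = (i, []) then \<one>\<^bsub>K\<^esub> else \<zero>\<^bsub>K\<^esub>)"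

text \<open>
  For a finite field \<open>K\<close>, the \<open>K\<close>-dimension of \<open>e\<^sub>i M\<close> is \<open>\<alpha>\<^sub>i\<close> if and only if \<open>e\<^sub>i M\<close> has
  \<open>|K|\<close> to the power \<open>\<alpha>\<^sub>i\<close> elements.
\<close>

definition has_dimension_vector ::
    "(nat, 'e) pre_digraph \<Rightarrow> int ring \<Rightarrow> (nat \<times> 'e list \<Rightarrow> int, 'b) module \<Rightarrow> (nat \<Rightarrow> int) \<Rightarrow> bool"
  where
  "has_dimension_vector Q K M \<alpha> \<longleftrightarrow> finite (carrier M) \<and>
     (\<forall>i\<in>verts Q. card ((\<lambda>x. vertex_idempotent K i \<odot>\<^bsub>M\<^esub> x) ` carrier M) =
                   card (carrier K) ^ nat (\<alpha> i))"

text \<open>The simple module at the vertex \<open>i\<close>.\<close>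

definition simple_module ::
    "int ring \<Rightarrow> nat \<Rightarrow> (nat \<times> 'e list \<Rightarrow> int, int) module" where
  "simple_module K i = \<lparr> carrier = carrier K, monoid.mult = undefined, monoid.one = undefined,
     zero = \<zero>\<^bsub>K\<^esub>, add = add K, module.smult = (\<lambda>f x. f (i, []) \<otimes>\<^bsub>K\<^esub> x) \<rparr>"

text \<open>$P_i$ and, for a positive root \<open>\<alpha>\<close>, $M_q(\alpha)$; both are unique up to isomorphism.\<close>

definition projective_at ::
    "(nat, 'e) pre_digraph \<Rightarrow> int ring \<Rightarrow> nat \<Rightarrow> (nat \<times> 'e list \<Rightarrow> int, int) module" where
  "projective_at Q K i = fst (proj_cover (path_algebra Q K) (simple_module K i))"

definition module_of_root ::
    "(nat, 'e) pre_digraph \<Rightarrow> int ring \<Rightarrow> (nat \<Rightarrow> int) \<Rightarrow> (nat \<times> 'e list \<Rightarrow> int, int) module" where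
  "module_of_root Q K \<alpha> =
     (SOME M. indecomposable_module (path_algebra Q K) M \<and> has_dimension_vector Q K M \<alpha>)"


section \<open>Hall polynomials\<close>

type_synonym hall_index = "(nat \<Rightarrow> int) + nat \<Rightarrow> nat"

definition hall_indices :: "(nat, 'e) pre_digraph \<Rightarrow> hall_index set" where
  "hall_indices Q = {l. \<forall>x. x \<notin> positive_roots Q <+> verts Q \<longrightarrow> l x = 0}"

text \<open>
  \<open>complex_of_index Q K \<kappa>\<close> is $C_q(\kappa)$ for the field \<open>K\<close> with \<open>q\<close> elements. The summand \<open>(x, k)\<close>
  is the \<open>k\<close>-th of the \<open>\<kappa>(x)\<close> copies of the complex belonging to \<open>x\<close>.
\<close>

definition complex_of_index ::
    "(nat, 'e) pre_digraph \<Rightarrow> int ring \<Rightarrow> hall_index \<Rightarrow>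
     (nat \<times> 'e list \<Rightarrow> int, ((nat \<Rightarrow> int) + nat) \<times> nat \<Rightarrow> int \<times> int) cyclic_complex" where
  "complex_of_index Q K \<kappa> =
     complex_sum {(x, k). x \<in> positive_roots Q <+> verts Q \<and> k < \<kappa> x}
       (\<lambda>(x, k). case x of
            Inl \<alpha> \<Rightarrow> complex_C (path_algebra Q K) (module_of_root Q K \<alpha>)
          | Inr i \<Rightarrow> complex_K (projective_at Q K i))"

text \<open>
  Every finite field is isomorphic to one with carrier in \<^typ>\<open>int\<close>, so the fields below range
  over $\mathbb{F}_q$ for all prime powers \<open>q\<close>.
\<close>

definition finite_field :: "int ring \<Rightarrow> bool" where
  "finite_field K \<longleftrightarrow> field K \<and> finite (carrier K)"

definition is_hall_polynomial ::
    "(nat, 'e) pre_digraph \<Rightarrow> hall_index \<Rightarrow> hall_index \<Rightarrow> hall_index \<Rightarrow> int poly \<Rightarrow> bool" where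
  "is_hall_polynomial Q \<mu> \<nu> \<kappa> \<psi> \<longleftrightarrow> (\<forall>K. finite_field K \<longrightarrow>
     of_int (poly \<psi> (int (card (carrier K)))) =
     hall_number (path_algebra Q K)
       (complex_of_index Q K \<mu>) (complex_of_index Q K \<nu>) (complex_of_index Q K \<kappa>))"

text \<open>
  \<open>hall_polynomial Q \<mu> \<nu> \<kappa>\<close> is $\psi_{\mu\nu}^{\kappa}$. It exists for all elements of
  \<^term>\<open>hall_indices Q\<close>, and it is unique because it is prescribed at infinitely many integers; the
  value \<open>0\<close> only makes the function total.
\<close>

definition hall_polynomial ::
    "(nat, 'e) pre_digraph \<Rightarrow> hall_index \<Rightarrow> hall_index \<Rightarrow> hall_index \<Rightarrow> int poly" where
  "hall_polynomial Q \<mu> \<nu> \<kappa> =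
     (if \<exists>\<psi>. is_hall_polynomial Q \<mu> \<nu> \<kappa> \<psi> then THE \<psi>. is_hall_polynomial Q \<mu> \<nu> \<kappa> \<psi> else 0)"


section \<open>The Lie algebras\<close>

definition indecomposable_indices :: "(nat, 'e) pre_digraph \<Rightarrow> hall_index set" where
  "indecomposable_indices Q = {\<kappa> \<in> hall_indices Q. \<forall>K. finite_field K \<longrightarrow>
     indecomposable_complex (path_algebra Q K) (complex_of_index Q K \<kappa>)}"

definition nonacyclic_indices :: "(nat, 'e) pre_digraph \<Rightarrow> hall_index set" where
  "nonacyclic_indices Q = {\<kappa> \<in> indecomposable_indices Q. \<forall>K. finite_field K \<longrightarrow>
     \<not> acyclic_complex (complex_of_index Q K \<kappa>)}"

text \<open>
  The class $[C_q(\mu)]$ is the basis vector \<open>Poly_Mapping.single \<mu> 1\<close> of the complex vector space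
  of finitely supported functions.
\<close>

definition vscale :: "complex \<Rightarrow> ('a \<Rightarrow>\<^sub>0 complex) \<Rightarrow> ('a \<Rightarrow>\<^sub>0 complex)" where
  "vscale c v = Poly_Mapping.map (\<lambda>z. c * z) v"

definition n_tilde :: "(nat, 'e) pre_digraph \<Rightarrow> (hall_index \<Rightarrow>\<^sub>0 complex) set" where
  "n_tilde Q = Modules.module.span vscale
     ((\<lambda>\<mu>. Poly_Mapping.single \<mu> 1) ` indecomposable_indices Q)"

definition n_tilde_plus :: "(nat, 'e) pre_digraph \<Rightarrow> (hall_index \<Rightarrow>\<^sub>0 complex) set" where
  "n_tilde_plus Q = Modules.module.span vscale
     ((\<lambda>\<mu>. Poly_Mapping.single \<mu> 1) ` nonacyclic_indices Q)"

definition structure_constant ::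
    "(nat, 'e) pre_digraph \<Rightarrow> hall_index \<Rightarrow> hall_index \<Rightarrow> hall_index \<Rightarrow> int" where
  "structure_constant Q \<mu> \<nu> \<kappa> = poly (hall_polynomial Q \<mu> \<nu> \<kappa>) 1 - poly (hall_polynomial Q \<nu> \<mu> \<kappa>) 1"

text \<open>The bracket on basis vectors, and its bilinear extension.\<close>

definition basis_bracket ::
    "(nat, 'e) pre_digraph \<Rightarrow> hall_index \<Rightarrow> hall_index \<Rightarrow> (hall_index \<Rightarrow>\<^sub>0 complex)" where
  "basis_bracket Q \<mu> \<nu> =
     (\<Sum>\<kappa> \<in> {\<kappa> \<in> indecomposable_indices Q. structure_constant Q \<mu> \<nu> \<kappa> \<noteq> 0}.
        Poly_Mapping.single \<kappa> (of_int (structure_constant Q \<mu> \<nu> \<kappa>)))"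

definition bracket ::
    "(nat, 'e) pre_digraph \<Rightarrow> (hall_index \<Rightarrow>\<^sub>0 complex) \<Rightarrow> (hall_index \<Rightarrow>\<^sub>0 complex) \<Rightarrow>
     (hall_index \<Rightarrow>\<^sub>0 complex)" where
  "bracket Q v w =
     (\<Sum>\<mu>\<in>Poly_Mapping.keys v. \<Sum>\<nu>\<in>Poly_Mapping.keys w.
        vscale (Poly_Mapping.lookup v \<mu> * Poly_Mapping.lookup w \<nu>) (basis_bracket Q \<mu> \<nu>))"

definition lie_subalgebra ::
    "(complex \<Rightarrow> 'v \<Rightarrow> 'v) \<Rightarrow> ('v \<Rightarrow> 'v \<Rightarrow> 'v) \<Rightarrow> 'v::ab_group_add set \<Rightarrow> 'v set \<Rightarrow> bool" where
  "lie_subalgebra s br L L' \<longleftrightarrow> L' \<subseteq> L \<and> Modules.module.subspace s L' \<and>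
     (\<forall>x\<in>L'. \<forall>y\<in>L'. br x y \<in> L')"

text \<open>\<open>lower_central s br L k\<close> is the term \<open>L\<^sup>k\<^sup>+\<^sup>1\<close> of the lower central series of \<open>L = L\<^sup>1\<close>.\<close>

primrec lower_central ::
    "(complex \<Rightarrow> 'v \<Rightarrow> 'v) \<Rightarrow> ('v \<Rightarrow> 'v \<Rightarrow> 'v) \<Rightarrow> 'v::ab_group_add set \<Rightarrow> nat \<Rightarrow> 'v set" where
  "lower_central s br L 0 = L"
| "lower_central s br L (Suc k) =
     Modules.module.span s {br x y | x y. x \<in> L \<and> y \<in> lower_central s br L k}"

definition nilpotent ::
    "(complex \<Rightarrow> 'v \<Rightarrow> 'v) \<Rightarrow> ('v \<Rightarrow> 'v \<Rightarrow> 'v) \<Rightarrow> 'v::ab_group_add set \<Rightarrow> bool" where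
  "nilpotent s br L \<longleftrightarrow> (\<exists>k. lower_central s br L k = {0})"

end

theory Submission
  imports Defs "HOL-Number_Theory.Residues"
begin

text \<open>
  The theorem rests on two facts about the classes that can occur in a bracket \<open>[C\<^sub>M, C\<^sub>N]\<close>.

  \<^item> Closure. The homology of \<open>C\<^sub>M\<close> is \<open>M\<close>. If the middle term of a conflation is acyclic, the
  connecting map identifies the homologies of the two outer terms. So an acyclic class can occur
  only if \<open>M\<close> and \<open>N\<close> have the same dimension vector; then they belong to the same root, and the
  bracket of a class with itself vanishes, because the structure constants are antisymmetric.

  \<^item> Grading. Along a conflation the numbers of elements of the underlying modules multiply. There
  are only finitely many classes \<open>C\<^sub>M\<close>, hence finitely many nonzero Hall polynomials between them,
  and some finite field \<open>F\<^sub>q\<close> exists whose order \<open>q\<close> is a root of none of them. Over this field every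
  nonzero Hall polynomial is witnessed by a conflation. Hence \<open>d(\<kappa>) = |C\<^sub>q(\<kappa>)|\<close> satisfies
  \<open>d(\<kappa>) = d(\<mu>) d(\<nu>)\<close> whenever \<open>\<kappa>\<close> occurs in the bracket of \<open>\<mu>\<close> and \<open>\<nu>\<close>. Since \<open>d \<ge> 2\<close>, brackets
  with \<open>k\<close> factors live in degrees at least \<open>2\<^sup>k\<close>; since \<open>d\<close> is bounded, long brackets vanish.
  The two facts are \<open>structure_constant_nonacyclic\<close> and \<open>exists_grading\<close>.

  Both facts need to know what the indecomposable classes are. A direct sum of two nonzero complexes
  decomposes, so an indecomposable index is the indicator function of a root or of a vertex
  (\<open>indecomposable_index\<close>). This requires that none of the summands \<open>C\<^sub>M\<close> and \<open>K\<^sub>P\<close> is degenerate: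
  every positive root has to be the dimension vector of an indecomposable module over every finite
  field, and projective covers have to exist.

  The module of a root \<open>\<alpha>\<close> is found by the argument of Gabriel and Tits, carried out by counting
  (\<open>exists_indecomposable_of_root\<close>). Among all modules of dimension vector \<open>\<alpha>\<close> take one, \<open>M\<close>, with the
  fewest endomorphisms. If \<open>M\<close> is the direct sum of \<open>N\<close> and \<open>N'\<close>, then the middle term of a nonsplit
  extension of these two would have fewer endomorphisms, so all extensions split. Extensions of
  representations are given by cocycles, one linear map for each arrow, modulo coboundaries, which
  come from one linear map for each vertex; if all extensions split, there are at least as many
  families of the second kind as of the first, that is, the Euler form satisfies
  \<open>\<langle>dim N, dim N'\<rangle> \<ge> 0\<close>, and likewise with \<open>N\<close> and \<open>N'\<close> exchanged (\<open>ext_vanishes\<close>). But the Tits form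
  \<open>q(x) = \<langle>x, x\<rangle>\<close> of a Dynkin quiver is positive definite and has the value \<open>1\<close> at every root, so
  \<open>1 = q(\<alpha>) \<ge> q(dim N) + q(dim N') \<ge> 2\<close>, a contradiction.

  Positive definiteness also yields that there are only finitely many roots (\<open>finite_roots\<close>).

  Dimensions, homology and exactness are expressed throughout by numbers of elements. The modules
  are finite, and the identity \<open>|S| = |h(S)| |ker h|\<close> (\<open>card_eq_image_kernel\<close>) takes the place of
  quotient modules and of the rank theorem. To keep track of the vertices, everything is counted
  separately on \<open>e\<^sub>i M\<close> for the idempotent \<open>e\<^sub>i\<close> of each vertex \<open>i\<close>.
\<close>

section \<open>Positive definiteness of the Tits form\<close>

text \<open>
  The Tits form of a line with vertices \<open>1, ..., k\<close>.
\<close>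

definition chain_form :: "nat \<Rightarrow> (nat \<Rightarrow> int) \<Rightarrow> int" where
  "chain_form k y = (\<Sum>i=1..k. (y i)\<^sup>2) - (\<Sum>i=2..k. y i * y (i - 1))"

lemma chain_form_Suc:
  assumes "1 \<le> k"
  shows "chain_form (Suc k) y = chain_form k y + (y (Suc k))\<^sup>2 - y (Suc k) * y k"
  using assms by (simp add: chain_form_def algebra_simps)

text \<open>
  Completing squares from one end of the line gives the minimum \<open>(k + 1) c\<^sup>2 / (2 k)\<close> of the form over the
  reals when the last coordinate is \<open>c\<close>. A star of several lines is treated by adding the minima of its arms,
  glued at the branch vertex.
\<close>

lemma chain_form_bound:
  "1 \<le> k \<Longrightarrow> int (k + 1) * (y k)\<^sup>2 \<le> 2 * int k * chain_form k y"
proof (induction k rule: nat_induct_at_least)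
  case base
  then show ?case by (simp add: chain_form_def)
next
  case (Suc k)
  define x z and K :: int where "x = y k" and "z = y (Suc k)" and "K = int k"
  have K: "K \<ge> 1" using Suc.hyps by (simp add: K_def)
  have IH: "(K + 1) * x\<^sup>2 \<le> 2 * K * chain_form k y"
    using Suc.IH by (simp add: x_def K_def algebra_simps)
  have "(K + 1) * ((K + 1) * x\<^sup>2) \<le> (K + 1) * (2 * K * chain_form k y)"
    using IH K by (intro mult_left_mono) auto
  moreover have "0 \<le> ((K + 1) * x - K * z)\<^sup>2" by simp
  ultimately have "K * ((K + 2) * z\<^sup>2) \<le> K * (2 * (K + 1) * (chain_form k y + z\<^sup>2 - z * x))"
    by (simp add: power2_eq_square algebra_simps)
  then have "(K + 2) * z\<^sup>2 \<le> 2 * (K + 1) * (chain_form k y + z\<^sup>2 - z * x)"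
    using K by (simp add: mult_le_cancel_left)
  then show ?case
    unfolding chain_form_Suc[OF Suc.hyps, of y]
    by (simp add: x_def z_def K_def algebra_simps)
qed

lemma chain_form_nonneg: "1 \<le> k \<Longrightarrow> 0 \<le> chain_form k y"
proof -
  assume k: "1 \<le> k"
  have "0 \<le> 2 * int k * chain_form k y"
    using chain_form_bound[OF k, of y] by (meson order_trans of_nat_0_le_iff zero_le_mult_iff zero_le_power2)
  then show ?thesis using k by (simp add: zero_le_mult_iff)
qed

lemma chain_form_eq_0:
  "1 \<le> k \<Longrightarrow> chain_form k y \<le> 0 \<Longrightarrow> i \<in> {1..k} \<Longrightarrow> y i = 0"
proof (induction k rule: nat_induct_at_least)
  case base
  then show ?case by (simp add: chain_form_def)
next
  case (Suc k)
  have "int (Suc k + 1) * (y (Suc k))\<^sup>2 \<le> 2 * int (Suc k) * chain_form (Suc k) y"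
    by (rule chain_form_bound) simp
  also have "\<dots> \<le> 0" using Suc.prems(1) by (simp add: mult_le_0_iff)
  finally have z: "y (Suc k) = 0" by (simp add: mult_le_0_iff)
  show ?case
  proof (cases "i = Suc k")
    case False
    then show ?thesis
      using Suc chain_form_Suc[OF Suc.hyps, of y] z by simp
  qed (use z in simp)
qed

lemma pos_def_A:
  fixes y :: "nat \<Rightarrow> int"
  assumes "1 \<le> n" "v \<in> {1..n}" "y v \<noteq> 0"
  shows "0 < (\<Sum>v=1..n. (y v)\<^sup>2) - (\<Sum>v=2..n. y v * y (v - 1))"
  using chain_form_eq_0[of n y v] assms unfolding chain_form_def by fastforce

text \<open>
  Let \<open>c\<close> be the coordinate of the branch vertex \<open>n - 2\<close>. Each of the two leaves contributes at least
  \<open>- c\<^sup>2 / 4\<close>, so by the bound for the line of the vertices \<open>1, ..., n - 2\<close> at least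
  \<open>c\<^sup>2 / (2 (n - 2))\<close> is left.
\<close>

lemma pos_def_D:
  fixes y :: "nat \<Rightarrow> int"
  assumes n: "4 \<le> n" and v: "v \<in> {1..n}" "y v \<noteq> 0"
  shows "0 < (\<Sum>v=1..n. (y v)\<^sup>2) - (\<Sum>v=2..n. y v * y (if v = n then n - 2 else v - 1))"
proof (rule ccontr)
  define k where "k = n - 2"
  have nk: "n = Suc (Suc k)" "2 \<le> k" using n by (auto simp: k_def)
  let ?s = "(\<Sum>v=1..n. (y v)\<^sup>2) - (\<Sum>v=2..n. y v * y (if v = n then n - 2 else v - 1))"
  have "(\<Sum>v=2..n. y v * y (if v = n then n - 2 else v - 1)) =
      (\<Sum>v=2..k. y v * y (v - 1)) + y (Suc k) * y k + y n * y k"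
    using nk by (simp add: atLeastAtMostSuc_conv)
  then have s: "?s = chain_form k y + (y (Suc k))\<^sup>2 + (y n)\<^sup>2 - y (Suc k) * y k - y n * y k"
    using nk by (simp add: chain_form_def)
  define c where "c = y k"
  define a b where "a = y (Suc k)" and "b = y n"
  assume "\<not> 0 < ?s"
  then have le: "4 * int k * ?s \<le> 0" using nk by (simp add: mult_le_0_iff)
  have bd: "int (k + 1) * c\<^sup>2 \<le> 2 * int k * chain_form k y"
    unfolding c_def using nk by (intro chain_form_bound) simp
  have "4 * int k * ?s = 2 * (2 * int k * chain_form k y) - 2 * (int k * c\<^sup>2)
      + int k * ((2 * a - c)\<^sup>2 + (2 * b - c)\<^sup>2)"
    unfolding s c_def a_def b_def by (simp add: power2_eq_square algebra_simps)
  then have "2 * c\<^sup>2 + int k * ((2 * a - c)\<^sup>2 + (2 * b - c)\<^sup>2) \<le> 0"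
    using bd le by (simp add: algebra_simps)
  moreover have "0 \<le> int k * ((2 * a - c)\<^sup>2 + (2 * b - c)\<^sup>2)" by simp
  ultimately have c0: "c\<^sup>2 \<le> 0" and "int k * ((2 * a - c)\<^sup>2 + (2 * b - c)\<^sup>2) \<le> 0"
    using zero_le_power2[of c] by linarith+
  then have "(2 * a - c)\<^sup>2 + (2 * b - c)\<^sup>2 \<le> 0" "c = 0"
    using nk by (simp_all add: mult_le_0_iff)
  then have "2 * a = 0 \<and> 2 * b = 0" by (simp only: sum_power2_le_zero_iff diff_0_right)
  then have "a = 0" "b = 0" by simp_all
  then have z: "y (Suc k) = 0" "y n = 0" by (simp_all add: a_def b_def)
  have "chain_form k y \<le> 0" using \<open>\<not> 0 < ?s\<close> unfolding s z by simp
  then have "y i = 0" if "i \<in> {1..k}" for i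
    using chain_form_eq_0[of k y i] nk that by simp
  moreover have "v \<in> {1..k} \<or> v = Suc k \<or> v = n" using v nk by auto
  ultimately show False using v z by auto
qed

text \<open>
  Let \<open>c\<close> be the coordinate of the branch vertex \<open>3\<close>. The vertices \<open>1, 2, 3\<close> and \<open>n - 1, ..., 3\<close> form lines
  with \<open>3\<close> and \<open>n - 3\<close> vertices ending at \<open>3\<close>, and \<open>n\<close> is a leaf. The form is at least
  \<open>(2/3 + (n - 2)/(2 (n - 3)) - 1 - 1/4) c\<^sup>2\<close>, and the factor is positive exactly because \<open>n < 9\<close>.
\<close>

lemma pos_def_E:
  fixes y :: "nat \<Rightarrow> int"
  assumes n: "n \<in> {6, 7, 8}" and v: "v \<in> {1..n}" "y v \<noteq> 0"
  shows "0 < (\<Sum>v=1..n. (y v)\<^sup>2) - (\<Sum>v=2..n. y v * y (if v = n then 3 else v - 1))"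
proof (rule ccontr)
  let ?s = "(\<Sum>v=1..n. (y v)\<^sup>2) - (\<Sum>v=2..n. y v * y (if v = n then 3 else v - 1))"
  let ?r = "\<lambda>i. y (n - i)"
  assume le: "\<not> 0 < ?s"
  have s: "?s = chain_form 3 y + chain_form (n - 3) ?r - (y 3)\<^sup>2 + (y n)\<^sup>2 - y n * y 3"
    using n by (auto simp: chain_form_def eval_nat_numeral algebra_simps)
  define c where "c = y 3"
  have b1: "4 * c\<^sup>2 \<le> 6 * chain_form 3 y"
    using chain_form_bound[of 3 y] by (simp add: c_def)
  have b2: "int (n - 2) * c\<^sup>2 \<le> 2 * int (n - 3) * chain_form (n - 3) ?r"
    using chain_form_bound[of "n - 3" ?r] n by (auto simp: c_def)
  have "0 \<le> (2 * y n - c)\<^sup>2" by simp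
  then have b3: "- (c\<^sup>2) \<le> 4 * ((y n)\<^sup>2 - y n * c)"
    by (simp add: power2_eq_square algebra_simps)
  have le': "chain_form 3 y + chain_form (n - 3) ?r - c\<^sup>2 + (y n)\<^sup>2 - y n * c \<le> 0"
    using le s by (simp add: c_def)
  define C where "C = c\<^sup>2"
  have "C \<le> 0" 
    using n b1 b2 b3 le' unfolding C_def[symmetric] by auto
  then have c0: "c = 0" by (simp add: C_def)
  have nn: "0 \<le> chain_form 3 y" "0 \<le> chain_form (n - 3) ?r"
    using n by (auto intro!: chain_form_nonneg)
  have "(y n)\<^sup>2 \<le> 0" using le' nn unfolding c0 by (simp only: mult_zero_right power_zero_numeral)
  then have yn: "y n = 0" by simp
  have "chain_form 3 y \<le> 0" "chain_form (n - 3) ?r \<le> 0"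
    using le' nn unfolding c0 yn by simp_all
  then have 1: "i \<in> {1..3} \<Longrightarrow> y i = 0" and 2: "j \<in> {1..n-3} \<Longrightarrow> y (n - j) = 0" for i j
    using chain_form_eq_0[of 3 y i] chain_form_eq_0[of "n - 3" ?r j] n by auto
  have "v \<in> {1..3} \<or> v = n \<or> (n - v \<in> {1..n-3} \<and> n - (n - v) = v)" using v by auto
  then show False using 1 2[of "n - v"] yn v by auto
qed

text \<open>
  The three types become one: every vertex except \<open>1\<close> is joined to a single smaller vertex, its
  parent. The type enters in the proof that the form is positive.
\<close>

lemma dynkin_diagram_tree:
  assumes "dynkin_diagram n E"
  obtains par where "1 \<le> n" "\<And>v. v \<in> {2..n} \<Longrightarrow> 1 \<le> par v \<and> par v < v"
    "E = (\<lambda>v. {par v, v}) ` {2..n}"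
    "\<And>(y :: nat \<Rightarrow> int) v. v \<in> {1..n} \<Longrightarrow> y v \<noteq> 0 \<Longrightarrow>
       0 < (\<Sum>v=1..n. (y v)\<^sup>2) - (\<Sum>v=2..n. y v * y (par v))"
proof -
  have chain: "{{i, i + 1} | i. 1 \<le> i \<and> i < m} = (\<lambda>v. {v - 1, v}) ` {2..m}" for m :: nat
  proof safe
    fix i assume "1 \<le> i" "i < m"
    then show "{i, i + 1} \<in> (\<lambda>v. {v - 1, v}) ` {2..m}" 
      by (intro image_eqI[of _ _ "i + 1"]) auto
  next
    fix v assume "v \<in> {2..m}"
    then show "\<exists>i. {v - 1, v} = {i, i + 1} \<and> 1 \<le> i \<and> i < m"
      by (intro exI[of _ "v - 1"]) auto
  qed
  have branch: "insert {k, n} {{i, i + 1} | i. 1 \<le> i \<and> i < n - 1} =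
      (\<lambda>v. {if v = n then k else v - 1, v}) ` {2..n}" if n: "4 \<le> n" for k
  proof -
    have "{2..n} = insert n {2..n - 1}" using n by auto
    moreover have "(\<lambda>v. {if v = n then k else v - 1, v}) ` {2..n - 1} = (\<lambda>v. {v - 1, v}) ` {2..n - 1}"
      using n by (intro image_cong) auto
    ultimately show ?thesis unfolding chain by simp
  qed
  from assms[unfolded dynkin_diagram_def] show ?thesis
  proof (elim disjE)
    assume A: "1 \<le> n \<and> E = {{i, i + 1} | i. 1 \<le> i \<and> i < n}"
    show ?thesis
    proof (rule that[of "\<lambda>v. v - 1"])
      show "E = (\<lambda>v. {v - 1, v}) ` {2..n}" using A chain by simp
      show "0 < (\<Sum>v=1..n. (y v)\<^sup>2) - (\<Sum>v=2..n. y v * y (v - 1))"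
        if "v \<in> {1..n}" "y v \<noteq> 0" for y :: "nat \<Rightarrow> int" and v
        using A that by (intro pos_def_A) auto
    qed (use A[THEN conjunct1] in auto)
  next
    assume D: "4 \<le> n \<and> E = insert {n - 2, n} {{i, i + 1} | i. 1 \<le> i \<and> i < n - 1}"
    show ?thesis
    proof (rule that[of "\<lambda>v. if v = n then n - 2 else v - 1"])
      show "E = (\<lambda>v. {if v = n then n - 2 else v - 1, v}) ` {2..n}" using D branch[of "n - 2"] by (simp only: mult_1)
      show "0 < (\<Sum>v=1..n. (y v)\<^sup>2) - (\<Sum>v=2..n. y v * y (if v = n then n - 2 else v - 1))"
        if "v \<in> {1..n}" "y v \<noteq> 0" for y :: "nat \<Rightarrow> int" and v
        using D that by (intro pos_def_D) auto
    qed (use D[THEN conjunct1] in auto)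
  next
    assume E: "n \<in> {6, 7, 8} \<and> E = insert {3, n} {{i, i + 1} | i. 1 \<le> i \<and> i < n - 1}"
    then have n4: "4 \<le> n" by auto
    show ?thesis
    proof (rule that[of "\<lambda>v. if v = n then 3 else v - 1"])
      show "E = (\<lambda>v. {if v = n then 3 else v - 1, v}) ` {2..n}" using E branch[of 3] n4 by (simp only: mult_1)
      show "0 < (\<Sum>v=1..n. (y v)\<^sup>2) - (\<Sum>v=2..n. y v * y (if v = n then 3 else v - 1))"
        if "v \<in> {1..n}" "y v \<noteq> 0" for y :: "nat \<Rightarrow> int" and v
        using E that by (intro pos_def_E) auto
    qed (use E[THEN conjunct1] in auto)
  qed
qed

definition euler_form :: "(nat, 'e) pre_digraph \<Rightarrow> (nat \<Rightarrow> int) \<Rightarrow> (nat \<Rightarrow> int) \<Rightarrow> int" where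
  "euler_form Q x y =
     (\<Sum>i\<in>verts Q. x i * y i) - (\<Sum>a\<in>arcs Q. x (tail Q a) * y (head Q a))"

text \<open>
  The renumbering \<open>\<sigma>\<close> is the one from the definition of a Dynkin quiver; \<open>par\<close> lives on the new numbers.
\<close>

definition tree_presentation ::
    "(nat, 'e) pre_digraph \<Rightarrow> nat \<Rightarrow> (nat \<Rightarrow> nat) \<Rightarrow> (nat \<Rightarrow> nat) \<Rightarrow> bool" where
  "tree_presentation Q n par \<sigma> \<longleftrightarrow> verts Q = {1..n} \<and> 1 \<le> n \<and> bij_betw \<sigma> (verts Q) {1..n} \<and>
     (\<forall>v\<in>{2..n}. 1 \<le> par v \<and> par v < v) \<and>
     bij_betw (\<lambda>a. {\<sigma> (tail Q a), \<sigma> (head Q a)}) (arcs Q) ((\<lambda>v. {par v, v}) ` {2..n})"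

lemma dynkin_quiver_tree:
  assumes "dynkin_quiver Q"
  shows "\<exists>n par \<sigma>. tree_presentation Q n par \<sigma> \<and> 
    (\<forall>(y :: nat \<Rightarrow> int). \<forall>v\<in>{1..n}. y v \<noteq> 0 \<longrightarrow> 
       0 < (\<Sum>v=1..n. (y v)\<^sup>2) - (\<Sum>v=2..n. y v * y (par v)))"
proof -
  from assms obtain n E \<sigma> where 1: "dynkin_diagram n E" "verts Q = {1..n}" "bij_betw \<sigma> {1..n} {1..n}"
    "bij_betw (\<lambda>a. {\<sigma> (tail Q a), \<sigma> (head Q a)}) (arcs Q) E"
    unfolding dynkin_quiver_def by blast
  show ?thesis
  proof (rule dynkin_diagram_tree[OF 1(1)])
    fix par assume p: "1 \<le> n" "\<And>v. v \<in> {2..n} \<Longrightarrow> 1 \<le> par v \<and> par v < v" "E = (\<lambda>v. {par v, v}) ` {2..n}"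
      and pos: "\<And>(y :: nat \<Rightarrow> int) v. v \<in> {1..n} \<Longrightarrow> y v \<noteq> 0 \<Longrightarrow>
       0 < (\<Sum>v=1..n. (y v)\<^sup>2) - (\<Sum>v=2..n. y v * y (par v))"
    have "tree_presentation Q n par \<sigma>"
      using 1(2,3,4) p by (simp add: tree_presentation_def)
    then show ?thesis using pos by blast
  qed
qed

lemma inj_on_parent_edges:
  fixes par :: "nat \<Rightarrow> nat"
  assumes "\<And>v. v \<in> A \<Longrightarrow> par v < v"
  shows "inj_on (\<lambda>v. {par v, v}) A"
  by (rule inj_onI) (metis assms doubleton_eq_iff less_asym)

lemma dynkin_quiver_facts:
  assumes "dynkin_quiver Q"
  shows "wf_digraph Q" "finite (verts Q)" "finite (arcs Q)" "verts Q \<noteq> {}"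
    "\<And>a. a \<in> arcs Q \<Longrightarrow> tail Q a \<noteq> head Q a"
proof -
  obtain n par \<sigma> where "tree_presentation Q n par \<sigma>"
    using dynkin_quiver_tree[OF assms] by blast
  then have t: "verts Q = {1..n}" "1 \<le> n" "bij_betw \<sigma> (verts Q) {1..n}"
    "\<And>v. v \<in> {2..n} \<Longrightarrow> 1 \<le> par v \<and> par v < v"
    "bij_betw (\<lambda>a. {\<sigma> (tail Q a), \<sigma> (head Q a)}) (arcs Q) ((\<lambda>v. {par v, v}) ` {2..n})"
    by (auto simp: tree_presentation_def)
  show "wf_digraph Q" using assms by (simp add: dynkin_quiver_def)
  show "finite (verts Q)" "verts Q \<noteq> {}" using t by auto
  show "finite (arcs Q)" using bij_betw_finite[OF t(5)] by simp
  show "tail Q a \<noteq> head Q a" if a: "a \<in> arcs Q" for a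
  proof
    assume "tail Q a = head Q a"
    then have "{\<sigma> (head Q a)} \<in> (\<lambda>v. {par v, v}) ` {2..n}"
      using bij_betwE[OF t(5)] a by force
    then show False using t(4) by force
  qed
qed

text \<open>
  The form does not depend on the orientation of the arrows. Writing the product of the coordinates of
  the ends of an arrow as a product over its set of ends makes this visible and allows to reindex the
  arrows by the edges of the tree.
\<close>

lemma tits_pos:
  assumes Q: "dynkin_quiver Q" and "i \<in> verts Q" "x i \<noteq> 0"
  shows "0 < euler_form Q x x"
proof -
  obtain n par \<sigma> where tp: "tree_presentation Q n par \<sigma>"
    and pos: "\<And>(y :: nat \<Rightarrow> int) v. v \<in> {1..n} \<Longrightarrow> y v \<noteq> 0 \<Longrightarrow>
       0 < (\<Sum>v=1..n. (y v)\<^sup>2) - (\<Sum>v=2..n. y v * y (par v))"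
    using dynkin_quiver_tree[OF Q] by blast
  from tp have t: "verts Q = {1..n}" "1 \<le> n" "bij_betw \<sigma> (verts Q) {1..n}"
    "\<And>v. v \<in> {2..n} \<Longrightarrow> 1 \<le> par v \<and> par v < v"
    "bij_betw (\<lambda>a. {\<sigma> (tail Q a), \<sigma> (head Q a)}) (arcs Q) ((\<lambda>v. {par v, v}) ` {2..n})"
    by (auto simp: tree_presentation_def)
  interpret wf_digraph Q by (rule dynkin_quiver_facts[OF Q])
  define y where "y = x \<circ> the_inv_into (verts Q) \<sigma>"
  have y\<sigma>: "y (\<sigma> i) = x i" if "i \<in> verts Q" for i
    using that t(3) by (simp add: y_def the_inv_into_f_f bij_betw_def)
  have s1: "(\<Sum>i\<in>verts Q. x i * x i) = (\<Sum>v=1..n. (y v)\<^sup>2)"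
    using sum.reindex_bij_betw[OF t(3), of "\<lambda>v. (y v)\<^sup>2"] y\<sigma> by (simp add: power2_eq_square)
  have "(\<Sum>a\<in>arcs Q. x (tail Q a) * x (head Q a)) =
      (\<Sum>a\<in>arcs Q. \<Prod>v\<in>{\<sigma> (tail Q a), \<sigma> (head Q a)}. y v)"
  proof (rule sum.cong)
    fix a assume a: "a \<in> arcs Q"
    then have "\<sigma> (tail Q a) \<noteq> \<sigma> (head Q a)"
      using t(3) dynkin_quiver_facts(5)[OF Q a] wellformed[OF a]
      by (auto simp: bij_betw_def inj_on_def)
    then show "x (tail Q a) * x (head Q a) = (\<Prod>v\<in>{\<sigma> (tail Q a), \<sigma> (head Q a)}. y v)"
      using a by (simp add: y\<sigma>)
  qed simp
  also have "\<dots> = (\<Sum>S\<in>(\<lambda>v. {par v, v}) ` {2..n}. \<Prod>v\<in>S. y v)"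
    by (rule sum.reindex_bij_betw[OF t(5)])
  also have "\<dots> = (\<Sum>v=2..n. \<Prod>v\<in>{par v, v}. y v)"
    using t(4) by (subst sum.reindex) (auto intro!: inj_on_parent_edges)
  also have "\<dots> = (\<Sum>v=2..n. y v * y (par v))"
  proof (rule sum.cong)
    fix v assume "v \<in> {2..n}"
    then have "par v \<noteq> v" using t(4) by fastforce
    then show "(\<Prod>v\<in>{par v, v}. y v) = y v * y (par v)" by simp
  qed simp
  finally show ?thesis
    unfolding euler_form_def s1 using pos[rule_format, of "\<sigma> i" y] assms(2,3) y\<sigma> bij_betwE[OF t(3)]
    by simp
qed

section \<open>Roots\<close>

lemma euler_form_diff_left:
  "euler_form Q (\<lambda>i. x i - z i) y = euler_form Q x y - euler_form Q z y"
  by (simp add: euler_form_def left_diff_distrib sum_subtractf)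
lemma euler_form_diff_right:
  "euler_form Q y (\<lambda>i. x i - z i) = euler_form Q y x - euler_form Q y z"
  by (simp add: euler_form_def right_diff_distrib sum_subtractf)
lemma euler_form_add_left:
  "euler_form Q (\<lambda>i. x i + z i) y = euler_form Q x y + euler_form Q z y"
  by (simp add: euler_form_def distrib_right sum.distrib)
lemma euler_form_add_right:
  "euler_form Q y (\<lambda>i. x i + z i) = euler_form Q y x + euler_form Q y z"
  by (simp add: euler_form_def distrib_left sum.distrib)
lemma euler_form_scale_left:
  "euler_form Q (\<lambda>i. c * x i) y = c * euler_form Q x y"
  by (simp add: euler_form_def right_diff_distrib sum_distrib_left mult.assoc)
lemma euler_form_scale_right:
  "euler_form Q y (\<lambda>i. c * x i) = c * euler_form Q y x"
  by (simp add: euler_form_def right_diff_distrib sum_distrib_left mult.left_commute)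

definition simple_root :: "nat \<Rightarrow> nat \<Rightarrow> int" where
  "simple_root i = (\<lambda>j. if j = i then 1 else 0)"

text \<open>
  A row of the Cartan matrix pairs with the simple root through the symmetrised Euler form. Hence the
  simple reflections are isometries of the Tits form.
\<close>

lemma cartan_sum:
  assumes Q: "dynkin_quiver Q" and i: "i \<in> verts Q"
  shows "(\<Sum>j\<in>verts Q. cartan Q i j * x j) =
    euler_form Q (simple_root i) x + euler_form Q x (simple_root i)"
proof -
  note fin = dynkin_quiver_facts[OF Q]
  interpret wf_digraph Q by (rule fin)
  let ?t = "\<lambda>a. (if tail Q a = i then x (head Q a) else 0) + (if head Q a = i then x (tail Q a) else 0)"
  have "(\<Sum>j\<in>verts Q. cartan Q i j * x j) = 
     2 * x i - (\<Sum>j\<in>verts Q - {i}. \<Sum>a\<in>{a \<in> arcs Q. {tail Q a, head Q a} = {i, j}}. x j)"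
    using fin(2) i by (simp add: sum.remove[of _ i] cartan_def sum_negf)
  also have "(\<Sum>j\<in>verts Q - {i}. \<Sum>a\<in>{a \<in> arcs Q. {tail Q a, head Q a} = {i, j}}. x j) =
     (\<Sum>j\<in>verts Q - {i}. \<Sum>a\<in>arcs Q. if {tail Q a, head Q a} = {i, j} then x j else 0)"
    using fin(3) by (simp only: sum.inter_filter)
  also have "\<dots> = (\<Sum>a\<in>arcs Q. \<Sum>j\<in>verts Q - {i}. if {tail Q a, head Q a} = {i, j} then x j else 0)"
    by (rule sum.swap)
  also have "\<dots> = (\<Sum>a\<in>arcs Q. ?t a)"
  proof (rule sum.cong)
    fix a assume a: "a \<in> arcs Q"
    have ne: "tail Q a \<noteq> head Q a" by (rule fin(5)[OF a])
    consider "tail Q a = i" | "head Q a = i" | "tail Q a \<noteq> i" "head Q a \<noteq> i" by blast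
    then show "(\<Sum>j\<in>verts Q - {i}. if {tail Q a, head Q a} = {i, j} then x j else 0) = ?t a"
    proof cases
      case 1
      then have "(\<Sum>j\<in>verts Q - {i}. if {tail Q a, head Q a} = {i, j} then x j else 0) =
        (\<Sum>j\<in>verts Q - {i}. if j = head Q a then x j else 0)"
        using ne by (intro sum.cong) (auto simp: doubleton_eq_iff)
      then show ?thesis using 1 ne a fin(2) by auto
    next
      case 2
      then have "(\<Sum>j\<in>verts Q - {i}. if {tail Q a, head Q a} = {i, j} then x j else 0) =
        (\<Sum>j\<in>verts Q - {i}. if j = tail Q a then x j else 0)"
        using ne by (intro sum.cong) (auto simp: doubleton_eq_iff)
      then show ?thesis using 2 ne a fin(2) by auto
    next
      case 3
      then have "{tail Q a, head Q a} \<noteq> {i, j}" for j by (auto simp: doubleton_eq_iff)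
      then show ?thesis using 3 by simp
    qed
  qed simp
  also have "2 * x i - (\<Sum>a\<in>arcs Q. ?t a) = 
      euler_form Q (simple_root i) x + euler_form Q x (simple_root i)"
    using fin(2) i
    by (simp add: euler_form_def simple_root_def sum.distrib if_distrib[of "\<lambda>t. t * _"]
      if_distrib[of "\<lambda>t. _ * t"] cong: if_cong)
  finally show ?thesis .
qed

lemma simple_reflection_eq:
  assumes "dynkin_quiver Q" "i \<in> verts Q"
  shows "simple_reflection Q i x =
    (\<lambda>j. x j - (euler_form Q (simple_root i) x + euler_form Q x (simple_root i)) * simple_root i j)"
  unfolding simple_reflection_def cartan_sum[OF assms] by (auto simp: simple_root_def)

lemma tits_simple_root:
  assumes "dynkin_quiver Q" "i \<in> verts Q"
  shows "euler_form Q (simple_root i) (simple_root i) = 1"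
proof -
  note fin = dynkin_quiver_facts[OF assms(1)]
  have "(\<Sum>a\<in>arcs Q. simple_root i (tail Q a) * simple_root i (head Q a)) = 0"
    using fin(5) by (intro sum.neutral) (force simp: simple_root_def)
  then show ?thesis using fin(2) assms(2)
    by (simp add: euler_form_def) (simp add: simple_root_def if_distrib[of "\<lambda>t. t * _"] cong: if_cong)
qed

lemma tits_root:
  assumes Q: "dynkin_quiver Q" and "x \<in> roots Q"
  shows "euler_form Q x x = 1"
  using assms(2)
proof induction
  case (simple_root i)
  then show ?case using tits_simple_root[OF Q] by (simp add: simple_root_def)
next
  case (reflection x i)
  then show ?case
    by (simp del: mult_minus_left add: simple_reflection_eq[OF Q] euler_form_diff_left euler_form_diff_right
      euler_form_scale_left euler_form_scale_right tits_simple_root[OF Q])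
      (simp add: algebra_simps)
qed

lemma euler_form_expand:
  assumes "dynkin_quiver Q"
  shows "(\<Sum>i\<in>verts Q. x i * euler_form Q (simple_root i) y) = euler_form Q x y"
    "(\<Sum>i\<in>verts Q. x i * euler_form Q y (simple_root i)) = euler_form Q y x"
proof -
  note fin = dynkin_quiver_facts[OF assms(1)]
  interpret wf_digraph Q by (rule fin)
  have "(\<Sum>i\<in>verts Q. \<Sum>a\<in>arcs Q. x i * (simple_root i (tail Q a) * y (head Q a))) =
      (\<Sum>a\<in>arcs Q. x (tail Q a) * y (head Q a))"
    "(\<Sum>i\<in>verts Q. \<Sum>a\<in>arcs Q. x i * (y (tail Q a) * simple_root i (head Q a))) =
      (\<Sum>a\<in>arcs Q. y (tail Q a) * x (head Q a))"
    using fin(2) by (subst sum.swap, auto intro!: sum.cong simp: simple_root_def 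
      if_distrib[of "\<lambda>t. t * _"] if_distrib[of "\<lambda>t. _ * t"] cong: if_cong)+
  moreover have "(\<Sum>i\<in>verts Q. x i * y i) = (\<Sum>i\<in>verts Q. y i * x i)"
    by (simp add: mult.commute)
  ultimately show "(\<Sum>i\<in>verts Q. x i * euler_form Q (simple_root i) y) = euler_form Q x y"
    "(\<Sum>i\<in>verts Q. x i * euler_form Q y (simple_root i)) = euler_form Q y x"
    using fin(2) by (simp_all add: euler_form_def right_diff_distrib sum_subtractf sum_distrib_left)
      (simp_all add: simple_root_def if_distrib[of "\<lambda>t. t * _"] if_distrib[of "\<lambda>t. _ * t"] cong: if_cong)
qed

lemma root_support:
  "x \<in> roots Q \<Longrightarrow> i \<notin> verts Q \<Longrightarrow> x i = 0"
  by (induction rule: roots.induct) (auto simp: simple_reflection_def)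

text \<open>
  A root \<open>x\<close> is determined by its pairings \<open>b x i\<close> with the simple roots, because the form is
  nondegenerate, and each pairing lies between \<open>-2\<close> and \<open>2\<close>, because the form is nonnegative on the sum
  and on the difference of the two roots.
\<close>

lemma finite_roots:
  assumes Q: "dynkin_quiver Q"
  shows "finite (roots Q)"
proof -
  note fin = dynkin_quiver_facts[OF assms(1)]
  define b where "b x i = euler_form Q (simple_root i) x + euler_form Q x (simple_root i)" for x i
  have nonneg: "0 \<le> euler_form Q x x" for x
  proof (cases "\<exists>i\<in>verts Q. x i \<noteq> 0")
    case False
    interpret wf_digraph Q by (rule fin)
    from False show ?thesis by (simp add: euler_form_def)
  qed (use tits_pos[OF Q] in force)
  have "b x i \<in> {-2..2}" if "x \<in> roots Q" "i \<in> verts Q" for x i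
    using nonneg[of "\<lambda>j. x j - simple_root i j"] nonneg[of "\<lambda>j. x j + simple_root i j"]
      tits_root[OF Q that(1)] tits_simple_root[OF Q that(2)]
    by (simp add: b_def euler_form_diff_left euler_form_diff_right
      euler_form_add_left euler_form_add_right)
  then have "(\<lambda>x. restrict (b x) (verts Q)) ` roots Q \<subseteq> (\<Pi>\<^sub>E i\<in>verts Q. {-2..2})"
    by auto
  then have "finite ((\<lambda>x. restrict (b x) (verts Q)) ` roots Q)"
    by (rule finite_subset) (simp add: finite_PiE fin)
  moreover have "inj_on (\<lambda>x. restrict (b x) (verts Q)) (roots Q)"
  proof (rule inj_onI, rule ext)
    fix x y j assume xy: "x \<in> roots Q" "y \<in> roots Q" "restrict (b x) (verts Q) = restrict (b y) (verts Q)"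
    define z where "z = (\<lambda>i. x i - y i)"
    have bz: "b z i = 0" if "i \<in> verts Q" for i
      using fun_cong[OF xy(3), of i] that
      by (simp add: b_def z_def euler_form_diff_left euler_form_diff_right)
    have "2 * euler_form Q z z = (\<Sum>i\<in>verts Q. z i * b z i)"
      unfolding b_def using euler_form_expand[OF Q, of z z]
      by (simp add: distrib_left sum.distrib)
    also have "\<dots> = 0" using bz by simp
    finally have "\<not> 0 < euler_form Q z z" by simp
    then have "j \<in> verts Q \<Longrightarrow> z j = 0" using tits_pos[OF Q] by blast
    then show "x j = y j" using root_support[OF xy(1)] root_support[OF xy(2)]
      by (cases "j \<in> verts Q") (auto simp: z_def)
  qed
  ultimately show ?thesis using finite_imageD by blast
qed

section \<open>Paths\<close>

text \<open>
  A recursive form of the walks that define paths; it is indexed by the start vertex only.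
\<close>

fun is_path :: "(nat, 'e) pre_digraph \<Rightarrow> nat \<Rightarrow> 'e list \<Rightarrow> bool" where
  "is_path Q u [] \<longleftrightarrow> u \<in> verts Q"
| "is_path Q u (a # p) \<longleftrightarrow> a \<in> arcs Q \<and> tail Q a = u \<and> is_path Q (head Q a) p"

lemma paths_iff: 
  assumes "wf_digraph Q"
  shows "(u, p) \<in> paths Q \<longleftrightarrow> is_path Q u p"
proof -
  interpret wf_digraph Q by fact
  have "(\<exists>v. awalk u p v) \<longleftrightarrow> is_path Q u p"
    for u p
  proof (induction p arbitrary: u)
    case (Cons a p)
    show ?case by (auto simp add: awalk_Cons_iff Cons[symmetric])
  next
    case (Nil u)
    show ?case by (auto simp: awalk_Nil_iff)
  qed
  then show ?thesis by (simp add: paths_def)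
qed

text \<open>
  On a tree one can choose heights such that every arrow rises by \<open>1\<close>: extend the heights from the
  vertices up to \<open>m\<close> to the vertex \<open>m + 1\<close>, which is joined to only one smaller vertex. Such a height
  bounds the lengths of the paths.
\<close>

lemma tree_potential:
  assumes "tree_presentation Q n par \<sigma>" "wf_digraph Q"
  shows "\<exists>h :: nat \<Rightarrow> int. \<forall>a\<in>arcs Q. h (head Q a) = h (tail Q a) + 1"
proof -
  interpret wf_digraph Q by fact
  have t: "bij_betw \<sigma> (verts Q) {1..n}" "\<And>v. v \<in> {2..n} \<Longrightarrow> 1 \<le> par v \<and> par v < v"
    "bij_betw (\<lambda>a. {\<sigma> (tail Q a), \<sigma> (head Q a)}) (arcs Q) ((\<lambda>v. {par v, v}) ` {2..n})"
    using assms(1) by (auto simp: tree_presentation_def)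
  have edge: "\<exists>v\<in>{2..n}. {\<sigma> (tail Q a), \<sigma> (head Q a)} = {par v, v}" if "a \<in> arcs Q" for a
    using bij_betwE[OF t(3)] that by blast
  have uniq: "a = b" if "a \<in> arcs Q" "b \<in> arcs Q"
    "{\<sigma> (tail Q a), \<sigma> (head Q a)} = {\<sigma> (tail Q b), \<sigma> (head Q b)}" for a b
    using t(3) that by (auto simp: bij_betw_def inj_on_def)
  have "\<exists>h :: nat \<Rightarrow> int. \<forall>a\<in>arcs Q. \<sigma> (tail Q a) \<le> m \<and> \<sigma> (head Q a) \<le> m \<longrightarrow>
      h (\<sigma> (head Q a)) = h (\<sigma> (tail Q a)) + 1" for m
  proof (induction m)
    case 0
    have "\<not> (\<sigma> (tail Q a) \<le> 0 \<and> \<sigma> (head Q a) \<le> 0)" if "a \<in> arcs Q" for a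
      using edge[OF that] t(2) by (auto simp: doubleton_eq_iff)
    then show ?case by blast
  next
    case (Suc m)
    then obtain h :: "nat \<Rightarrow> int" where h: "\<And>a. a \<in> arcs Q \<Longrightarrow> \<sigma> (tail Q a) \<le> m \<Longrightarrow> \<sigma> (head Q a) \<le> m \<Longrightarrow>
      h (\<sigma> (head Q a)) = h (\<sigma> (tail Q a)) + 1" by blast
    show ?case
    proof (cases "\<exists>a\<in>arcs Q. {\<sigma> (tail Q a), \<sigma> (head Q a)} = {par (Suc m), Suc m} \<and> Suc m \<in> {2..n}")
      case False
      have "\<sigma> (tail Q a) \<le> m \<and> \<sigma> (head Q a) \<le> m" 
        if a: "a \<in> arcs Q" "\<sigma> (tail Q a) \<le> Suc m" "\<sigma> (head Q a) \<le> Suc m" for a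
      proof -
        obtain v where v: "v \<in> {2..n}" "{\<sigma> (tail Q a), \<sigma> (head Q a)} = {par v, v}"
          using edge a(1) by blast
        then have "v \<noteq> Suc m" using False a(1) by blast
        moreover have "v \<in> {\<sigma> (tail Q a), \<sigma> (head Q a)}" using v by blast
        ultimately have "v \<le> m" using a by auto
        then show ?thesis using v(2) t(2)[OF v(1)] by (auto simp: doubleton_eq_iff)
      qed
      then show ?thesis using h by blast
    next
      case True
      then obtain b where b: "b \<in> arcs Q" "{\<sigma> (tail Q b), \<sigma> (head Q b)} = {par (Suc m), Suc m}"
        "Suc m \<in> {2..n}" by blast
      have par: "par (Suc m) \<le> m" using t(2)[OF b(3)] by simp
      define h' where "h' = h(Suc m := if \<sigma> (head Q b) = Suc m then h (par (Suc m)) + 1 else h (par (Suc m)) - 1)"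
      have "h' (\<sigma> (head Q a)) = h' (\<sigma> (tail Q a)) + 1"
        if a: "a \<in> arcs Q" "\<sigma> (tail Q a) \<le> Suc m" "\<sigma> (head Q a) \<le> Suc m" for a
      proof (cases "\<sigma> (tail Q a) \<le> m \<and> \<sigma> (head Q a) \<le> m")
        case True
        then show ?thesis using h[OF a(1)] by (simp add: h'_def)
      next
        case False
        obtain v where v: "v \<in> {2..n}" "{\<sigma> (tail Q a), \<sigma> (head Q a)} = {par v, v}" using edge[OF a(1)] by blast
        have "v = Suc m" using False v t(2)[OF v(1)] a by (auto simp: doubleton_eq_iff)
        then have "a = b" using uniq[OF a(1) b(1)] v b by simp
        then show ?thesis using b(2) par by (auto simp: h'_def doubleton_eq_iff)
      qed
      then show ?thesis by blast
    qed
  qed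
  from this[of n] obtain h :: "nat \<Rightarrow> int" where h: "\<And>a. a \<in> arcs Q \<Longrightarrow> \<sigma> (tail Q a) \<le> n \<Longrightarrow> \<sigma> (head Q a) \<le> n \<Longrightarrow>
      h (\<sigma> (head Q a)) = h (\<sigma> (tail Q a)) + 1" by blast
  have "\<sigma> v \<le> n" if "v \<in> verts Q" for v using bij_betwE[OF t(1)] that by auto
  then show ?thesis using h by (intro exI[of _ "h \<circ> \<sigma>"]) simp
qed

lemma finite_paths:
  assumes "dynkin_quiver Q"
  shows "finite (paths Q)"
proof -
  note fin = dynkin_quiver_facts[OF assms(1)]
  interpret wf_digraph Q by (rule fin)
  obtain h :: "nat \<Rightarrow> int" where h: "\<And>a. a \<in> arcs Q \<Longrightarrow> h (head Q a) = h (tail Q a) + 1"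
    using dynkin_quiver_tree[OF assms] tree_potential fin(1) by metis
  define H where "H = Max (h ` verts Q)"
  have H: "h v \<le> H" if "v \<in> verts Q" for v using that fin(2) by (simp add: H_def)
  have len: "h u + int (length p) \<le> H" if "is_path Q u p" for u p
    using that by (induction p arbitrary: u) (force simp: H h)+
  define N where "N = nat (H - Min (h ` verts Q))"
  have "paths Q \<subseteq> verts Q \<times> {p. set p \<subseteq> arcs Q \<and> length p \<le> N}"
  proof safe
    fix u p assume "(u, p) \<in> paths Q"
    then have p: "is_path Q u p" by (simp add: paths_iff fin)
    then show u: "u \<in> verts Q" by (cases p) auto
    show "x \<in> arcs Q" if "x \<in> set p" for x using p that by (induction p arbitrary: u) auto
    have "Min (h ` verts Q) \<le> h u" using u fin(2) by simp
    then show "length p \<le> N" using len[OF p] by (simp add: N_def)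
  qed
  then show ?thesis
    by (rule finite_subset) (simp add: fin finite_lists_length_le)
qed

section \<open>Left modules\<close>

text \<open>
  Negatives are multiples by \<open>-1\<close> as soon as the zero of the ring acts as zero; so this last hypothesis
  takes the place of the existence of inverses.
\<close>

lemma left_moduleI:
  fixes R (structure) and M (structure)
  assumes "ring R"
    and "\<And>x y. \<lbrakk> x \<in> carrier M; y \<in> carrier M \<rbrakk> \<Longrightarrow> x \<oplus>\<^bsub>M\<^esub> y \<in> carrier M"
    and "\<zero>\<^bsub>M\<^esub> \<in> carrier M"
    and "\<And>x y z. \<lbrakk> x \<in> carrier M; y \<in> carrier M; z \<in> carrier M \<rbrakk> \<Longrightarrow> (x \<oplus>\<^bsub>M\<^esub> y) \<oplus>\<^bsub>M\<^esub> z = x \<oplus>\<^bsub>M\<^esub> (y \<oplus>\<^bsub>M\<^esub> z)"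
    and "\<And>x y. \<lbrakk> x \<in> carrier M; y \<in> carrier M \<rbrakk> \<Longrightarrow> x \<oplus>\<^bsub>M\<^esub> y = y \<oplus>\<^bsub>M\<^esub> x"
    and "\<And>x. x \<in> carrier M \<Longrightarrow> \<zero>\<^bsub>M\<^esub> \<oplus>\<^bsub>M\<^esub> x = x"
    and closed: "\<And>a x. \<lbrakk> a \<in> carrier R; x \<in> carrier M \<rbrakk> \<Longrightarrow> a \<odot>\<^bsub>M\<^esub> x \<in> carrier M"
    and ld: "\<And>a b x. \<lbrakk> a \<in> carrier R; b \<in> carrier R; x \<in> carrier M \<rbrakk> \<Longrightarrow>
        (a \<oplus> b) \<odot>\<^bsub>M\<^esub> x = a \<odot>\<^bsub>M\<^esub> x \<oplus>\<^bsub>M\<^esub> b \<odot>\<^bsub>M\<^esub> x"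
    and "\<And>a x y. \<lbrakk> a \<in> carrier R; x \<in> carrier M; y \<in> carrier M \<rbrakk> \<Longrightarrow>
        a \<odot>\<^bsub>M\<^esub> (x \<oplus>\<^bsub>M\<^esub> y) = a \<odot>\<^bsub>M\<^esub> x \<oplus>\<^bsub>M\<^esub> a \<odot>\<^bsub>M\<^esub> y"
    and "\<And>a b x. \<lbrakk> a \<in> carrier R; b \<in> carrier R; x \<in> carrier M \<rbrakk> \<Longrightarrow>
        (a \<otimes> b) \<odot>\<^bsub>M\<^esub> x = a \<odot>\<^bsub>M\<^esub> (b \<odot>\<^bsub>M\<^esub> x)"
    and one: "\<And>x. x \<in> carrier M \<Longrightarrow> \<one> \<odot>\<^bsub>M\<^esub> x = x"
    and null: "\<And>x. x \<in> carrier M \<Longrightarrow> \<zero> \<odot>\<^bsub>M\<^esub> x = \<zero>\<^bsub>M\<^esub>"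
  shows "left_module R M"
proof -
  interpret R: ring R by fact
  have "abelian_group M"
  proof (rule abelian_groupI)
    fix x assume x: "x \<in> carrier M"
    have "(\<ominus> \<one>) \<odot>\<^bsub>M\<^esub> x \<oplus>\<^bsub>M\<^esub> x = (\<ominus> \<one> \<oplus> \<one>) \<odot>\<^bsub>M\<^esub> x"
      using x ld[of "\<ominus> \<one>" \<one> x] one by simp
    also have "\<dots> = \<zero>\<^bsub>M\<^esub>" using x null by (simp add: R.l_neg)
    finally show "\<exists>y\<in>carrier M. y \<oplus>\<^bsub>M\<^esub> x = \<zero>\<^bsub>M\<^esub>"
      using closed[of "\<ominus> \<one>" x] x by auto
  qed (use assms in auto)
  then show ?thesis
    using assms by (intro left_module.intro left_module_axioms.intro) auto
qed

context left_module
begin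

lemma smult_l_null [simp]:
  assumes "x \<in> carrier M" shows "\<zero> \<odot>\<^bsub>M\<^esub> x = \<zero>\<^bsub>M\<^esub>"
proof -
  have "\<zero> \<odot>\<^bsub>M\<^esub> x \<oplus>\<^bsub>M\<^esub> \<zero> \<odot>\<^bsub>M\<^esub> x = \<zero> \<odot>\<^bsub>M\<^esub> x"
    using smult_l_distr[of \<zero> \<zero> x] assms by simp
  then show ?thesis using smult_closed[of \<zero> x] assms by (metis M.add.r_cancel_one' R.zero_closed)
qed

lemma smult_r_null [simp]:
  assumes "a \<in> carrier R" shows "a \<odot>\<^bsub>M\<^esub> \<zero>\<^bsub>M\<^esub> = \<zero>\<^bsub>M\<^esub>"
proof -
  have "a \<odot>\<^bsub>M\<^esub> \<zero>\<^bsub>M\<^esub> \<oplus>\<^bsub>M\<^esub> a \<odot>\<^bsub>M\<^esub> \<zero>\<^bsub>M\<^esub> = a \<odot>\<^bsub>M\<^esub> \<zero>\<^bsub>M\<^esub>"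
    using smult_r_distr[of a "\<zero>\<^bsub>M\<^esub>" "\<zero>\<^bsub>M\<^esub>"] assms by simp
  then show ?thesis using smult_closed[of a "\<zero>\<^bsub>M\<^esub>"] assms by (metis M.add.r_cancel_one' M.zero_closed)
qed

lemma neg_eq_smult:
  assumes "x \<in> carrier M" shows "\<ominus>\<^bsub>M\<^esub> x = (\<ominus> \<one>) \<odot>\<^bsub>M\<^esub> x"
proof -
  have "(\<ominus> \<one>) \<odot>\<^bsub>M\<^esub> x \<oplus>\<^bsub>M\<^esub> x = (\<ominus> \<one> \<oplus> \<one>) \<odot>\<^bsub>M\<^esub> x"
    using assms smult_l_distr[of "\<ominus> \<one>" \<one> x] smult_one by simp
  then show ?thesis using assms smult_closed[of "\<ominus> \<one>" x] by (simp add: R.l_neg M.minus_equality)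
qed

lemma smult_minus:
  assumes "a \<in> carrier R" "x \<in> carrier M" shows "a \<odot>\<^bsub>M\<^esub> (\<ominus>\<^bsub>M\<^esub> x) = \<ominus>\<^bsub>M\<^esub> (a \<odot>\<^bsub>M\<^esub> x)"
proof -
  have "a \<odot>\<^bsub>M\<^esub> (\<ominus>\<^bsub>M\<^esub> x) \<oplus>\<^bsub>M\<^esub> a \<odot>\<^bsub>M\<^esub> x = \<zero>\<^bsub>M\<^esub>"
    using assms smult_r_distr[of a "\<ominus>\<^bsub>M\<^esub> x" x] by (simp add: M.l_neg)
  then show ?thesis using assms smult_closed M.minus_equality by simp
qed

lemma submodule_iff:
  "submodule N R M \<longleftrightarrow> N \<subseteq> carrier M \<and> \<zero>\<^bsub>M\<^esub> \<in> N \<and> (\<forall>x\<in>N. \<forall>y\<in>N. x \<oplus>\<^bsub>M\<^esub> y \<in> N) \<and>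
     (\<forall>a\<in>carrier R. \<forall>x\<in>N. a \<odot>\<^bsub>M\<^esub> x \<in> N)"
proof
  assume N: "submodule N R M"
  interpret submodule N R M by fact
  show "N \<subseteq> carrier M \<and> \<zero>\<^bsub>M\<^esub> \<in> N \<and> (\<forall>x\<in>N. \<forall>y\<in>N. x \<oplus>\<^bsub>M\<^esub> y \<in> N) \<and>
     (\<forall>a\<in>carrier R. \<forall>x\<in>N. a \<odot>\<^bsub>M\<^esub> x \<in> N)"
    using subset one_closed m_closed smult_closed by auto
next
  assume N: "N \<subseteq> carrier M \<and> \<zero>\<^bsub>M\<^esub> \<in> N \<and> (\<forall>x\<in>N. \<forall>y\<in>N. x \<oplus>\<^bsub>M\<^esub> y \<in> N) \<and>
     (\<forall>a\<in>carrier R. \<forall>x\<in>N. a \<odot>\<^bsub>M\<^esub> x \<in> N)"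
  have "\<ominus>\<^bsub>M\<^esub> x \<in> N" if "x \<in> N" for x
    using N that neg_eq_smult[of x] by auto
  then show "submodule N R M"
    using N by (intro submodule.intro subgroup.intro submodule_axioms.intro) (auto simp: a_inv_def)
qed

lemma submoduleD:
  assumes "submodule N R M"
  shows "N \<subseteq> carrier M" "\<zero>\<^bsub>M\<^esub> \<in> N" "\<And>x. x \<in> N \<Longrightarrow> x \<in> carrier M" 
    "\<And>x y. x \<in> N \<Longrightarrow> y \<in> N \<Longrightarrow> x \<oplus>\<^bsub>M\<^esub> y \<in> N"
    "\<And>a x. a \<in> carrier R \<Longrightarrow> x \<in> N \<Longrightarrow> a \<odot>\<^bsub>M\<^esub> x \<in> N"
  using assms unfolding submodule_iff by auto

lemma submodule_neg:
  "submodule N R M \<Longrightarrow> x \<in> N \<Longrightarrow> \<ominus>\<^bsub>M\<^esub> x \<in> N"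
  unfolding submodule_iff by (subst neg_eq_smult) auto

lemma left_module_submodule:
  assumes "submodule N R M"
  shows "left_module R (M\<lparr>carrier := N\<rparr>)"
  using assms unfolding submodule_iff
  by (intro left_moduleI)
    (auto simp: R.ring_axioms smult_one smult_assoc smult_l_distr smult_r_distr M.add.m_ac subset_iff)

end

lemma mod_homI:
  assumes "f \<in> extensional (carrier M)" "\<And>x. x \<in> carrier M \<Longrightarrow> f x \<in> carrier N"
    "\<And>x y. x \<in> carrier M \<Longrightarrow> y \<in> carrier M \<Longrightarrow> f (x \<oplus>\<^bsub>M\<^esub> y) = f x \<oplus>\<^bsub>N\<^esub> f y"
    "\<And>a x. a \<in> carrier R \<Longrightarrow> x \<in> carrier M \<Longrightarrow> f (a \<odot>\<^bsub>M\<^esub> x) = a \<odot>\<^bsub>N\<^esub> f x"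
  shows "f \<in> mod_hom R M N"
  using assms by (auto simp: mod_hom_def hom_def)

lemma mod_hom_restrictI:
  assumes "\<And>x. x \<in> carrier M \<Longrightarrow> f x \<in> carrier N"
    "\<And>x y. x \<in> carrier M \<Longrightarrow> y \<in> carrier M \<Longrightarrow> f (x \<oplus>\<^bsub>M\<^esub> y) = f x \<oplus>\<^bsub>N\<^esub> f y"
    "\<And>a x. a \<in> carrier R \<Longrightarrow> x \<in> carrier M \<Longrightarrow> f (a \<odot>\<^bsub>M\<^esub> x) = a \<odot>\<^bsub>N\<^esub> f x"
    "left_module R M"
  shows "restrict f (carrier M) \<in> mod_hom R M N"
proof -
  interpret left_module R M by fact
  show ?thesis using assms by (intro mod_homI) (auto simp: smult_closed)
qed

lemma mod_homD:
  assumes "f \<in> mod_hom R M N"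
  shows "f \<in> extensional (carrier M)" "\<And>x. x \<in> carrier M \<Longrightarrow> f x \<in> carrier N"
    "\<And>x y. x \<in> carrier M \<Longrightarrow> y \<in> carrier M \<Longrightarrow> f (x \<oplus>\<^bsub>M\<^esub> y) = f x \<oplus>\<^bsub>N\<^esub> f y"
    "\<And>a x. a \<in> carrier R \<Longrightarrow> x \<in> carrier M \<Longrightarrow> f (a \<odot>\<^bsub>M\<^esub> x) = a \<odot>\<^bsub>N\<^esub> f x"
  using assms by (auto simp: mod_hom_def hom_def)

lemma mod_hom_zero:
  assumes "f \<in> mod_hom R M N" "left_module R M" "left_module R N"
  shows "f \<zero>\<^bsub>M\<^esub> = \<zero>\<^bsub>N\<^esub>"
proof -
  interpret M: left_module R M by fact
  interpret N: left_module R N by fact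
  have "f (\<zero>\<^bsub>R\<^esub> \<odot>\<^bsub>M\<^esub> \<zero>\<^bsub>M\<^esub>) = \<zero>\<^bsub>R\<^esub> \<odot>\<^bsub>N\<^esub> f \<zero>\<^bsub>M\<^esub>"
    by (rule mod_homD(4)[OF assms(1)]) auto
  then show ?thesis using mod_homD(2)[OF assms(1)] by simp
qed

lemma mod_hom_neg:
  assumes "f \<in> mod_hom R M N" "left_module R M" "left_module R N" "x \<in> carrier M"
  shows "f (\<ominus>\<^bsub>M\<^esub> x) = \<ominus>\<^bsub>N\<^esub> f x"
proof -
  interpret M: left_module R M by fact
  interpret N: left_module R N by fact
  show ?thesis
    using mod_homD(2,4)[OF assms(1)] assms(4) by (simp add: M.neg_eq_smult N.neg_eq_smult)
qed

lemma mod_hom_minus: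
  assumes "f \<in> mod_hom R M N" "left_module R M" "left_module R N" "x \<in> carrier M" "y \<in> carrier M"
  shows "f (x \<ominus>\<^bsub>M\<^esub> y) = f x \<ominus>\<^bsub>N\<^esub> f y"
proof -
  interpret M: left_module R M by fact
  show ?thesis
    using mod_hom_neg[OF assms(1-3,5)] mod_homD(3)[OF assms(1)] assms(4,5) by (simp add: a_minus_def)
qed

lemma mod_hom_comp:
  assumes "f \<in> mod_hom R M N" "g \<in> mod_hom R N L" "left_module R M"
  shows "restrict (\<lambda>x. g (f x)) (carrier M) \<in> mod_hom R M L"
  by (intro mod_hom_restrictI) (simp_all add: mod_homD[OF assms(1)] mod_homD[OF assms(2)] assms(3))

lemma mod_hom_id:
  assumes "left_module R M"
  shows "restrict (\<lambda>x. x) (carrier M) \<in> mod_hom R M M"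
  using assms by (intro mod_hom_restrictI) auto

lemma mod_hom_eqI:
  assumes "f \<in> mod_hom R M N" "g \<in> mod_hom R M N" "\<And>x. x \<in> carrier M \<Longrightarrow> f x = g x"
  shows "f = g"
  using assms(1,2)[THEN mod_homD(1)] assms(3) by (rule extensionalityI)

lemma finite_mod_hom:
  assumes "finite (carrier M)" "finite (carrier N)"
  shows "finite (mod_hom R M N)"
proof (rule finite_subset)
  show "mod_hom R M N \<subseteq> (\<Pi>\<^sub>E x\<in>carrier M. carrier N)"
    by (auto simp: PiE_def dest: mod_homD(1,2))
qed (use assms in \<open>simp add: finite_PiE\<close>)

lemma submodule_image:
  assumes "f \<in> mod_hom R M N" "left_module R M" "left_module R N" "submodule S R M"
  shows "submodule (f ` S) R N"
proof -
  interpret M: left_module R M by fact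
  interpret N: left_module R N by fact
  have S: "S \<subseteq> carrier M" "\<zero>\<^bsub>M\<^esub> \<in> S" "\<And>x y. x \<in> S \<Longrightarrow> y \<in> S \<Longrightarrow> x \<oplus>\<^bsub>M\<^esub> y \<in> S"
    "\<And>a x. a \<in> carrier R \<Longrightarrow> x \<in> S \<Longrightarrow> a \<odot>\<^bsub>M\<^esub> x \<in> S"
    using assms(4) unfolding M.submodule_iff by auto
  note f = mod_homD[OF assms(1)]
  show ?thesis
    unfolding N.submodule_iff
  proof (intro conjI ballI)
    show "\<zero>\<^bsub>N\<^esub> \<in> f ` S" using S(2) mod_hom_zero[OF assms(1-3)] by (metis imageI)
    show "x \<oplus>\<^bsub>N\<^esub> y \<in> f ` S" if xy: "x \<in> f ` S" "y \<in> f ` S" for x y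
    proof -
      obtain s t where st: "s \<in> S" "t \<in> S" "x = f s" "y = f t" using xy by blast
      then have "f (s \<oplus>\<^bsub>M\<^esub> t) = x \<oplus>\<^bsub>N\<^esub> y" using f(3)[of s t] S(1) by blast
      then show ?thesis using S(3)[OF st(1,2)] by (metis imageI)
    qed
    show "a \<odot>\<^bsub>N\<^esub> x \<in> f ` S" if ax: "a \<in> carrier R" "x \<in> f ` S" for a x
    proof -
      obtain s where s: "s \<in> S" "x = f s" using ax by blast
      then have "f (a \<odot>\<^bsub>M\<^esub> s) = a \<odot>\<^bsub>N\<^esub> x" using f(4)[of a s] S(1) ax by blast
      then show ?thesis using S(4)[OF ax(1) s(1)] by (metis imageI)
    qed
  qed (use S(1) f(2) in auto)
qed

lemma submodule_carrier: "left_module R M \<Longrightarrow> submodule (carrier M) R M"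
proof -
  assume "left_module R M"
  then interpret left_module R M .
  show ?thesis unfolding submodule_iff by (auto simp: smult_closed)
qed

lemma submodule_zero: "left_module R M \<Longrightarrow> submodule {\<zero>\<^bsub>M\<^esub>} R M"
proof -
  assume "left_module R M"
  then interpret left_module R M .
  show ?thesis unfolding submodule_iff by (auto simp: smult_closed)
qed

lemma submodule_ker:
  assumes "f \<in> mod_hom R M N" "left_module R M" "left_module R N"
  shows "submodule (mod_ker M N f) R M"
proof -
  interpret M: left_module R M by fact
  interpret N: left_module R N by fact
  show ?thesis
    unfolding M.submodule_iff mod_ker_def
    by (simp add: M.smult_closed mod_homD(2,3,4)[OF assms(1)] mod_hom_zero[OF assms] subset_iff)
qed

section \<open>Counting with images and kernels\<close>

text \<open>
  All nonempty fibres of \<open>h\<close> on \<open>S\<close> are cosets of its kernel. The map is only required to be additive on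
  the subgroup \<open>S\<close>; this applies to the differential, to the maps of a conflation and to projections
  alike.
\<close>

lemma card_eq_image_kernel:
  assumes "abelian_group A" "abelian_group B" "subgroup S (add_monoid A)" "finite S"
    "\<And>x. x \<in> S \<Longrightarrow> h x \<in> carrier B"
    "\<And>x y. x \<in> S \<Longrightarrow> y \<in> S \<Longrightarrow> h (x \<oplus>\<^bsub>A\<^esub> y) = h x \<oplus>\<^bsub>B\<^esub> h y"
  shows "card S = card (h ` S) * card {x \<in> S. h x = \<zero>\<^bsub>B\<^esub>}"
proof -
  interpret A: abelian_group A by fact
  interpret B: abelian_group B by fact
  interpret S: subgroup S "add_monoid A" by fact
  have sub: "x \<in> carrier A" if "x \<in> S" for x using S.subset that by auto
  have neg: "\<ominus>\<^bsub>A\<^esub> x \<in> S" if "x \<in> S" for x using S.m_inv_closed[OF that] by (simp add: a_inv_def)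
  have cl: "x \<oplus>\<^bsub>A\<^esub> y \<in> S" if "x \<in> S" "y \<in> S" for x y using S.m_closed that by simp
  have z: "\<zero>\<^bsub>A\<^esub> \<in> S" using S.one_closed by simp
  have "h \<zero>\<^bsub>A\<^esub> \<oplus>\<^bsub>B\<^esub> h \<zero>\<^bsub>A\<^esub> = h \<zero>\<^bsub>A\<^esub>" using assms(6)[OF z z] by simp
  then have h0: "h \<zero>\<^bsub>A\<^esub> = \<zero>\<^bsub>B\<^esub>"
    using B.r_neg1[OF assms(5)[OF z] assms(5)[OF z]] B.l_neg[OF assms(5)[OF z]] by simp
  have fib: "card {x \<in> S. h x = b} = card {x \<in> S. h x = \<zero>\<^bsub>B\<^esub>}" if b: "b \<in> h ` S" for b
  proof -
    obtain x0 where x0: "x0 \<in> S" "b = h x0" using b by blast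
    have hn: "h (\<ominus>\<^bsub>A\<^esub> x0) \<oplus>\<^bsub>B\<^esub> h x0 = \<zero>\<^bsub>B\<^esub>"
      using assms(6)[OF neg[OF x0(1)] x0(1)] A.l_neg[OF sub[OF x0(1)]] h0 by simp
    have "bij_betw (\<lambda>k. x0 \<oplus>\<^bsub>A\<^esub> k) {x \<in> S. h x = \<zero>\<^bsub>B\<^esub>} {x \<in> S. h x = b}"
    proof (rule bij_betw_byWitness[where f' = "\<lambda>x. \<ominus>\<^bsub>A\<^esub> x0 \<oplus>\<^bsub>A\<^esub> x"])
      show "(\<lambda>k. x0 \<oplus>\<^bsub>A\<^esub> k) ` {x \<in> S. h x = \<zero>\<^bsub>B\<^esub>} \<subseteq> {x \<in> S. h x = b}"
        using assms(5) by (auto simp: x0 assms(6) cl)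
      show "(\<lambda>x. \<ominus>\<^bsub>A\<^esub> x0 \<oplus>\<^bsub>A\<^esub> x) ` {x \<in> S. h x = b} \<subseteq> {x \<in> S. h x = \<zero>\<^bsub>B\<^esub>}"
        using hn by (auto simp: x0 assms(6) cl neg)
    qed (simp_all add: A.r_neg2 A.r_neg1 sub x0(1))
    then show ?thesis by (rule bij_betw_same_card[symmetric])
  qed
  have "card S = (\<Sum>b\<in>h ` S. card {x \<in> S. h x = b})"
    using sum.image_gen[OF assms(4), of "\<lambda>_. 1 :: nat" h] by simp
  also have "\<dots> = (\<Sum>b\<in>h ` S. card {x \<in> S. h x = \<zero>\<^bsub>B\<^esub>})"
    using fib by (rule sum.cong[OF refl])
  finally show ?thesis by simp
qed

lemma card_le_image_fibre:
  assumes "finite S" "finite (h ` S)" "\<And>b. b \<in> h ` S \<Longrightarrow> card {x \<in> S. h x = b} \<le> c"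
  shows "card S \<le> card (h ` S) * c"
proof -
  have "card S = (\<Sum>b\<in>h ` S. card {x \<in> S. h x = b})"
    using sum.image_gen[OF assms(1), of "\<lambda>_. 1 :: nat" h] by simp
  also have "\<dots> \<le> (\<Sum>b\<in>h ` S. c)" using assms(3) by (rule sum_mono)
  finally show ?thesis by simp
qed

section \<open>Transport of structure and direct sums\<close>

text \<open>
  Projectivity and the module of a root only speak of modules whose elements are integers. Modules
  that are constructed from pairs or from ring elements are moved there along an injection.
\<close>

definition transport :: "('b \<Rightarrow> 'c) \<Rightarrow> ('a, 'b) module \<Rightarrow> ('a, 'c) module" where
  "transport \<phi> M = (let \<psi> = inv_into (carrier M) \<phi> in
     \<lparr> carrier = \<phi> ` carrier M, monoid.mult = undefined, monoid.one = undefined,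
       zero = \<phi> \<zero>\<^bsub>M\<^esub>, add = (\<lambda>x y. \<phi> (\<psi> x \<oplus>\<^bsub>M\<^esub> \<psi> y)),
       module.smult = (\<lambda>a x. \<phi> (a \<odot>\<^bsub>M\<^esub> \<psi> x)) \<rparr>)"

lemma transport_simps:
  assumes "inj_on \<phi> (carrier M)"
  shows "carrier (transport \<phi> M) = \<phi> ` carrier M"
    "\<zero>\<^bsub>transport \<phi> M\<^esub> = \<phi> \<zero>\<^bsub>M\<^esub>"
    "\<And>x y. x \<in> carrier M \<Longrightarrow> y \<in> carrier M \<Longrightarrow> \<phi> x \<oplus>\<^bsub>transport \<phi> M\<^esub> \<phi> y = \<phi> (x \<oplus>\<^bsub>M\<^esub> y)"
    "\<And>a x. x \<in> carrier M \<Longrightarrow> a \<odot>\<^bsub>transport \<phi> M\<^esub> \<phi> x = \<phi> (a \<odot>\<^bsub>M\<^esub> x)"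
  using assms by (simp_all add: transport_def Let_def)

lemma left_module_transport:
  assumes "left_module R M" "inj_on \<phi> (carrier M)"
  shows "left_module R (transport \<phi> M)"
proof -
  interpret left_module R M by fact
  show ?thesis
    by (rule left_moduleI)
      (auto simp: transport_simps[OF assms(2)] R.ring_axioms smult_closed smult_one smult_assoc
        smult_l_distr smult_r_distr M.add.m_ac)
qed

lemma transport_hom:
  assumes "left_module R M" "inj_on \<phi> (carrier M)"
  shows "restrict \<phi> (carrier M) \<in> mod_hom R M (transport \<phi> M)"
    "restrict (inv_into (carrier M) \<phi>) (carrier (transport \<phi> M)) \<in> mod_hom R (transport \<phi> M) M"
proof -
  interpret left_module R M by fact
  show "restrict \<phi> (carrier M) \<in> mod_hom R M (transport \<phi> M)"
    by (rule mod_hom_restrictI) (auto simp: transport_simps[OF assms(2)] assms)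
  show "restrict (inv_into (carrier M) \<phi>) (carrier (transport \<phi> M)) \<in> mod_hom R (transport \<phi> M) M"
    by (rule mod_hom_restrictI)
      (auto simp: transport_simps[OF assms(2)] left_module_transport[OF assms] assms(2) smult_closed)
qed

lemma finite_inj_int:
  assumes "finite A"
  obtains \<phi> :: "'b \<Rightarrow> int" where "inj_on \<phi> A"
proof -
  obtain f :: "'b \<Rightarrow> nat" where "inj_on f A"
    using finite_imp_inj_to_nat_seg[OF assms] by blast
  then have "inj_on (int \<circ> f) A" by (simp add: comp_inj_on inj_on_subset[OF inj_of_nat])
  then show ?thesis by (rule that)
qed

lemma mod_sum_simps [simp]:
  "carrier (mod_sum M N) = carrier M \<times> carrier N"
  "\<zero>\<^bsub>mod_sum M N\<^esub> = (\<zero>\<^bsub>M\<^esub>, \<zero>\<^bsub>N\<^esub>)"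
  "(x, y) \<oplus>\<^bsub>mod_sum M N\<^esub> (x', y') = (x \<oplus>\<^bsub>M\<^esub> x', y \<oplus>\<^bsub>N\<^esub> y')"
  "a \<odot>\<^bsub>mod_sum M N\<^esub> (x, y) = (a \<odot>\<^bsub>M\<^esub> x, a \<odot>\<^bsub>N\<^esub> y)"
  by (simp_all add: mod_sum_def)

lemma left_module_mod_sum:
  assumes "left_module R M" "left_module R N"
  shows "left_module R (mod_sum M N)"
proof -
  interpret M: left_module R M by fact
  interpret N: left_module R N by fact
  show ?thesis
    by (rule left_moduleI)
      (auto simp: M.R.ring_axioms M.smult_closed M.smult_one M.smult_assoc M.smult_l_distr 
        M.smult_r_distr N.smult_closed N.smult_one N.smult_assoc N.smult_l_distr N.smult_r_distr
        M.M.add.m_ac N.M.add.m_ac)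
qed

definition regular_module :: "'a ring \<Rightarrow> ('a, 'a) module" where
  "regular_module R = \<lparr> carrier = carrier R, monoid.mult = undefined, monoid.one = undefined,
     zero = \<zero>\<^bsub>R\<^esub>, add = add R, module.smult = monoid.mult R \<rparr>"

lemma regular_module_simps [simp]:
  "carrier (regular_module R) = carrier R" "\<zero>\<^bsub>regular_module R\<^esub> = \<zero>\<^bsub>R\<^esub>"
  "x \<oplus>\<^bsub>regular_module R\<^esub> y = x \<oplus>\<^bsub>R\<^esub> y" "a \<odot>\<^bsub>regular_module R\<^esub> x = a \<otimes>\<^bsub>R\<^esub> x"
  by (simp_all add: regular_module_def)

lemma left_module_regular:
  assumes "ring R" shows "left_module R (regular_module R)"
proof -
  interpret ring R by fact
  show ?thesis
    by (rule left_moduleI) (auto simp: assms add.m_ac l_distr r_distr m_assoc)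
qed

section \<open>Projective modules and projective covers\<close>

text \<open>
  Projectivity for a module with elements of any type, so that it can be proved for the ring itself
  and for direct sums before these are transported.
\<close>

definition lifting_property :: "'a ring \<Rightarrow> ('a, 'b) module \<Rightarrow> bool" where
  "lifting_property R P \<longleftrightarrow>
     (\<forall>(M :: ('a, int) module) (N :: ('a, int) module) g f.
        left_module R M \<and> left_module R N \<and> g \<in> mod_hom R M N \<and> g ` carrier M = carrier N \<and>
        f \<in> mod_hom R P N \<longrightarrow>
        (\<exists>h\<in>mod_hom R P M. \<forall>x\<in>carrier P. g (h x) = f x))"

lemma projective_module_iff:
  "projective_module R P \<longleftrightarrow> left_module R P \<and> lifting_property R P"
  by (simp add: projective_module_def lifting_property_def)

lemma lifting_propertyD:
  fixes M N :: "('a, int) module"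
  assumes "lifting_property R P" "left_module R M" "left_module R N" "g \<in> mod_hom R M N"
    "g ` carrier M = carrier N" "f \<in> mod_hom R P N"
  obtains h where "h \<in> mod_hom R P M" "\<And>x. x \<in> carrier P \<Longrightarrow> g (h x) = f x"
proof -
  have "\<exists>h\<in>mod_hom R P M. \<forall>x\<in>carrier P. g (h x) = f x"
    using assms(1)[unfolded lifting_property_def, rule_format, of M N g f] assms(2-6) by simp
  then show ?thesis using that by auto
qed

lemma lifting_property_retract:
  fixes P :: "('a, 'b) module" and P' :: "('a, 'c) module"
  assumes "lifting_property R P" "left_module R P" "left_module R P'" 
    "i \<in> mod_hom R P' P" "r \<in> mod_hom R P P'" "\<And>x. x \<in> carrier P' \<Longrightarrow> r (i x) = x"
  shows "lifting_property R P'"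
  unfolding lifting_property_def
proof (intro allI impI, elim conjE)
  fix M N :: "('a, int) module" and g f
  assume *: "left_module R M" "left_module R N" "g \<in> mod_hom R M N" "g ` carrier M = carrier N"
    "f \<in> mod_hom R P' N"
  obtain h where h: "h \<in> mod_hom R P M" "\<And>x. x \<in> carrier P \<Longrightarrow> g (h x) = restrict (\<lambda>x. f (r x)) (carrier P) x"
    using lifting_propertyD[OF assms(1) *(1-4) mod_hom_comp[OF assms(5) *(5) assms(2)]] by blast
  show "\<exists>h\<in>mod_hom R P' M. \<forall>x\<in>carrier P'. g (h x) = f x"
  proof (rule bexI[OF _ mod_hom_comp[OF assms(4) h(1) assms(3)]])
    show "\<forall>x\<in>carrier P'. g (restrict (\<lambda>x. h (i x)) (carrier P') x) = f x"
      using h(2) mod_homD(2)[OF assms(4)] assms(6) by simp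
  qed
qed

lemma lifting_property_transport:
  assumes "lifting_property R P" "left_module R P" "inj_on \<phi> (carrier P)"
  shows "lifting_property R (transport \<phi> P)"
  by (rule lifting_property_retract[OF assms(1,2) left_module_transport[OF assms(2,3)]
     transport_hom(2)[OF assms(2,3)] transport_hom(1)[OF assms(2,3)]])
    (use assms(3) in \<open>auto simp: transport_simps\<close>)

lemma lifting_property_zero:
  assumes "left_module R P" "carrier P = {\<zero>\<^bsub>P\<^esub>}"
  shows "lifting_property R P"
  unfolding lifting_property_def
proof (intro allI impI, elim conjE)
  fix M N :: "('a, int) module" and g f
  assume *: "left_module R M" "left_module R N" "g \<in> mod_hom R M N" "g ` carrier M = carrier N"
    "f \<in> mod_hom R P N"
  interpret P: left_module R P by fact
  interpret M: left_module R M by fact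
  have z: "\<zero>\<^bsub>P\<^esub> \<oplus>\<^bsub>P\<^esub> \<zero>\<^bsub>P\<^esub> = \<zero>\<^bsub>P\<^esub>" "\<And>a. a \<in> carrier R \<Longrightarrow> a \<odot>\<^bsub>P\<^esub> \<zero>\<^bsub>P\<^esub> = \<zero>\<^bsub>P\<^esub>" by simp_all
  have "restrict (\<lambda>x. \<zero>\<^bsub>M\<^esub>) (carrier P) \<in> mod_hom R P M"
    by (rule mod_hom_restrictI) (simp_all add: assms(1))
  moreover have "g \<zero>\<^bsub>M\<^esub> = f \<zero>\<^bsub>P\<^esub>"
    using mod_hom_zero[OF *(3,1,2)] mod_hom_zero[OF *(5) assms(1) *(2)] by simp
  ultimately show "\<exists>h\<in>mod_hom R P M. \<forall>x\<in>carrier P. g (h x) = f x"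
    using assms(2) by (intro bexI[of _ "restrict (\<lambda>x. \<zero>\<^bsub>M\<^esub>) (carrier P)"]) simp_all
qed

lemma orbit_hom:
  assumes "left_module R M" "m \<in> carrier M"
  shows "restrict (\<lambda>r. r \<odot>\<^bsub>M\<^esub> m) (carrier R) \<in> mod_hom R (regular_module R) M"
proof -
  interpret M: left_module R M by fact
  show ?thesis
    using mod_hom_restrictI[of "regular_module R" "\<lambda>r. r \<odot>\<^bsub>M\<^esub> m" M R] left_module_regular[OF M.R.ring_axioms]
    by (simp add: M.smult_closed M.smult_l_distr M.smult_assoc assms(2))
qed

lemma lifting_property_regular:
  assumes "ring R"
  shows "lifting_property R (regular_module R)"
  unfolding lifting_property_def
proof (intro allI impI, elim conjE)
  fix M N :: "('a, int) module" and g f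
  assume *: "left_module R M" "left_module R N" "g \<in> mod_hom R M N" "g ` carrier M = carrier N"
    "f \<in> mod_hom R (regular_module R) N"
  interpret R: ring R by fact
  have "f \<one>\<^bsub>R\<^esub> \<in> carrier N" using mod_homD(2)[OF *(5)] by simp
  then obtain m where m: "m \<in> carrier M" "g m = f \<one>\<^bsub>R\<^esub>" using *(4) by (metis imageE)
  have "g (r \<odot>\<^bsub>M\<^esub> m) = f r" if "r \<in> carrier R" for r
    using mod_homD(4)[OF *(3) that m(1)] mod_homD(4)[OF *(5) that, of "\<one>\<^bsub>R\<^esub>"] m(2) that by simp
  then show "\<exists>h\<in>mod_hom R (regular_module R) M. \<forall>x\<in>carrier (regular_module R). g (h x) = f x"
    by (intro bexI[OF _ orbit_hom[OF *(1) m(1)]]) simp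
qed

lemma sum_hom:
  assumes "left_module R P" "left_module R P'" "left_module R M" "h \<in> mod_hom R P M" "h' \<in> mod_hom R P' M"
  shows "restrict (\<lambda>(x, y). h x \<oplus>\<^bsub>M\<^esub> h' y) (carrier P \<times> carrier P') \<in> mod_hom R (mod_sum P P') M"
proof -
  interpret M: left_module R M by fact
  have "restrict (\<lambda>(x, y). h x \<oplus>\<^bsub>M\<^esub> h' y) (carrier (mod_sum P P')) \<in> mod_hom R (mod_sum P P') M"
    by (rule mod_hom_restrictI)
      (auto simp: mod_homD(2-4)[OF assms(4)] mod_homD(2-4)[OF assms(5)] M.smult_r_distr M.add.m_ac
       left_module_mod_sum[OF assms(1,2)])
  then show ?thesis by simp
qed

lemma inl_hom:
  assumes "left_module R P" "left_module R P'"
  shows "restrict (\<lambda>x. (x, \<zero>\<^bsub>P'\<^esub>)) (carrier P) \<in> mod_hom R P (mod_sum P P')"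
    "restrict (\<lambda>x. (\<zero>\<^bsub>P\<^esub>, x)) (carrier P') \<in> mod_hom R P' (mod_sum P P')"
proof -
  interpret P: left_module R P by fact
  interpret P': left_module R P' by fact
  show "restrict (\<lambda>x. (x, \<zero>\<^bsub>P'\<^esub>)) (carrier P) \<in> mod_hom R P (mod_sum P P')"
    "restrict (\<lambda>x. (\<zero>\<^bsub>P\<^esub>, x)) (carrier P') \<in> mod_hom R P' (mod_sum P P')"
    by (rule mod_hom_restrictI; simp add: assms)+
qed

lemma lifting_property_mod_sum:
  fixes P :: "('a, 'b) module" and P' :: "('a, 'c) module"
  assumes "left_module R P" "left_module R P'" "lifting_property R P" "lifting_property R P'"
  shows "lifting_property R (mod_sum P P')"
  unfolding lifting_property_def
proof (intro allI impI, elim conjE)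
  fix M N :: "('a, int) module" and g f
  assume *: "left_module R M" "left_module R N" "g \<in> mod_hom R M N" "g ` carrier M = carrier N"
    "f \<in> mod_hom R (mod_sum P P') N"
  interpret P: left_module R P by fact
  interpret P': left_module R P' by fact
  obtain h where h: "h \<in> mod_hom R P M" "\<And>x. x \<in> carrier P \<Longrightarrow> g (h x) = f (x, \<zero>\<^bsub>P'\<^esub>)"
    by (rule lifting_propertyD[OF assms(3) *(1-4) mod_hom_comp[OF inl_hom(1)[OF assms(1,2)] *(5) assms(1)]]) simp
  obtain h' where h': "h' \<in> mod_hom R P' M" "\<And>x. x \<in> carrier P' \<Longrightarrow> g (h' x) = f (\<zero>\<^bsub>P\<^esub>, x)"
    by (rule lifting_propertyD[OF assms(4) *(1-4) mod_hom_comp[OF inl_hom(2)[OF assms(1,2)] *(5) assms(2)]]) simp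
  have "g (h x \<oplus>\<^bsub>M\<^esub> h' y) = f (x, y)" if "x \<in> carrier P" "y \<in> carrier P'" for x y
    using mod_homD(3)[OF *(3) mod_homD(2)[OF h(1) that(1)] mod_homD(2)[OF h'(1) that(2)]]
      mod_homD(3)[OF *(5), of "(x, \<zero>\<^bsub>P'\<^esub>)" "(\<zero>\<^bsub>P\<^esub>, y)"] that h(2) h'(2) by simp
  then show "\<exists>h\<in>mod_hom R (mod_sum P P') M. \<forall>x\<in>carrier (mod_sum P P'). g (h x) = f x"
    by (intro bexI[OF _ sum_hom[OF assms(1,2) *(1) h(1) h'(1)]]) auto
qed

text \<open>
  Adjoin the elements of \<open>M\<close> one at a time: each needs one more copy of the ring. The sum is transported
  to the integers in each step, so that the type does not grow.
\<close>

lemma exists_finite_projective_onto: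
  fixes M :: "('a, int) module"
  assumes "left_module R M" "finite (carrier R)" "finite (carrier M)"
  shows "\<exists>(P :: ('a, int) module) p. projective_module R P \<and> finite (carrier P) \<and> p \<in> mod_hom R P M \<and>
    p ` carrier P = carrier M"
proof -
  interpret M: left_module R M by fact
  have "\<exists>(P :: ('a, int) module) p. projective_module R P \<and> finite (carrier P) \<and> p \<in> mod_hom R P M \<and>
    X \<subseteq> p ` carrier P" if "finite X" "X \<subseteq> carrier M" for X
    using that
  proof induction
    case empty
    let ?Z = "M\<lparr>carrier := {\<zero>\<^bsub>M\<^esub>}\<rparr>"
    have Z: "left_module R ?Z" by (rule M.left_module_submodule[OF submodule_zero[OF assms(1)]])
    have "restrict (\<lambda>x. x) (carrier ?Z) \<in> mod_hom R ?Z M"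
      by (rule mod_hom_restrictI[OF _ _ _ Z]) simp_all
    moreover have "projective_module R ?Z"
      unfolding projective_module_iff using Z lifting_property_zero[OF Z] by simp
    ultimately show ?case by (intro exI[of _ ?Z]) auto
  next
    case (insert m X)
    then obtain P :: "('a, int) module" and p where P: "left_module R P" "lifting_property R P" "finite (carrier P)"
      "p \<in> mod_hom R P M" "X \<subseteq> p ` carrier P" unfolding projective_module_iff by auto
    interpret P: left_module R P by fact
    have m: "m \<in> carrier M" using insert by simp
    let ?F = "regular_module R"
    let ?S = "mod_sum P ?F"
    have F: "left_module R ?F" by (rule left_module_regular[OF M.R.ring_axioms])
    have S: "left_module R ?S" by (rule left_module_mod_sum[OF P(1) F])
    have finS: "finite (carrier ?S)" using P(3) assms(2) by simp
    then obtain \<phi> :: "_ \<Rightarrow> int" where \<phi>: "inj_on \<phi> (carrier ?S)" by (rule finite_inj_int)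
    let ?P' = "transport \<phi> ?S"
    define s where "s = restrict (\<lambda>(x, y). p x \<oplus>\<^bsub>M\<^esub> restrict (\<lambda>r. r \<odot>\<^bsub>M\<^esub> m) (carrier R) y) (carrier P \<times> carrier ?F)"
    have s: "s \<in> mod_hom R ?S M"
      unfolding s_def by (rule sum_hom[OF P(1) F assms(1) P(4) orbit_hom[OF assms(1) m]])
    define p' where "p' = restrict (\<lambda>x. s (restrict (inv_into (carrier ?S) \<phi>) (carrier ?P') x)) (carrier ?P')"
    have p': "p' \<in> mod_hom R ?P' M"
      unfolding p'_def by (rule mod_hom_comp[OF transport_hom(2)[OF S \<phi>] s left_module_transport[OF S \<phi>]])
    have s_in: "s z \<in> p' ` carrier ?P'" if "z \<in> carrier ?S" for z
      using that \<phi> by (intro image_eqI[of _ _ "\<phi> z"]) (simp_all add: p'_def transport_simps[OF \<phi>])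
    have "insert m X \<subseteq> p' ` carrier ?P'"
    proof safe
      have "s (\<zero>\<^bsub>P\<^esub>, \<one>\<^bsub>R\<^esub>) = m"
        using mod_hom_zero[OF P(4,1) assms(1)] m by (simp add: s_def M.smult_one)
      then show "m \<in> p' ` carrier ?P'" using s_in[of "(\<zero>\<^bsub>P\<^esub>, \<one>\<^bsub>R\<^esub>)"] by simp
    next
      fix x assume "x \<in> X"
      then obtain y where y: "y \<in> carrier P" "x = p y" using P(5) by blast
      have "s (y, \<zero>\<^bsub>R\<^esub>) = x" using y m mod_homD(2)[OF P(4) y(1)] by (simp add: s_def)
      then show "x \<in> p' ` carrier ?P'" using s_in[of "(y, \<zero>\<^bsub>R\<^esub>)"] y by simp
    qed
    moreover have "projective_module R ?P'"
      unfolding projective_module_iff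
      using left_module_transport[OF S \<phi>] lifting_property_transport[OF _ S \<phi>]
        lifting_property_mod_sum[OF P(1) F P(2) lifting_property_regular[OF M.R.ring_axioms]] by simp
    moreover have "finite (carrier ?P')" using finS by (simp add: transport_simps[OF \<phi>])
    ultimately show ?case using p' by blast
  qed
  from this[OF assms(3) subset_refl] obtain P :: "('a, int) module" and p where
    P: "projective_module R P" "finite (carrier P)" "p \<in> mod_hom R P M" "carrier M \<subseteq> p ` carrier P" by blast
  moreover have "p ` carrier P \<subseteq> carrier M" using mod_homD(2)[OF P(3)] by blast
  ultimately show ?thesis by blast
qed

lemma mod_hom_restrict_submodule:
  assumes "left_module R P" "submodule N R P" "p \<in> mod_hom R P M"
  shows "restrict p N \<in> mod_hom R (P\<lparr>carrier := N\<rparr>) M"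
proof -
  interpret P: left_module R P by fact
  note N = P.submoduleD(3)[OF assms(2)]
  have "restrict p (carrier (P\<lparr>carrier := N\<rparr>)) \<in> mod_hom R (P\<lparr>carrier := N\<rparr>) M"
    by (rule mod_hom_restrictI[OF _ _ _ P.left_module_submodule[OF assms(2)]])
      (simp_all add: N mod_homD(2-4)[OF assms(3)])
  then show ?thesis by simp
qed

lemma mod_hom_submodule_incl:
  assumes "left_module R P" "submodule N R P"
  shows "restrict (\<lambda>x. x) N \<in> mod_hom R (P\<lparr>carrier := N\<rparr>) P"
proof -
  interpret P: left_module R P by fact
  note N = P.submoduleD(1)[OF assms(2)]
  have "restrict (restrict (\<lambda>x. x) (carrier P)) N \<in> mod_hom R (P\<lparr>carrier := N\<rparr>) P"
    by (rule mod_hom_restrict_submodule[OF assms mod_hom_id[OF assms(1)]])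
  then show ?thesis using N by (simp add: Int_absorb1)
qed

lemma mod_hom_into_submodule:
  assumes "f \<in> mod_hom R M (P\<lparr>carrier := N\<rparr>)" "N \<subseteq> carrier P"
  shows "f \<in> mod_hom R M P"
proof (rule mod_homI)
  show "f x \<in> carrier P" if "x \<in> carrier M" for x
    using mod_homD(2)[OF assms(1) that] assms(2) by auto
qed (simp_all add: mod_homD(1,3,4)[OF assms(1)])

text \<open>
  The image is a direct summand: \<open>h\<close> is a bijection of it, so \<open>h\<close> followed by the inverse of this
  bijection is a retraction onto it.
\<close>

lemma lifting_property_stable_image:
  fixes P :: "('a, 'b) module"
  assumes P: "left_module R P" "lifting_property R P"
    and h: "h \<in> mod_hom R P P" "h ` h ` carrier P = h ` carrier P" "inj_on h (h ` carrier P)"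
  shows "lifting_property R (P\<lparr>carrier := h ` carrier P\<rparr>)"
proof -
  interpret P: left_module R P by fact
  let ?W = "h ` carrier P"
  have W: "submodule ?W R P" by (rule submodule_image[OF h(1) P(1) P(1) submodule_carrier[OF P(1)]])
  note Wsub = P.submoduleD(3)[OF W] and Wadd = P.submoduleD(4)[OF W] and Wsm = P.submoduleD(5)[OF W]
  define r where "r x = inv_into ?W h (h x)" for x
  have r: "r x \<in> ?W" "h (r x) = h x" if "x \<in> carrier P" for x
    using that h(2) unfolding r_def by (auto intro!: inv_into_into f_inv_into_f)
  have rI: "r x = y" if "y \<in> ?W" "h y = h x" for x y
    using that h(3) unfolding r_def by (metis inv_into_f_f)
  have "restrict r (carrier P) \<in> mod_hom R P (P\<lparr>carrier := ?W\<rparr>)"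
  proof (rule mod_hom_restrictI[OF _ _ _ P(1)])
    show "r x \<in> carrier (P\<lparr>carrier := ?W\<rparr>)" if "x \<in> carrier P" for x using r(1)[OF that] by simp
    show "r (x \<oplus>\<^bsub>P\<^esub> y) = r x \<oplus>\<^bsub>P\<lparr>carrier := ?W\<rparr>\<^esub> r y" if "x \<in> carrier P" "y \<in> carrier P" for x y
      using that by (intro rI) (simp_all add: Wadd r mod_homD(3)[OF h(1)] Wsub)
    show "r (a \<odot>\<^bsub>P\<^esub> x) = a \<odot>\<^bsub>P\<lparr>carrier := ?W\<rparr>\<^esub> r x" if "a \<in> carrier R" "x \<in> carrier P" for a x
      using that by (intro rI) (simp_all add: Wsm r mod_homD(4)[OF h(1)] Wsub)
  qed
  then show ?thesis
  proof (rule lifting_property_retract[OF P(2,1) P.left_module_submodule[OF W] mod_hom_submodule_incl[OF P(1) W]])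
    show "restrict r (carrier P) (restrict (\<lambda>x. x) ?W x) = x" if "x \<in> carrier (P\<lparr>carrier := ?W\<rparr>)" for x
      using that Wsub[of x] rI[of x x] by simp
  qed
qed

text \<open>
  A smallest finite projective module \<open>P\<close> with a surjection \<open>p\<close> onto \<open>M\<close> is a cover. Otherwise some proper
  submodule \<open>N\<close> already maps onto \<open>M\<close>, and \<open>p\<close> lifts to endomorphisms \<open>h\<close> of \<open>P\<close> over \<open>M\<close> with values in
  \<open>N\<close>. Such an \<open>h\<close> with the smallest image has the same image as its square, so its image is a
  projective module (a retract of \<open>P\<close>) that maps onto \<open>M\<close> and is smaller than \<open>P\<close>.
\<close>

theorem exists_projective_cover:
  fixes M :: "('a, int) module"
  assumes M: "left_module R M" and "finite (carrier R)" "finite (carrier M)"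
  shows "\<exists>P p. projective_cover R M P p"
proof -
  define A where "A = (\<lambda>(P :: ('a, int) module, p). projective_module R P \<and> finite (carrier P) \<and>
    p \<in> mod_hom R P M \<and> p ` carrier P = carrier M)"
  obtain P p where Pp: "A (P, p)" and min: "\<And>P' p'. A (P', p') \<Longrightarrow> card (carrier P) \<le> card (carrier P')"
  proof -
    obtain Z0 where "A Z0" using exists_finite_projective_onto[OF assms] by (auto simp: A_def)
    then obtain Z where Z: "A Z" "\<And>Y. A Y \<Longrightarrow> card (carrier (fst Z)) \<le> card (carrier (fst Y))"
      using ex_has_least_nat[of A Z0 "\<lambda>Z. card (carrier (fst Z))"] by blast
    show ?thesis using Z(1) Z(2) by (intro that[of "fst Z" "snd Z"]) force+
  qed
  have P: "left_module R P" "lifting_property R P" "finite (carrier P)" "p \<in> mod_hom R P M" "p ` carrier P = carrier M"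
    using Pp by (auto simp: A_def projective_module_iff)
  interpret P: left_module R P by fact
  have "N = carrier P" if N: "submodule N R P" "p ` N = carrier M" for N
  proof (rule ccontr)
    assume "N \<noteq> carrier P"
    note Nsub = P.submoduleD(1)[OF N(1)]
    let ?N = "P\<lparr>carrier := N\<rparr>"
    define H where "H = {h \<in> mod_hom R P P. (\<forall>x\<in>carrier P. p (h x) = p x) \<and> h ` carrier P \<subseteq> N}"
    have "restrict p N ` carrier ?N = carrier M" using N(2) by simp
    then obtain h0 where h0: "h0 \<in> mod_hom R P ?N" "\<And>x. x \<in> carrier P \<Longrightarrow> restrict p N (h0 x) = p x"
      by (rule lifting_propertyD[OF P(2) P.left_module_submodule[OF N(1)] M
        mod_hom_restrict_submodule[OF P(1) N(1) P(4)] _ P(4)]) (rule that)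
    have "h0 x \<in> N" if "x \<in> carrier P" for x using mod_homD(2)[OF h0(1) that] by simp
    then have "h0 \<in> H" using h0(2) mod_hom_into_submodule[OF h0(1) Nsub] by (auto simp: H_def)
    then obtain h where h: "h \<in> H" "\<And>h'. h' \<in> H \<Longrightarrow> card (h ` carrier P) \<le> card (h' ` carrier P)"
      using ex_has_least_nat[of "\<lambda>h. h \<in> H" h0 "\<lambda>h. card (h ` carrier P)"] by blast
    have hP: "h \<in> mod_hom R P P" "\<And>x. x \<in> carrier P \<Longrightarrow> p (h x) = p x" "h ` carrier P \<subseteq> N"
      using h(1) by (auto simp: H_def)
    let ?W = "h ` carrier P"
    have WP: "?W \<subseteq> carrier P" using hP(3) Nsub by blast
    have finW: "finite ?W" using P(3) by simp
    define h2 where "h2 = restrict (\<lambda>x. h (h x)) (carrier P)"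
    have h2im: "h2 ` carrier P = h ` ?W" by (force simp: h2_def)
    have "h2 \<in> H"
      using mod_hom_comp[OF hP(1) hP(1) P(1)] hP(2,3) mod_homD(2)[OF hP(1)]
      by (auto simp: H_def h2_def)
    then have "card ?W \<le> card (h ` ?W)" using h(2) h2im by metis
    moreover have "h ` ?W \<subseteq> ?W" using WP by blast
    ultimately have im: "h ` ?W = ?W" using card_seteq[OF finW] by blast
    then have inj: "inj_on h ?W" using finW by (simp add: eq_card_imp_inj_on)
    let ?Q = "P\<lparr>carrier := ?W\<rparr>"
    have W: "submodule ?W R P" by (rule submodule_image[OF hP(1) P(1) P(1) submodule_carrier[OF P(1)]])
    have "p ` ?W = carrier M" using P(5) hP(2) by (simp add: image_image)
    then have "A (?Q, restrict p ?W)"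
      using mod_hom_restrict_submodule[OF P(1) W P(4)] lifting_property_stable_image[OF P(1,2) hP(1) im inj]
        P.left_module_submodule[OF W] finW
      by (simp add: A_def projective_module_iff)
    then have "card (carrier P) \<le> card ?W" using min by fastforce
    moreover have "card ?W \<le> card N" using hP(3) Nsub P(3) finite_subset by (intro card_mono) auto
    moreover have "card N < card (carrier P)" using Nsub \<open>N \<noteq> carrier P\<close> P(3) by (intro psubset_card_mono) auto
    ultimately show False by simp
  qed
  then have "projective_cover R M P p"
    using P by (simp add: projective_cover_def projective_module_iff)
  then show ?thesis by blast
qed

text \<open>
  A finite projective module over \<open>M\<close> maps to the cover, and by minimality of the cover its image is
  everything.
\<close>

lemma projective_cover_finite:
  assumes M: "left_module R M" and fin: "finite (carrier R)" "finite (carrier M)"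
    and cover: "projective_cover R M P p"
  shows "finite (carrier P)"
proof -
  have P: "left_module R P" "p \<in> mod_hom R P M" "p ` carrier P = carrier M"
    "\<And>N. submodule N R P \<Longrightarrow> p ` N = carrier M \<Longrightarrow> N = carrier P"
    using cover by (auto simp: projective_cover_def projective_module_iff)
  obtain F :: "('a, int) module" and f where F: "left_module R F" "lifting_property R F" "finite (carrier F)"
    "f \<in> mod_hom R F M" "f ` carrier F = carrier M"
    using exists_finite_projective_onto[OF M fin] by (auto simp: projective_module_iff)
  obtain h where h: "h \<in> mod_hom R F P" "\<And>x. x \<in> carrier F \<Longrightarrow> p (h x) = f x"
    by (rule lifting_propertyD[OF F(2) P(1) M P(2,3) F(4)]) (rule that)
  have "p ` h ` carrier F = carrier M" using h(2) F(5) by (simp add: image_image)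
  then have "h ` carrier F = carrier P"
    using P(4) submodule_image[OF h(1) F(1) P(1) submodule_carrier[OF F(1)]] by blast
  then show ?thesis using F(3) by (metis finite_imageI)
qed

lemma proj_cover:
  assumes M: "left_module R M" and fin: "finite (carrier R)" "finite (carrier M)"
  obtains P p where "proj_cover R M = (P, p)" "left_module R P" "finite (carrier P)" 
    "p \<in> mod_hom R P M" "p ` carrier P = carrier M"
proof -
  obtain P p where Pp: "proj_cover R M = (P, p)" by fastforce
  have "\<exists>Z. case Z of (P, p) \<Rightarrow> projective_cover R M P p"
    using exists_projective_cover[OF assms] by auto
  from someI_ex[OF this] have c: "projective_cover R M P p" 
    using Pp by (simp add: proj_cover_def)
  then show ?thesis
    using that[OF Pp] projective_cover_finite[OF assms c] 
    by (simp add: projective_cover_def projective_module_iff)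
qed

section \<open>The path algebra\<close>

lemma (in abelian_monoid) finsum_only:
  assumes "finite A" "i \<in> A" "f i \<in> carrier G" "\<And>j. j \<in> A \<Longrightarrow> j \<noteq> i \<Longrightarrow> f j = \<zero>"
  shows "finsum G f A = f i"
proof -
  have "finsum G f A = finsum G (\<lambda>_. f i) {i}"
  proof (rule add.finprod_mono_neutral_cong_right[OF assms(1)])
    show "f \<in> A \<rightarrow> carrier G" using assms(3,4) by (intro Pi_I) (metis zero_closed)
  qed (use assms in auto)
  then show ?thesis using assms(3) by simp
qed

lemma (in abelian_group) minus_eq_zeroD:
  assumes "x \<ominus> y = \<zero>" "x \<in> carrier G" "y \<in> carrier G"
  shows "x = y"
  using minus_equality[of x "\<ominus> y"] assms by (simp add: a_minus_def)

lemma (in abelian_group) double_eq_selfD: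
  assumes "x \<oplus> x = x" "x \<in> carrier G"
  shows "x = \<zero>"
  using r_neg1[OF assms(2,2)] l_neg[OF assms(2)] assms(1) by simp

fun path_end :: "(nat, 'e) pre_digraph \<Rightarrow> nat \<Rightarrow> 'e list \<Rightarrow> nat" where
  "path_end Q u [] = u"
| "path_end Q u (a # p) = path_end Q (head Q a) p"

lemma last_awalk_verts: "last (pre_digraph.awalk_verts Q u p) = path_end Q u p"
  by (induction p arbitrary: u) 
    (simp_all add: pre_digraph.awalk_verts.simps pre_digraph.awalk_verts_non_Nil)

lemma path_end_append: "path_end Q u (p @ q) = path_end Q (path_end Q u p) q"
  by (induction p arbitrary: u) auto

locale path_alg = wf_digraph Q + K: field K
  for Q :: "(nat, 'e) pre_digraph" and K :: "int ring" +
  assumes fin_verts: "finite (verts Q)" and fin_arcs: "finite (arcs Q)"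
    and fin_paths: "finite (paths Q)" and fin_K: "finite (carrier K)"
begin

abbreviation "A \<equiv> path_algebra Q K"

lemma in_paths [simp]: "(u, p) \<in> paths Q \<longleftrightarrow> is_path Q u p"
  using paths_iff wf_digraph by blast

lemma is_path_end: "is_path Q u p \<Longrightarrow> path_end Q u p \<in> verts Q"
  by (induction p arbitrary: u) auto

lemma is_path_start: "is_path Q u p \<Longrightarrow> u \<in> verts Q"
  by (cases p) auto

lemma is_path_append:
  "is_path Q u (p @ q) \<longleftrightarrow> is_path Q u p \<and> is_path Q (path_end Q u p) q"
  by (induction p arbitrary: u) (auto dest: is_path_start)

lemma A_carrier: "carrier A = {f. (\<forall>x. f x \<in> carrier K) \<and> (\<forall>x. x \<notin> paths Q \<longrightarrow> f x = \<zero>\<^bsub>K\<^esub>)}"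
proof -
  have "finite {x. f x \<noteq> \<zero>\<^bsub>K\<^esub>}" if "\<forall>x. x \<notin> paths Q \<longrightarrow> f x = \<zero>\<^bsub>K\<^esub>" for f :: "_ \<Rightarrow> int"
    using that by (intro finite_subset[OF _ fin_paths]) blast
  then have c: "carrier A = {f. (\<forall>x\<in>paths Q. f x \<in> carrier K) \<and> (\<forall>x. x \<notin> paths Q \<longrightarrow> f x = \<zero>\<^bsub>K\<^esub>)}"
    unfolding path_algebra_def partial_object.simps by blast
  have "f x \<in> carrier K" if "\<forall>x\<in>paths Q. f x \<in> carrier K" "\<forall>x. x \<notin> paths Q \<longrightarrow> f x = \<zero>\<^bsub>K\<^esub>"
    for f :: "nat \<times> 'e list \<Rightarrow> int" and x
    using that(2)[THEN spec, of x] that(1) by (cases "x \<in> paths Q") simp_all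
  then show ?thesis unfolding c by blast
qed

lemma AI: "(\<And>x. f x \<in> carrier K) \<Longrightarrow> (\<And>x. x \<notin> paths Q \<Longrightarrow> f x = \<zero>\<^bsub>K\<^esub>) \<Longrightarrow> f \<in> carrier A"
  unfolding A_carrier by blast
lemma A_val: "f \<in> carrier A \<Longrightarrow> f x \<in> carrier K"
  unfolding A_carrier by blast
lemma A_out: "f \<in> carrier A \<Longrightarrow> x \<notin> paths Q \<Longrightarrow> f x = \<zero>\<^bsub>K\<^esub>"
  unfolding A_carrier by blast

lemma A_zero: "\<zero>\<^bsub>A\<^esub> = (\<lambda>x. \<zero>\<^bsub>K\<^esub>)" by (simp add: path_algebra_def)
lemma A_add: "f \<oplus>\<^bsub>A\<^esub> g = (\<lambda>x. f x \<oplus>\<^bsub>K\<^esub> g x)" by (simp add: path_algebra_def)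
lemma A_mult: "(f \<otimes>\<^bsub>A\<^esub> g) (u, r) = (if is_path Q u r then
    \<Oplus>\<^bsub>K\<^esub>k\<in>{..length r}. f (path_end Q u (take k r), drop k r) \<otimes>\<^bsub>K\<^esub> g (u, take k r) else \<zero>\<^bsub>K\<^esub>)"
  by (simp add: path_algebra_def last_awalk_verts)

text \<open>
  The element \<open>c\<close> times identity; these elements form a central copy of \<open>K\<close>.
\<close>

definition const :: "int \<Rightarrow> nat \<times> 'e list \<Rightarrow> int" where
  "const c = (\<lambda>(u, r). if u \<in> verts Q \<and> r = [] then c else \<zero>\<^bsub>K\<^esub>)"

text \<open>
  The path \<open>p\<close> with coefficient \<open>c\<close>.
\<close>

definition mon :: "int \<Rightarrow> nat \<times> 'e list \<Rightarrow> nat \<times> 'e list \<Rightarrow> int" where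
  "mon c p = (\<lambda>x. if x = p then c else \<zero>\<^bsub>K\<^esub>)"

lemma A_one: "\<one>\<^bsub>A\<^esub> = const \<one>\<^bsub>K\<^esub>" by (simp add: path_algebra_def const_def)

lemma const_A: "c \<in> carrier K \<Longrightarrow> const c \<in> carrier A"
  by (rule AI) (auto simp: const_def split: prod.splits)
lemma mon_A: "c \<in> carrier K \<Longrightarrow> p \<in> paths Q \<Longrightarrow> mon c p \<in> carrier A"
  by (rule AI) (auto simp: mon_def)

lemma A_add_closed: 
  assumes "f \<in> carrier A" "g \<in> carrier A"
  shows "f \<oplus>\<^bsub>A\<^esub> g \<in> carrier A"
  by (rule AI) (simp_all add: A_add A_val[OF assms(1)] A_val[OF assms(2)] A_out[OF assms(1)] A_out[OF assms(2)])

lemma A_zero_closed: "\<zero>\<^bsub>A\<^esub> \<in> carrier A" by (rule AI) (simp_all add: A_zero)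

lemma A_mult_closed: 
  assumes "f \<in> carrier A" "g \<in> carrier A"
  shows "f \<otimes>\<^bsub>A\<^esub> g \<in> carrier A"
  by (rule AI; rename_tac x; case_tac x) (simp_all add: A_mult A_val[OF assms(1)] A_val[OF assms(2)])

lemma A_abelian_group: "abelian_group A"
proof (rule abelian_groupI)
  fix f g h assume f: "f \<in> carrier A" and g: "g \<in> carrier A" 
  note v = A_val[OF f] A_val[OF g]
  show "f \<oplus>\<^bsub>A\<^esub> g \<in> carrier A" using f g by (rule A_add_closed)
  show "f \<oplus>\<^bsub>A\<^esub> g = g \<oplus>\<^bsub>A\<^esub> f" by (simp add: A_add v K.a_ac)
  show "f \<oplus>\<^bsub>A\<^esub> g \<oplus>\<^bsub>A\<^esub> h = f \<oplus>\<^bsub>A\<^esub> (g \<oplus>\<^bsub>A\<^esub> h)" if "h \<in> carrier A"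
    by (simp add: A_add v A_val[OF that] K.a_ac)
next
  fix f assume f: "f \<in> carrier A"
  show "\<zero>\<^bsub>A\<^esub> \<oplus>\<^bsub>A\<^esub> f = f" by (simp add: A_add A_zero A_val[OF f])
  have "(\<lambda>x. \<ominus>\<^bsub>K\<^esub> f x) \<in> carrier A" by (rule AI) (simp_all add: A_out[OF f] A_val[OF f])
  moreover have "(\<lambda>x. \<ominus>\<^bsub>K\<^esub> f x) \<oplus>\<^bsub>A\<^esub> f = \<zero>\<^bsub>A\<^esub>" by (simp add: A_add A_zero K.l_neg A_val[OF f])
  ultimately show "\<exists>g\<in>carrier A. g \<oplus>\<^bsub>A\<^esub> f = \<zero>\<^bsub>A\<^esub>" by blast
qed (rule A_zero_closed)

lemma A_l_distr: 
  assumes "f \<in> carrier A" "g \<in> carrier A" "h \<in> carrier A"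
  shows "(f \<oplus>\<^bsub>A\<^esub> g) \<otimes>\<^bsub>A\<^esub> h = f \<otimes>\<^bsub>A\<^esub> h \<oplus>\<^bsub>A\<^esub> g \<otimes>\<^bsub>A\<^esub> h"
proof
  fix x :: "nat \<times> 'e list"
  obtain u r where x: "x = (u, r)" by fastforce
  show "((f \<oplus>\<^bsub>A\<^esub> g) \<otimes>\<^bsub>A\<^esub> h) x = (f \<otimes>\<^bsub>A\<^esub> h \<oplus>\<^bsub>A\<^esub> g \<otimes>\<^bsub>A\<^esub> h) x"
    by (simp add: x A_mult A_add K.l_distr Pi_def assms[THEN A_val])
qed

lemma A_r_distr:
  assumes "f \<in> carrier A" "g \<in> carrier A" "h \<in> carrier A"
  shows "h \<otimes>\<^bsub>A\<^esub> (f \<oplus>\<^bsub>A\<^esub> g) = h \<otimes>\<^bsub>A\<^esub> f \<oplus>\<^bsub>A\<^esub> h \<otimes>\<^bsub>A\<^esub> g"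
proof
  fix x :: "nat \<times> 'e list"
  obtain u r where x: "x = (u, r)" by fastforce
  show "(h \<otimes>\<^bsub>A\<^esub> (f \<oplus>\<^bsub>A\<^esub> g)) x = (h \<otimes>\<^bsub>A\<^esub> f \<oplus>\<^bsub>A\<^esub> h \<otimes>\<^bsub>A\<^esub> g) x"
    by (simp add: x A_mult A_add K.r_distr Pi_def assms[THEN A_val])
qed

lemma A_zero_mult:
  assumes "f \<in> carrier A"
  shows "\<zero>\<^bsub>A\<^esub> \<otimes>\<^bsub>A\<^esub> f = \<zero>\<^bsub>A\<^esub>" "f \<otimes>\<^bsub>A\<^esub> \<zero>\<^bsub>A\<^esub> = \<zero>\<^bsub>A\<^esub>"
  by (auto simp: A_mult A_zero fun_eq_iff A_val[OF assms])

lemma const_mult: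
  assumes "c \<in> carrier K" "f \<in> carrier A"
  shows "const c \<otimes>\<^bsub>A\<^esub> f = (\<lambda>p. c \<otimes>\<^bsub>K\<^esub> f p)" "f \<otimes>\<^bsub>A\<^esub> const c = (\<lambda>p. c \<otimes>\<^bsub>K\<^esub> f p)"
proof -
  note v = A_val[OF assms(2)]
  have "(const c \<otimes>\<^bsub>A\<^esub> f) (u, r) = c \<otimes>\<^bsub>K\<^esub> f (u, r)" for u r
  proof (cases "is_path Q u r")
    case True
    let ?t = "\<lambda>k. const c (path_end Q u (take k r), drop k r) \<otimes>\<^bsub>K\<^esub> f (u, take k r)"
    have "(const c \<otimes>\<^bsub>A\<^esub> f) (u, r) = finsum K ?t {..length r}" using True by (simp add: A_mult)
    also have "\<dots> = ?t (length r)"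
      by (rule K.finsum_only) (use assms(1) in \<open>auto simp: const_def v\<close>)
    finally show ?thesis using True assms(1) by (simp add: const_def is_path_end v)
  qed (use assms(1) in \<open>simp add: A_mult A_out[OF assms(2)]\<close>)
  then show "const c \<otimes>\<^bsub>A\<^esub> f = (\<lambda>p. c \<otimes>\<^bsub>K\<^esub> f p)" by (auto simp: fun_eq_iff)
  have "(f \<otimes>\<^bsub>A\<^esub> const c) (u, r) = c \<otimes>\<^bsub>K\<^esub> f (u, r)" for u r
  proof (cases "is_path Q u r")
    case True
    let ?t = "\<lambda>k. f (path_end Q u (take k r), drop k r) \<otimes>\<^bsub>K\<^esub> const c (u, take k r)"
    have "(f \<otimes>\<^bsub>A\<^esub> const c) (u, r) = finsum K ?t {..length r}" using True by (simp add: A_mult)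
    also have "\<dots> = ?t 0"
      by (rule K.finsum_only) (use assms(1) in \<open>auto simp: const_def v\<close>)
    finally show ?thesis using True assms(1) by (simp add: const_def is_path_start K.m_comm v)
  qed (use assms(1) in \<open>simp add: A_mult A_out[OF assms(2)]\<close>)
  then show "f \<otimes>\<^bsub>A\<^esub> const c = (\<lambda>p. c \<otimes>\<^bsub>K\<^esub> f p)" by (auto simp: fun_eq_iff)
qed

lemma mon_mult:
  assumes "c \<in> carrier K" "d \<in> carrier K" "is_path Q v s" "is_path Q w t"
  shows "mon c (v, s) \<otimes>\<^bsub>A\<^esub> mon d (w, t) =
    (if path_end Q w t = v then mon (c \<otimes>\<^bsub>K\<^esub> d) (w, t @ s) else \<zero>\<^bsub>A\<^esub>)"
proof -
  have "(mon c (v, s) \<otimes>\<^bsub>A\<^esub> mon d (w, t)) (u, r) =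
    (if path_end Q w t = v \<and> u = w \<and> r = t @ s then c \<otimes>\<^bsub>K\<^esub> d else \<zero>\<^bsub>K\<^esub>)" for u r
  proof (cases "is_path Q u r")
    case True
    let ?t = "\<lambda>k. mon c (v, s) (path_end Q u (take k r), drop k r) \<otimes>\<^bsub>K\<^esub> mon d (w, t) (u, take k r)"
    define F where "F = ?t"
    have t: "F k = (if path_end Q w t = v \<and> u = w \<and> r = t @ s \<and> k = length t then c \<otimes>\<^bsub>K\<^esub> d else \<zero>\<^bsub>K\<^esub>)"
      if "k \<le> length r" for k
      using assms that by (auto simp: F_def mon_def append_eq_conv_conj)
    have "(mon c (v, s) \<otimes>\<^bsub>A\<^esub> mon d (w, t)) (u, r) = finsum K F {..length r}" 
      using True by (simp add: A_mult F_def)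
    also have "\<dots> = (if path_end Q w t = v \<and> u = w \<and> r = t @ s then c \<otimes>\<^bsub>K\<^esub> d else \<zero>\<^bsub>K\<^esub>)"
    proof (cases "path_end Q w t = v \<and> u = w \<and> r = t @ s")
      case True
      have "finsum K F {..length r} = F (length t)"
        by (rule K.finsum_only) (use True assms(1,2) in \<open>auto simp: t\<close>)
      then show ?thesis using True by (auto simp: t)
    next
      case False
      have "finsum K F {..length r} = \<zero>\<^bsub>K\<^esub>"
        by (rule K.add.finprod_one_eqI[simplified]) (use False in \<open>auto simp: t\<close>)
      then show ?thesis using False by auto
    qed
    finally show ?thesis .
  next
    case False
    then have "\<not> (path_end Q w t = v \<and> u = w \<and> r = t @ s)"
      using assms is_path_append by auto
    then show ?thesis using False by (auto simp: A_mult)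
  qed
  then show ?thesis by (auto simp: fun_eq_iff mon_def A_zero)
qed

lemma A_induct [consumes 1, case_names zero mon add]:
  assumes f: "f \<in> carrier A" and zero: "P \<zero>\<^bsub>A\<^esub>"
    and mon: "\<And>c p. c \<in> carrier K \<Longrightarrow> p \<in> paths Q \<Longrightarrow> P (mon c p)"
    and add: "\<And>f g. f \<in> carrier A \<Longrightarrow> g \<in> carrier A \<Longrightarrow> P f \<Longrightarrow> P g \<Longrightarrow> P (f \<oplus>\<^bsub>A\<^esub> g)"
  shows "P f"
proof -
  have "\<forall>f\<in>carrier A. (\<forall>x. x \<notin> S \<longrightarrow> f x = \<zero>\<^bsub>K\<^esub>) \<longrightarrow> P f" if "finite S" "S \<subseteq> paths Q" for S
    using that
  proof (induction S)
    case empty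
    show ?case
    proof (intro ballI impI)
      fix f :: "nat \<times> 'e list \<Rightarrow> int" assume "\<forall>x. x \<notin> {} \<longrightarrow> f x = \<zero>\<^bsub>K\<^esub>"
      then have "f = \<zero>\<^bsub>A\<^esub>" by (simp add: A_zero fun_eq_iff)
      then show "P f" using zero by simp
    qed
  next
    case (insert p S)
    show ?case
    proof (intro ballI impI)
      fix f assume f: "f \<in> carrier A" and S: "\<forall>x. x \<notin> insert p S \<longrightarrow> f x = \<zero>\<^bsub>K\<^esub>"
      have p: "p \<in> paths Q" using insert by simp
      have g: "f(p := \<zero>\<^bsub>K\<^esub>) \<in> carrier A" by (intro AI) (auto simp: A_out[OF f] A_val[OF f])
      have "f = f(p := \<zero>\<^bsub>K\<^esub>) \<oplus>\<^bsub>A\<^esub> mon (f p) p"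
        by (auto simp: A_add mon_def fun_eq_iff A_val[OF f])
      moreover have "P (f(p := \<zero>\<^bsub>K\<^esub>))" using insert g S by simp
      moreover have "P (mon (f p) p)" by (rule mon[OF A_val[OF f] p])
      ultimately show "P f" using add[OF g mon_A[OF A_val[OF f] p]] by metis
    qed
  qed
  from this[OF fin_paths subset_refl] show ?thesis using f A_out[OF f] by blast
qed

text \<open>
  Both sides are additive in each factor, so it suffices to compare products of three paths, where the
  claim is the associativity of concatenation.
\<close>

lemma A_assoc:
  assumes "f \<in> carrier A" "g \<in> carrier A" "h \<in> carrier A"
  shows "(f \<otimes>\<^bsub>A\<^esub> g) \<otimes>\<^bsub>A\<^esub> h = f \<otimes>\<^bsub>A\<^esub> (g \<otimes>\<^bsub>A\<^esub> h)"
proof -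
  have mmm: "(mon c p \<otimes>\<^bsub>A\<^esub> mon d q) \<otimes>\<^bsub>A\<^esub> mon e r = mon c p \<otimes>\<^bsub>A\<^esub> (mon d q \<otimes>\<^bsub>A\<^esub> mon e r)"
    if "c \<in> carrier K" "d \<in> carrier K" "e \<in> carrier K" "p \<in> paths Q" "q \<in> paths Q" "r \<in> paths Q" 
    for c d e p q r
  proof -
    obtain u s v t w z where "p = (u, s)" "q = (v, t)" "r = (w, z)" by fastforce
    then show ?thesis using that
      by (simp add: mon_mult is_path_append path_end_append A_zero_mult mon_A K.m_assoc)
  qed
  have mmh: "(mon c p \<otimes>\<^bsub>A\<^esub> mon d q) \<otimes>\<^bsub>A\<^esub> h = mon c p \<otimes>\<^bsub>A\<^esub> (mon d q \<otimes>\<^bsub>A\<^esub> h)"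
    if m: "c \<in> carrier K" "d \<in> carrier K" "p \<in> paths Q" "q \<in> paths Q" for c d p q
    using assms(3)
    by (induction h rule: A_induct) 
      (simp_all add: m mmm mon_A A_zero_mult A_r_distr A_mult_closed)
  have mgh: "(mon c p \<otimes>\<^bsub>A\<^esub> g) \<otimes>\<^bsub>A\<^esub> h = mon c p \<otimes>\<^bsub>A\<^esub> (g \<otimes>\<^bsub>A\<^esub> h)"
    if m: "c \<in> carrier K" "p \<in> paths Q" for c p
    using assms(2)
    by (induction g rule: A_induct) 
      (simp_all add: m mmh assms(3) mon_A A_zero_mult A_l_distr A_r_distr A_mult_closed)
  show ?thesis
    using assms(1)
    by (induction f rule: A_induct) 
      (simp_all add: mgh assms(2,3) mon_A A_zero_mult A_l_distr A_mult_closed)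
qed

lemma A_ring: "ring A"
proof (rule ringI[OF A_abelian_group])
  show "Group.monoid A"
  proof (rule monoidI)
    fix f assume "f \<in> carrier A"
    then show "\<one>\<^bsub>A\<^esub> \<otimes>\<^bsub>A\<^esub> f = f" "f \<otimes>\<^bsub>A\<^esub> \<one>\<^bsub>A\<^esub> = f" by (simp_all add: A_one const_mult A_val)
  qed (simp_all add: A_mult_closed A_assoc A_one const_A)
qed (simp_all add: A_l_distr A_r_distr)

lemma A_finite: "finite (carrier A)"
proof -
  have "inj_on (\<lambda>f. restrict f (paths Q)) (carrier A)"
  proof (rule inj_onI)
    fix f g :: "nat \<times> 'e list \<Rightarrow> int" assume "f \<in> carrier A" "g \<in> carrier A" "restrict f (paths Q) = restrict g (paths Q)"
    note fg = this
    show "f = g"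
    proof
      show "f x = g x" for x
        using fun_cong[OF fg(3), of x] A_out[OF fg(1), of x] A_out[OF fg(2), of x]
        by (cases "x \<in> paths Q") simp_all
    qed
  qed
  moreover have "(\<lambda>f. restrict f (paths Q)) ` carrier A \<subseteq> (\<Pi>\<^sub>E p\<in>paths Q. carrier K)"
    using A_val by (intro image_subsetI) (simp add: PiE_iff)
  moreover have "finite (\<Pi>\<^sub>E p\<in>paths Q. carrier K)" using fin_paths fin_K by (simp add: finite_PiE)
  ultimately show ?thesis using finite_imageD finite_subset by blast
qed

text \<open>
  Every path is a product of arrows. Hence a property of the whole algebra, such as linearity of a map,
  needs to be checked only on vertices and arrows.
\<close>

lemma A_generated [consumes 1, case_names vert arc zero add mult]:
  assumes f: "f \<in> carrier A"
    and vert: "\<And>c u. c \<in> carrier K \<Longrightarrow> u \<in> verts Q \<Longrightarrow> P (mon c (u, []))"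
    and arc: "\<And>a. a \<in> arcs Q \<Longrightarrow> P (mon \<one>\<^bsub>K\<^esub> (tail Q a, [a]))"
    and zero: "P \<zero>\<^bsub>A\<^esub>"
    and add: "\<And>f g. f \<in> carrier A \<Longrightarrow> g \<in> carrier A \<Longrightarrow> P f \<Longrightarrow> P g \<Longrightarrow> P (f \<oplus>\<^bsub>A\<^esub> g)"
    and mult: "\<And>f g. f \<in> carrier A \<Longrightarrow> g \<in> carrier A \<Longrightarrow> P f \<Longrightarrow> P g \<Longrightarrow> P (f \<otimes>\<^bsub>A\<^esub> g)"
  shows "P f"
  using f
proof (induction f rule: A_induct)
  case (mon c p)
  obtain u r where p: "p = (u, r)" by fastforce
  have "is_path Q u r \<Longrightarrow> P (mon c (u, r))"
  proof (induction r rule: rev_induct)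
    case Nil
    then show ?case using vert mon by simp
  next
    case (snoc a r)
    then have r: "is_path Q u r" "a \<in> arcs Q" "tail Q a = path_end Q u r" by (auto simp: is_path_append)
    then have "mon c (u, r @ [a]) = mon \<one>\<^bsub>K\<^esub> (tail Q a, [a]) \<otimes>\<^bsub>A\<^esub> mon c (u, r)"
      using mon by (simp add: mon_mult)
    then show ?case using mult[OF _ _ arc[OF r(2)] snoc.IH[OF r(1)]] mon r by (simp add: mon_A)
  qed
  then show ?case using mon p by simp
qed (simp_all add: zero add)

end

section \<open>Modules from representations\<close>

text \<open>
  A representation of the quiver, given on the sum \<open>V\<close> of the spaces at the vertices: \<open>e u\<close> is the
  projection to the space at \<open>u\<close>, and \<open>T a\<close> is the map of the arrow \<open>a\<close>, extended by zero to the other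
  vertices. The axiom \<open>e_sep\<close> replaces the requirement that the projections add up to the identity.
\<close>

locale quiver_rep = path_alg Q K + V: left_module K V
  for Q :: "(nat, 'e) pre_digraph" and K :: "int ring" and V :: "(int, 'b) module" +
  fixes e :: "nat \<Rightarrow> 'b \<Rightarrow> 'b" and T :: "'e \<Rightarrow> 'b \<Rightarrow> 'b"
  assumes e_closed: "\<And>u x. u \<in> verts Q \<Longrightarrow> x \<in> carrier V \<Longrightarrow> e u x \<in> carrier V"
    and e_add: "\<And>u x y. u \<in> verts Q \<Longrightarrow> x \<in> carrier V \<Longrightarrow> y \<in> carrier V \<Longrightarrow> e u (x \<oplus>\<^bsub>V\<^esub> y) = e u x \<oplus>\<^bsub>V\<^esub> e u y"
    and e_smult: "\<And>u c x. u \<in> verts Q \<Longrightarrow> c \<in> carrier K \<Longrightarrow> x \<in> carrier V \<Longrightarrow> e u (c \<odot>\<^bsub>V\<^esub> x) = c \<odot>\<^bsub>V\<^esub> e u x"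
    and T_closed: "\<And>a x. a \<in> arcs Q \<Longrightarrow> x \<in> carrier V \<Longrightarrow> T a x \<in> carrier V"
    and T_add: "\<And>a x y. a \<in> arcs Q \<Longrightarrow> x \<in> carrier V \<Longrightarrow> y \<in> carrier V \<Longrightarrow> T a (x \<oplus>\<^bsub>V\<^esub> y) = T a x \<oplus>\<^bsub>V\<^esub> T a y"
    and T_smult: "\<And>a c x. a \<in> arcs Q \<Longrightarrow> c \<in> carrier K \<Longrightarrow> x \<in> carrier V \<Longrightarrow> T a (c \<odot>\<^bsub>V\<^esub> x) = c \<odot>\<^bsub>V\<^esub> T a x"
    and e_e: "\<And>u v x. u \<in> verts Q \<Longrightarrow> v \<in> verts Q \<Longrightarrow> x \<in> carrier V \<Longrightarrow> e u (e v x) = (if u = v then e v x else \<zero>\<^bsub>V\<^esub>)"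
    and e_sep: "\<And>x. x \<in> carrier V \<Longrightarrow> (\<And>u. u \<in> verts Q \<Longrightarrow> e u x = \<zero>\<^bsub>V\<^esub>) \<Longrightarrow> x = \<zero>\<^bsub>V\<^esub>"
    and e_T: "\<And>a x. a \<in> arcs Q \<Longrightarrow> x \<in> carrier V \<Longrightarrow> e (head Q a) (T a x) = T a x"
    and T_e: "\<And>a x. a \<in> arcs Q \<Longrightarrow> x \<in> carrier V \<Longrightarrow> T a (e (tail Q a) x) = T a x"
begin

text \<open>
  The operator of a path: restrict to its start vertex, then apply its arrows in turn.
\<close>

definition op :: "nat \<times> 'e list \<Rightarrow> 'b \<Rightarrow> 'b" where
  "op p x = fold T (snd p) (e (fst p) x)"

definition act :: "(nat \<times> 'e list \<Rightarrow> int) \<Rightarrow> 'b \<Rightarrow> 'b" where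
  "act f x = (\<Oplus>\<^bsub>V\<^esub>p\<in>paths Q. f p \<odot>\<^bsub>V\<^esub> op p x)"

definition rep_module :: "(nat \<times> 'e list \<Rightarrow> int, 'b) module" where
  "rep_module = \<lparr> carrier = carrier V, monoid.mult = undefined, monoid.one = undefined,
     zero = \<zero>\<^bsub>V\<^esub>, add = add V, module.smult = act \<rparr>"

lemma rep_module_simps [simp]:
  "carrier rep_module = carrier V" "\<zero>\<^bsub>rep_module\<^esub> = \<zero>\<^bsub>V\<^esub>" "x \<oplus>\<^bsub>rep_module\<^esub> y = x \<oplus>\<^bsub>V\<^esub> y"
  "f \<odot>\<^bsub>rep_module\<^esub> x = act f x"
  by (simp_all add: rep_module_def)

lemma e_zero: "u \<in> verts Q \<Longrightarrow> e u \<zero>\<^bsub>V\<^esub> = \<zero>\<^bsub>V\<^esub>"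
  using e_smult[of u "\<zero>\<^bsub>K\<^esub>" "\<zero>\<^bsub>V\<^esub>"] e_closed[of u "\<zero>\<^bsub>V\<^esub>"] by simp
lemma T_zero: "a \<in> arcs Q \<Longrightarrow> T a \<zero>\<^bsub>V\<^esub> = \<zero>\<^bsub>V\<^esub>"
  using T_smult[of a "\<zero>\<^bsub>K\<^esub>" "\<zero>\<^bsub>V\<^esub>"] T_closed[of a "\<zero>\<^bsub>V\<^esub>"] by simp

lemma op_Nil: "op (u, []) x = e u x" and op_snoc: "op (u, r @ [a]) x = T a (op (u, r) x)"
  by (simp_all add: op_def)

lemma op_closed: "is_path Q u r \<Longrightarrow> x \<in> carrier V \<Longrightarrow> op (u, r) x \<in> carrier V"
  by (induction r rule: rev_induct) (simp_all add: op_Nil op_snoc is_path_append e_closed T_closed)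

lemma op_add:
  "is_path Q u r \<Longrightarrow> x \<in> carrier V \<Longrightarrow> y \<in> carrier V \<Longrightarrow> op (u, r) (x \<oplus>\<^bsub>V\<^esub> y) = op (u, r) x \<oplus>\<^bsub>V\<^esub> op (u, r) y"
  by (induction r rule: rev_induct) (simp_all add: op_Nil op_snoc is_path_append e_add T_add op_closed)

lemma op_smult:
  "is_path Q u r \<Longrightarrow> c \<in> carrier K \<Longrightarrow> x \<in> carrier V \<Longrightarrow> op (u, r) (c \<odot>\<^bsub>V\<^esub> x) = c \<odot>\<^bsub>V\<^esub> op (u, r) x"
  by (induction r rule: rev_induct) (simp_all add: op_Nil op_snoc is_path_append e_smult T_smult op_closed)

lemma op_zero: "is_path Q u r \<Longrightarrow> op (u, r) \<zero>\<^bsub>V\<^esub> = \<zero>\<^bsub>V\<^esub>"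
  by (induction r rule: rev_induct) (simp_all add: op_Nil op_snoc is_path_append e_zero T_zero)

lemma e_op:
  assumes "is_path Q u r" "v \<in> verts Q" "x \<in> carrier V"
  shows "e v (op (u, r) x) = (if v = path_end Q u r then op (u, r) x else \<zero>\<^bsub>V\<^esub>)"
proof (cases r rule: rev_cases)
  case Nil
  then show ?thesis using assms by (simp add: op_Nil e_e)
next
  case (snoc r' a)
  then have a: "a \<in> arcs Q" "is_path Q u r'" using assms by (simp_all add: is_path_append)
  then have y: "op (u, r') x \<in> carrier V" using assms op_closed by simp
  have "e v (op (u, r) x) = e v (e (head Q a) (T a (op (u, r') x)))"
    using a y by (simp add: snoc op_snoc e_T)
  also have "\<dots> = (if v = head Q a then e (head Q a) (T a (op (u, r') x)) else \<zero>\<^bsub>V\<^esub>)"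
    using a y assms by (intro e_e) (simp_all add: T_closed)
  finally show ?thesis using a y by (simp add: snoc op_snoc e_T path_end_append)
qed

lemma fold_T_zero: "is_path Q u r \<Longrightarrow> fold T r \<zero>\<^bsub>V\<^esub> = \<zero>\<^bsub>V\<^esub>"
  by (induction r arbitrary: u) (auto simp: T_zero)

lemma op_op:
  assumes "is_path Q v s" "is_path Q u r" "x \<in> carrier V"
  shows "op (v, s) (op (u, r) x) = (if path_end Q u r = v then op (u, r @ s) x else \<zero>\<^bsub>V\<^esub>)"
proof -
  have "op (v, s) (op (u, r) x) = fold T s (e v (op (u, r) x))" by (simp add: op_def)
  also have "\<dots> = fold T s (if v = path_end Q u r then op (u, r) x else \<zero>\<^bsub>V\<^esub>)"
    using assms is_path_start by (simp add: e_op)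
  finally show ?thesis using fold_T_zero[OF assms(1)] by (auto simp: op_def)
qed

lemma term_closed:
  assumes "f \<in> carrier A" "x \<in> carrier V"
  shows "(\<lambda>p. f p \<odot>\<^bsub>V\<^esub> op p x) \<in> paths Q \<rightarrow> carrier V"
proof (rule Pi_I)
  fix p assume "p \<in> paths Q"
  then show "f p \<odot>\<^bsub>V\<^esub> op p x \<in> carrier V"
    by (cases p) (simp add: V.smult_closed op_closed assms(2) A_val[OF assms(1)])
qed

lemma act_closed: "f \<in> carrier A \<Longrightarrow> x \<in> carrier V \<Longrightarrow> act f x \<in> carrier V"
  unfolding act_def by (intro V.M.finsum_closed term_closed)

lemma act_cong:
  assumes "\<And>u r. is_path Q u r \<Longrightarrow> f (u, r) \<odot>\<^bsub>V\<^esub> op (u, r) x = h (u, r)"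
     "f \<in> carrier A" "x \<in> carrier V"
  shows "act f x = (\<Oplus>\<^bsub>V\<^esub>p\<in>paths Q. h p)"
proof -
  have h: "f p \<odot>\<^bsub>V\<^esub> op p x = h p" if "p \<in> paths Q" for p
    using that assms(1)[of "fst p" "snd p"] by (cases p) simp
  show ?thesis unfolding act_def
  proof (rule V.M.finsum_cong'[OF refl _ h])
    show "h \<in> paths Q \<rightarrow> carrier V"
      using h Pi_mem[OF term_closed[OF assms(2,3)]] by (intro Pi_I) metis
  qed
qed

lemma act_add_left:
  assumes "f \<in> carrier A" "g \<in> carrier A" "x \<in> carrier V"
  shows "act (f \<oplus>\<^bsub>A\<^esub> g) x = act f x \<oplus>\<^bsub>V\<^esub> act g x"
proof -
  have "act (f \<oplus>\<^bsub>A\<^esub> g) x = (\<Oplus>\<^bsub>V\<^esub>p\<in>paths Q. f p \<odot>\<^bsub>V\<^esub> op p x \<oplus>\<^bsub>V\<^esub> g p \<odot>\<^bsub>V\<^esub> op p x)"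
    using assms by (intro act_cong) (simp_all add: A_add V.smult_l_distr op_closed assms(1,2)[THEN A_val] A_add_closed[unfolded A_add])
  also have "\<dots> = act f x \<oplus>\<^bsub>V\<^esub> act g x"
    unfolding act_def using term_closed assms by (intro V.M.finsum_addf) simp_all
  finally show ?thesis .
qed

lemma act_add_right:
  assumes "f \<in> carrier A" "x \<in> carrier V" "y \<in> carrier V"
  shows "act f (x \<oplus>\<^bsub>V\<^esub> y) = act f x \<oplus>\<^bsub>V\<^esub> act f y"
proof -
  have "act f (x \<oplus>\<^bsub>V\<^esub> y) = (\<Oplus>\<^bsub>V\<^esub>p\<in>paths Q. f p \<odot>\<^bsub>V\<^esub> op p x \<oplus>\<^bsub>V\<^esub> f p \<odot>\<^bsub>V\<^esub> op p y)"
    using assms by (intro act_cong) (simp_all add: V.smult_r_distr op_add op_closed A_val[OF assms(1)])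
  also have "\<dots> = act f x \<oplus>\<^bsub>V\<^esub> act f y"
    unfolding act_def using term_closed assms by (intro V.M.finsum_addf) simp_all
  finally show ?thesis .
qed

lemma act_zero_left: "x \<in> carrier V \<Longrightarrow> act \<zero>\<^bsub>A\<^esub> x = \<zero>\<^bsub>V\<^esub>"
  using act_cong[of "\<zero>\<^bsub>A\<^esub>" x "\<lambda>_. \<zero>\<^bsub>V\<^esub>"] A_zero_closed by (simp add: A_zero op_closed)

lemma act_zero_right: "f \<in> carrier A \<Longrightarrow> act f \<zero>\<^bsub>V\<^esub> = \<zero>\<^bsub>V\<^esub>"
  using act_cong[of f "\<zero>\<^bsub>V\<^esub>" "\<lambda>_. \<zero>\<^bsub>V\<^esub>"] by (simp add: op_zero A_val)

lemma act_mon: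
  assumes "c \<in> carrier K" "is_path Q u r" "x \<in> carrier V"
  shows "act (mon c (u, r)) x = c \<odot>\<^bsub>V\<^esub> op (u, r) x"
proof -
  have "act (mon c (u, r)) x = mon c (u, r) (u, r) \<odot>\<^bsub>V\<^esub> op (u, r) x"
    unfolding act_def
  proof (rule V.M.finsum_only)
    show "mon c (u, r) p \<odot>\<^bsub>V\<^esub> op p x = \<zero>\<^bsub>V\<^esub>" if "p \<in> paths Q" "p \<noteq> (u, r)" for p
      using that assms(3) by (cases p) (auto simp: mon_def op_closed)
  qed (use assms in \<open>simp_all add: fin_paths mon_def op_closed V.smult_closed\<close>)
  then show ?thesis by (simp add: mon_def)
qed

lemma act_mult:
  assumes "f \<in> carrier A" "g \<in> carrier A" "x \<in> carrier V"
  shows "act (f \<otimes>\<^bsub>A\<^esub> g) x = act f (act g x)"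
proof -
  have mm: "act (mon c p \<otimes>\<^bsub>A\<^esub> mon d q) x = act (mon c p) (act (mon d q) x)"
    if "c \<in> carrier K" "d \<in> carrier K" "p \<in> paths Q" "q \<in> paths Q" for c d p q
  proof -
    obtain v s u r where "p = (v, s)" "q = (u, r)" by fastforce
    then show ?thesis using that assms(3)
      by (simp add: mon_mult act_mon op_closed op_smult op_op V.smult_closed V.smult_assoc is_path_append
          act_zero_left)
  qed
  have mg: "act (mon c p \<otimes>\<^bsub>A\<^esub> g) x = act (mon c p) (act g x)" if m: "c \<in> carrier K" "p \<in> paths Q" for c p
    using assms(2)
    by (induction g rule: A_induct)
      (simp_all add: m mm assms(3) mon_A A_zero_mult A_r_distr A_mult_closed act_zero_left act_zero_right
        act_add_left act_add_right act_closed)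
  show ?thesis
    using assms(1)
    by (induction f rule: A_induct)
      (simp_all add: mg assms(2,3) mon_A A_zero_mult A_l_distr A_mult_closed act_zero_left
        act_add_left act_closed)
qed

text \<open>
  Multiplying the identity by the idempotent of a vertex shows that \<open>x\<close> and its image have the same
  components at every vertex.
\<close>

lemma act_one:
  assumes x: "x \<in> carrier V"
  shows "act \<one>\<^bsub>A\<^esub> x = x"
proof -
  interpret AR: ring A by (rule A_ring)
  have y: "act \<one>\<^bsub>A\<^esub> x \<in> carrier V" using x by (simp add: act_closed)
  have "e u (act \<one>\<^bsub>A\<^esub> x \<ominus>\<^bsub>V\<^esub> x) = \<zero>\<^bsub>V\<^esub>" if u: "u \<in> verts Q" for u
  proof -
    have i: "act (mon \<one>\<^bsub>K\<^esub> (u, [])) z = e u z" if "z \<in> carrier V" for z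
      using act_mon[of "\<one>\<^bsub>K\<^esub>" u "[]" z] u that by (simp add: op_Nil e_closed V.smult_one)
    have m: "mon \<one>\<^bsub>K\<^esub> (u, []) \<in> carrier A" using u by (simp add: mon_A)
    have "e u (act \<one>\<^bsub>A\<^esub> x) = act (mon \<one>\<^bsub>K\<^esub> (u, []) \<otimes>\<^bsub>A\<^esub> \<one>\<^bsub>A\<^esub>) x"
      unfolding act_mult[OF m AR.one_closed x] by (rule i[OF y, symmetric])
    also have "\<dots> = e u x" unfolding AR.r_one[OF m] by (rule i[OF x])
    finally have *: "e u (act \<one>\<^bsub>A\<^esub> x) = e u x" .
    have neg: "e u (\<ominus>\<^bsub>V\<^esub> x) = \<ominus>\<^bsub>V\<^esub> e u x"
      unfolding V.neg_eq_smult[OF x] V.neg_eq_smult[OF e_closed[OF u x]] 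
      by (rule e_smult[OF u _ x]) simp
    show ?thesis 
      unfolding a_minus_def e_add[OF u y V.M.a_inv_closed[OF x]] neg *
      by (rule V.M.r_neg[OF e_closed[OF u x]])
  qed
  then have "act \<one>\<^bsub>A\<^esub> x \<ominus>\<^bsub>V\<^esub> x = \<zero>\<^bsub>V\<^esub>" by (rule e_sep[OF V.M.minus_closed[OF y x]])
  then show ?thesis using y x by (rule V.M.minus_eq_zeroD)
qed

theorem left_module_rep: "left_module A rep_module"
  by (rule left_moduleI)
    (simp_all add: A_ring V.M.add.m_ac act_closed act_add_left act_add_right act_mult act_one act_zero_left)

lemma rep_vertex:
  "c \<in> carrier K \<Longrightarrow> u \<in> verts Q \<Longrightarrow> x \<in> carrier V \<Longrightarrow> mon c (u, []) \<odot>\<^bsub>rep_module\<^esub> x = c \<odot>\<^bsub>V\<^esub> e u x"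
  by (simp add: act_mon op_Nil)

lemma rep_arrow:
  assumes "a \<in> arcs Q" "x \<in> carrier V"
  shows "mon \<one>\<^bsub>K\<^esub> (tail Q a, [a]) \<odot>\<^bsub>rep_module\<^esub> x = T a x"
  using assms act_mon[of "\<one>\<^bsub>K\<^esub>" "tail Q a" "[a]" x] op_snoc[of "tail Q a" "[]" a x]
  by (simp add: op_Nil T_e T_closed V.smult_one)

end

section \<open>Modules over the path algebra\<close>

context path_alg
begin

abbreviation "idem u \<equiv> mon \<one>\<^bsub>K\<^esub> (u, [])"
abbreviation "arrow a \<equiv> mon \<one>\<^bsub>K\<^esub> (tail Q a, [a])"

lemma vertex_idempotent_eq: "vertex_idempotent K i = idem i"
  by (simp add: vertex_idempotent_def mon_def)

lemma idem_A: "u \<in> verts Q \<Longrightarrow> idem u \<in> carrier A" by (simp add: mon_A)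
lemma arrow_A: "a \<in> arcs Q \<Longrightarrow> arrow a \<in> carrier A" by (simp add: mon_A)

lemma const_mon:
  assumes "c \<in> carrier K" "d \<in> carrier K" "p \<in> paths Q" 
  shows "const c \<otimes>\<^bsub>A\<^esub> mon d p = mon (c \<otimes>\<^bsub>K\<^esub> d) p"
  using const_mult(1)[OF assms(1) mon_A[OF assms(2,3)]] assms by (auto simp: mon_def)

lemma const_comm:
  assumes "c \<in> carrier K" "f \<in> carrier A"
  shows "const c \<otimes>\<^bsub>A\<^esub> f = f \<otimes>\<^bsub>A\<^esub> const c"
  using const_mult[OF assms] by simp

text \<open>
  The vector space over \<open>K\<close> underlying a module over the path algebra.
\<close>

definition scalars :: "(nat \<times> 'e list \<Rightarrow> int, 'b) module \<Rightarrow> (int, 'b) module" where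
  "scalars M = \<lparr> carrier = carrier M, monoid.mult = undefined, monoid.one = undefined,
     zero = \<zero>\<^bsub>M\<^esub>, add = add M, module.smult = (\<lambda>c x. const c \<odot>\<^bsub>M\<^esub> x) \<rparr>"

lemma scalars_simps [simp]:
  "carrier (scalars M) = carrier M" "\<zero>\<^bsub>scalars M\<^esub> = \<zero>\<^bsub>M\<^esub>" "x \<oplus>\<^bsub>scalars M\<^esub> y = x \<oplus>\<^bsub>M\<^esub> y"
  "c \<odot>\<^bsub>scalars M\<^esub> x = const c \<odot>\<^bsub>M\<^esub> x"
  by (simp_all add: scalars_def)

lemma left_module_scalars:
  assumes "left_module A M" shows "left_module K (scalars M)"
proof -
  interpret M: left_module A M by fact
  have m: "const (c \<otimes>\<^bsub>K\<^esub> d) = const c \<otimes>\<^bsub>A\<^esub> const d" if "c \<in> carrier K" "d \<in> carrier K" for c d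
    using that const_mult(1)[OF that(1) const_A[OF that(2)]] by (auto simp: const_def)
  have a: "const (c \<oplus>\<^bsub>K\<^esub> d) = const c \<oplus>\<^bsub>A\<^esub> const d" if "c \<in> carrier K" "d \<in> carrier K" for c d
    using that by (auto simp: A_add const_def)
  have z: "const \<zero>\<^bsub>K\<^esub> = \<zero>\<^bsub>A\<^esub>" by (auto simp: const_def A_zero)
  show ?thesis
    by (rule left_moduleI)
      (simp_all add: K.ring_axioms M.M.add.m_ac M.smult_closed const_A M.smult_r_distr
        M.smult_assoc M.smult_l_distr m a z A_one[symmetric] M.smult_one)
qed

text \<open>
  Every path starts at some vertex \<open>u\<close> and so factors through the idempotent of \<open>u\<close>. An element that is
  killed by all these idempotents is killed by the whole algebra, in particular by the identity.
\<close>

lemma idem_sep: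
  assumes "left_module A M" "x \<in> carrier M" "\<And>u. u \<in> verts Q \<Longrightarrow> idem u \<odot>\<^bsub>M\<^esub> x = \<zero>\<^bsub>M\<^esub>"
  shows "x = \<zero>\<^bsub>M\<^esub>"
proof -
  interpret M: left_module A M by fact
  have "f \<odot>\<^bsub>M\<^esub> x = \<zero>\<^bsub>M\<^esub>" if "f \<in> carrier A" for f
    using that
  proof (induction f rule: A_induct)
    case (mon c p)
    obtain u r where p: "p = (u, r)" by fastforce
    have u: "u \<in> verts Q" using mon is_path_start p by simp
    have "mon c p = mon c p \<otimes>\<^bsub>A\<^esub> idem u"
      using mon u by (simp add: p mon_mult)
    then have "mon c p \<odot>\<^bsub>M\<^esub> x = mon c p \<odot>\<^bsub>M\<^esub> (idem u \<odot>\<^bsub>M\<^esub> x)"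
      using M.smult_assoc[OF mon_A[OF mon] idem_A[OF u] assms(2)] by simp
    then show ?case using assms(3)[OF u] M.smult_r_null[OF mon_A[OF mon]] by simp
  qed (simp_all add: M.smult_l_distr assms(2))
  from this[of "\<one>\<^bsub>A\<^esub>"] show ?thesis using assms(2) by (simp add: M.smult_one)
qed

lemma path_hom:
  assumes M: "left_module A M" and N: "left_module A N"
    and h: "\<And>x. x \<in> carrier M \<Longrightarrow> h x \<in> carrier N"
    "\<And>x y. x \<in> carrier M \<Longrightarrow> y \<in> carrier M \<Longrightarrow> h (x \<oplus>\<^bsub>M\<^esub> y) = h x \<oplus>\<^bsub>N\<^esub> h y"
    "\<And>c u x. c \<in> carrier K \<Longrightarrow> u \<in> verts Q \<Longrightarrow> x \<in> carrier M \<Longrightarrow> 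
       h (mon c (u, []) \<odot>\<^bsub>M\<^esub> x) = mon c (u, []) \<odot>\<^bsub>N\<^esub> h x"
    "\<And>a x. a \<in> arcs Q \<Longrightarrow> x \<in> carrier M \<Longrightarrow> h (arrow a \<odot>\<^bsub>M\<^esub> x) = arrow a \<odot>\<^bsub>N\<^esub> h x"
  shows "restrict h (carrier M) \<in> mod_hom A M N"
proof -
  interpret M: left_module A M by fact
  interpret N: left_module A N by fact
  have "h \<zero>\<^bsub>M\<^esub> \<oplus>\<^bsub>N\<^esub> h \<zero>\<^bsub>M\<^esub> = h \<zero>\<^bsub>M\<^esub>"
    using h(2)[of "\<zero>\<^bsub>M\<^esub>" "\<zero>\<^bsub>M\<^esub>"] by simp
  then have hz: "h \<zero>\<^bsub>M\<^esub> = \<zero>\<^bsub>N\<^esub>"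
    by (rule N.M.double_eq_selfD[OF _ h(1)[OF M.M.zero_closed]])
  have "\<forall>x\<in>carrier M. h (f \<odot>\<^bsub>M\<^esub> x) = f \<odot>\<^bsub>N\<^esub> h x" if "f \<in> carrier A" for f
    using that
  proof (induction f rule: A_generated)
    case (mult f g)
    then show ?case by (simp add: M.smult_assoc N.smult_assoc h(1) M.smult_closed)
  qed (simp_all add: h hz M.smult_l_distr N.smult_l_distr M.smult_closed)
  note lin = this
  show ?thesis
  proof (rule mod_hom_restrictI)
    show "h (f \<odot>\<^bsub>M\<^esub> x) = f \<odot>\<^bsub>N\<^esub> h x" if "f \<in> carrier A" "x \<in> carrier M" for f x
      using lin[OF that(1)] that(2) by (rule bspec)
  qed (fact h(1) h(2) M)+
qed

end

section \<open>Counting homomorphisms along exact sequences\<close>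

lemma (in abelian_group) eq_minus_add:
  "x \<in> carrier G \<Longrightarrow> y \<in> carrier G \<Longrightarrow> y \<oplus> (x \<ominus> y) = x"
  by (simp add: a_minus_def a_lcomm r_neg)

lemma (in abelian_group) r_neg3:
  "x \<in> carrier G \<Longrightarrow> y \<in> carrier G \<Longrightarrow> x \<oplus> (y \<oplus> \<ominus> x) = y"
  using a_comm[of y "\<ominus> x"] by (simp add: r_neg2)

lemma mod_hom_diff:
  assumes "f \<in> mod_hom R X Y" "g \<in> mod_hom R X Y" "left_module R X" "left_module R Y"
  shows "restrict (\<lambda>x. f x \<ominus>\<^bsub>Y\<^esub> g x) (carrier X) \<in> mod_hom R X Y"
proof -
  interpret Y: left_module R Y by fact
  show ?thesis
  proof (rule mod_hom_restrictI[OF _ _ _ assms(3)])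
    fix x y assume xy: "x \<in> carrier X" "y \<in> carrier X"
    note c = mod_homD(2)[OF assms(1) xy(1)] mod_homD(2)[OF assms(1) xy(2)]
      mod_homD(2)[OF assms(2) xy(1)] mod_homD(2)[OF assms(2) xy(2)]
    show "f (x \<oplus>\<^bsub>X\<^esub> y) \<ominus>\<^bsub>Y\<^esub> g (x \<oplus>\<^bsub>X\<^esub> y) = (f x \<ominus>\<^bsub>Y\<^esub> g x) \<oplus>\<^bsub>Y\<^esub> (f y \<ominus>\<^bsub>Y\<^esub> g y)"
      using c by (simp add: mod_homD(3)[OF assms(1) xy] mod_homD(3)[OF assms(2) xy] 
        a_minus_def Y.M.minus_add Y.M.a_ac)
  next
    fix a x assume ax: "a \<in> carrier R" "x \<in> carrier X"
    note c = mod_homD(2)[OF assms(1) ax(2)] mod_homD(2)[OF assms(2) ax(2)]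
    show "f (a \<odot>\<^bsub>X\<^esub> x) \<ominus>\<^bsub>Y\<^esub> g (a \<odot>\<^bsub>X\<^esub> x) = a \<odot>\<^bsub>Y\<^esub> (f x \<ominus>\<^bsub>Y\<^esub> g x)"
      using ax c by (simp add: mod_homD(4)[OF assms(1) ax] mod_homD(4)[OF assms(2) ax] 
        a_minus_def Y.smult_r_distr Y.smult_minus)
  qed (simp add: mod_homD(2)[OF assms(1)] mod_homD(2)[OF assms(2)])
qed

lemma mod_hom_add:
  assumes "f \<in> mod_hom R X Y" "g \<in> mod_hom R X Y" "left_module R X" "left_module R Y"
  shows "restrict (\<lambda>x. f x \<oplus>\<^bsub>Y\<^esub> g x) (carrier X) \<in> mod_hom R X Y"
proof -
  interpret Y: left_module R Y by fact
  show ?thesis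
  proof (rule mod_hom_restrictI[OF _ _ _ assms(3)])
    fix x y assume xy: "x \<in> carrier X" "y \<in> carrier X"
    note c = mod_homD(2)[OF assms(1) xy(1)] mod_homD(2)[OF assms(1) xy(2)]
      mod_homD(2)[OF assms(2) xy(1)] mod_homD(2)[OF assms(2) xy(2)]
    show "f (x \<oplus>\<^bsub>X\<^esub> y) \<oplus>\<^bsub>Y\<^esub> g (x \<oplus>\<^bsub>X\<^esub> y) = (f x \<oplus>\<^bsub>Y\<^esub> g x) \<oplus>\<^bsub>Y\<^esub> (f y \<oplus>\<^bsub>Y\<^esub> g y)"
      using c by (simp add: mod_homD(3)[OF assms(1) xy] mod_homD(3)[OF assms(2) xy] Y.M.a_ac)
  next
    fix a x assume ax: "a \<in> carrier R" "x \<in> carrier X"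
    note c = mod_homD(2)[OF assms(1) ax(2)] mod_homD(2)[OF assms(2) ax(2)]
    show "f (a \<odot>\<^bsub>X\<^esub> x) \<oplus>\<^bsub>Y\<^esub> g (a \<odot>\<^bsub>X\<^esub> x) = a \<odot>\<^bsub>Y\<^esub> (f x \<oplus>\<^bsub>Y\<^esub> g x)"
      using ax c by (simp add: mod_homD(4)[OF assms(1) ax] mod_homD(4)[OF assms(2) ax] Y.smult_r_distr)
  qed (simp add: mod_homD(2)[OF assms(1)] mod_homD(2)[OF assms(2)])
qed

lemma mod_hom_const_zero:
  assumes "left_module R X" "left_module R Y"
  shows "restrict (\<lambda>x. \<zero>\<^bsub>Y\<^esub>) (carrier X) \<in> mod_hom R X Y"
proof -
  interpret Y: left_module R Y by fact
  show ?thesis by (rule mod_hom_restrictI[OF _ _ _ assms(1)]) simp_all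
qed

lemma card_mod_hom_pos:
  assumes "left_module R X" "left_module R Y" "finite (carrier X)" "finite (carrier Y)"
  shows "0 < card (mod_hom R X Y)"
  using mod_hom_const_zero[OF assms(1,2)] finite_mod_hom[OF assms(3,4)] by (auto simp: card_gt_0_iff)

lemma mod_hom_kernel_submodule:
  assumes "f \<in> mod_hom R X Y" "\<And>x. x \<in> carrier X \<Longrightarrow> p (f x) = \<zero>\<^bsub>Z\<^esub>"
  shows "f \<in> mod_hom R X (Y\<lparr>carrier := mod_ker Y Z p\<rparr>)"
  using assms(2) mod_homD(2)[OF assms(1)]
  by (intro mod_homI) (simp_all add: mod_ker_def mod_homD(1,3,4)[OF assms(1)])

text \<open>
  For fibres of additive maps on homomorphisms: \<open>D\<close> is the difference of two homomorphisms in the same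
  fibre, read as an element of the kernel.
\<close>

lemma card_fibre_le:
  assumes "finite C" "\<And>f g. f \<in> F \<Longrightarrow> g \<in> F \<Longrightarrow> D f g \<in> C"
    "\<And>f f' g. f \<in> F \<Longrightarrow> f' \<in> F \<Longrightarrow> g \<in> F \<Longrightarrow> D f g = D f' g \<Longrightarrow> f = f'"
  shows "card F \<le> card C"
proof (cases "F = {}")
  case False
  then obtain g where g: "g \<in> F" by blast
  show ?thesis
  proof (rule card_inj_on_le[of "\<lambda>f. D f g"])
    show "inj_on (\<lambda>f. D f g) F" using assms(3) g by (intro inj_onI) blast
    show "(\<lambda>f. D f g) ` F \<subseteq> C" using assms(2) g by blast
  qed (rule assms(1))
qed simp

text \<open>
  The sequence \<open>0 \<rightarrow> Hom(X, ker p) \<rightarrow> Hom(X, Y) \<rightarrow> Hom(X, Z)\<close> is exact: two homomorphisms with the same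
  composite with \<open>p\<close> differ by a homomorphism to the kernel.
\<close>

lemma card_hom_left_exact:
  assumes X: "left_module R X" and Y: "left_module R Y" and Z: "left_module R Z"
    and fin: "finite (carrier X)" "finite (carrier Y)" and p: "p \<in> mod_hom R Y Z"
  shows "card (mod_hom R X Y) \<le> card ((\<lambda>f. restrict (\<lambda>x. p (f x)) (carrier X)) ` mod_hom R X Y) *
     card (mod_hom R X (Y\<lparr>carrier := mod_ker Y Z p\<rparr>))"
proof (rule card_le_image_fibre)
  let ?h = "\<lambda>f. restrict (\<lambda>x. p (f x)) (carrier X)"
  let ?D = "\<lambda>f g. restrict (\<lambda>x. f x \<ominus>\<^bsub>Y\<^esub> g x) (carrier X)"
  interpret Y: left_module R Y by fact
  interpret Z: left_module R Z by fact
  show "finite (mod_hom R X Y)" by (rule finite_mod_hom[OF fin])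
  then show "finite (?h ` mod_hom R X Y)" by simp
  fix b
  show "card {f \<in> mod_hom R X Y. ?h f = b} \<le> card (mod_hom R X (Y\<lparr>carrier := mod_ker Y Z p\<rparr>))"
  proof (rule card_fibre_le[where D = ?D])
    show "finite (mod_hom R X (Y\<lparr>carrier := mod_ker Y Z p\<rparr>))"
      using fin by (intro finite_mod_hom) (auto simp: mod_ker_def)
    fix f g assume f: "f \<in> {f \<in> mod_hom R X Y. ?h f = b}" and g: "g \<in> {f \<in> mod_hom R X Y. ?h f = b}"
    then have fg: "f \<in> mod_hom R X Y" "g \<in> mod_hom R X Y" "?h f = ?h g" by auto
    have "p (f x \<ominus>\<^bsub>Y\<^esub> g x) = \<zero>\<^bsub>Z\<^esub>" if x: "x \<in> carrier X" for x
    proof -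
      have "p (f x) = p (g x)" using fun_cong[OF fg(3), of x] x by simp
      then show ?thesis
        using mod_hom_minus[OF p Y Z mod_homD(2)[OF fg(1) x] mod_homD(2)[OF fg(2) x]]
          mod_homD(2)[OF p mod_homD(2)[OF fg(2) x]] by (simp add: a_minus_def Z.M.r_neg)
    qed
    then show "?D f g \<in> mod_hom R X (Y\<lparr>carrier := mod_ker Y Z p\<rparr>)"
      by (intro mod_hom_kernel_submodule[OF mod_hom_diff[OF fg(1,2) X Y]]) simp
  next
    fix f f' g assume f: "f \<in> {f \<in> mod_hom R X Y. ?h f = b}" "f' \<in> {f \<in> mod_hom R X Y. ?h f = b}" 
      "g \<in> {f \<in> mod_hom R X Y. ?h f = b}" and D: "?D f g = ?D f' g"
    then have fg: "f \<in> mod_hom R X Y" "f' \<in> mod_hom R X Y" "g \<in> mod_hom R X Y" by auto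
    show "f = f'"
    proof (rule mod_hom_eqI[OF fg(1,2)])
      fix x assume x: "x \<in> carrier X"
      note c = mod_homD(2)[OF fg(1) x] mod_homD(2)[OF fg(2) x] mod_homD(2)[OF fg(3) x]
      have "f x \<ominus>\<^bsub>Y\<^esub> g x = f' x \<ominus>\<^bsub>Y\<^esub> g x" using fun_cong[OF D, of x] x by simp
      then show "f x = f' x" using Y.M.eq_minus_add[OF c(1,3)] Y.M.eq_minus_add[OF c(2,3)] by metis
    qed
  qed
qed

text \<open>
  The sequence \<open>0 \<rightarrow> Hom(Z, Y) \<rightarrow> Hom(X, Y) \<rightarrow> Hom(ker p, Y)\<close> is exact: if two homomorphisms agree on the
  kernel of the surjection \<open>p\<close>, their difference factors through \<open>Z\<close>.
\<close>

lemma card_hom_right_exact: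
  assumes X: "left_module R X" and Y: "left_module R Y" and Z: "left_module R Z"
    and fin: "finite (carrier X)" "finite (carrier Y)" "finite (carrier Z)" 
    and p: "p \<in> mod_hom R X Z" "p ` carrier X = carrier Z"
  shows "card (mod_hom R X Y) \<le> card (mod_hom R (X\<lparr>carrier := mod_ker X Z p\<rparr>) Y) * card (mod_hom R Z Y)"
proof -
  let ?S = "mod_ker X Z p"
  let ?h = "\<lambda>f. restrict f ?S"
  let ?s = "inv_into (carrier X) p"
  let ?D = "\<lambda>f g. restrict (\<lambda>z. f (?s z) \<ominus>\<^bsub>Y\<^esub> g (?s z)) (carrier Z)"
  interpret X: left_module R X by fact
  interpret Y: left_module R Y by fact
  interpret Z: left_module R Z by fact
  have S: "submodule ?S R X" by (rule submodule_ker[OF p(1) X Z])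
  have fS: "finite ?S" using fin by (auto simp: mod_ker_def)
  have s: "?s z \<in> carrier X" "p (?s z) = z" if "z \<in> carrier Z" for z
    using that p(2) by (auto intro: inv_into_into f_inv_into_f)
  have D: "f (?s (p x)) \<ominus>\<^bsub>Y\<^esub> g (?s (p x)) = f x \<ominus>\<^bsub>Y\<^esub> g x"
    if fg: "f \<in> mod_hom R X Y" "g \<in> mod_hom R X Y" "?h f = ?h g" and x: "x \<in> carrier X" for f g x
  proof -
    define y where "y = ?s (p x)"
    have px: "p x \<in> carrier Z" using mod_homD(2)[OF p(1) x] .
    have y: "y \<in> carrier X" "p y = p x" using s[OF px] by (simp_all add: y_def)
    have d: "y \<ominus>\<^bsub>X\<^esub> x \<in> ?S"
      using mod_hom_minus[OF p(1) X Z y(1) x] y px by (simp add: mod_ker_def a_minus_def Z.M.r_neg x)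
    have e: "f (y \<ominus>\<^bsub>X\<^esub> x) = g (y \<ominus>\<^bsub>X\<^esub> x)" using fun_cong[OF fg(3), of "y \<ominus>\<^bsub>X\<^esub> x"] d by simp
    note c = mod_homD(2)[OF fg(1) x] mod_homD(2)[OF fg(1) y(1)] mod_homD(2)[OF fg(2) x] mod_homD(2)[OF fg(2) y(1)]
    have "f y = f x \<oplus>\<^bsub>Y\<^esub> (f y \<ominus>\<^bsub>Y\<^esub> f x)" using Y.M.eq_minus_add[OF c(2,1)] by simp
    also have "f y \<ominus>\<^bsub>Y\<^esub> f x = g y \<ominus>\<^bsub>Y\<^esub> g x"
      using e mod_hom_minus[OF fg(1) X Y y(1) x] mod_hom_minus[OF fg(2) X Y y(1) x] by simp
    finally have "f y \<ominus>\<^bsub>Y\<^esub> g y = f x \<oplus>\<^bsub>Y\<^esub> (g y \<ominus>\<^bsub>Y\<^esub> g x) \<ominus>\<^bsub>Y\<^esub> g y" by simp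
    also have "\<dots> = f x \<ominus>\<^bsub>Y\<^esub> g x"
      using c by (simp add: a_minus_def Y.M.a_assoc Y.M.r_neg3)
    finally show ?thesis by (simp add: y_def)
  qed
  have "card (mod_hom R X Y) \<le> card (?h ` mod_hom R X Y) * card (mod_hom R Z Y)"
  proof (rule card_le_image_fibre)
    show "finite (mod_hom R X Y)" by (rule finite_mod_hom[OF fin(1,2)])
    then show "finite (?h ` mod_hom R X Y)" by simp
    fix b
    show "card {f \<in> mod_hom R X Y. ?h f = b} \<le> card (mod_hom R Z Y)"
    proof (rule card_fibre_le[where D = ?D])
      show "finite (mod_hom R Z Y)" by (rule finite_mod_hom[OF fin(3,2)])
      fix f g assume "f \<in> {f \<in> mod_hom R X Y. ?h f = b}" "g \<in> {f \<in> mod_hom R X Y. ?h f = b}"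
      then have fg: "f \<in> mod_hom R X Y" "g \<in> mod_hom R X Y" "?h f = ?h g" by auto
      note d = mod_hom_diff[OF fg(1,2) X Y]
      define E where "E = (\<lambda>x. f x \<ominus>\<^bsub>Y\<^esub> g x)"
      have E: "E (x \<oplus>\<^bsub>X\<^esub> y) = E x \<oplus>\<^bsub>Y\<^esub> E y" "E (a \<odot>\<^bsub>X\<^esub> x) = a \<odot>\<^bsub>Y\<^esub> E x" "E x \<in> carrier Y"
        if "x \<in> carrier X" "y \<in> carrier X" "a \<in> carrier R" for x y a
        using mod_homD(3)[OF d that(1,2)] mod_homD(4)[OF d that(3,1)] mod_homD(2)[OF d that(1)] that
        by (simp_all add: E_def X.smult_closed)
      have Ep: "E (?s (p x)) = E x" if "x \<in> carrier X" for x
        using D[OF fg that] by (simp add: E_def)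
      have "restrict (\<lambda>z. E (?s z)) (carrier Z) \<in> mod_hom R Z Y"
      proof (rule mod_hom_restrictI[OF _ _ _ Z])
        show "E (?s z) \<in> carrier Y" if "z \<in> carrier Z" for z
          using E(3)[OF s(1)[OF that] s(1)[OF that] X.R.zero_closed] .
        show "E (?s (z \<oplus>\<^bsub>Z\<^esub> w)) = E (?s z) \<oplus>\<^bsub>Y\<^esub> E (?s w)" if "z \<in> carrier Z" "w \<in> carrier Z" for z w
          using Ep[of "?s z \<oplus>\<^bsub>X\<^esub> ?s w"] E(1)[OF s(1)[OF that(1)] s(1)[OF that(2)] X.R.zero_closed] 
            mod_homD(3)[OF p(1) s(1)[OF that(1)] s(1)[OF that(2)]] s that by simp
        show "E (?s (a \<odot>\<^bsub>Z\<^esub> z)) = a \<odot>\<^bsub>Y\<^esub> E (?s z)" if "a \<in> carrier R" "z \<in> carrier Z" for a z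
          using Ep[of "a \<odot>\<^bsub>X\<^esub> ?s z"] E(2)[OF s(1)[OF that(2)] s(1)[OF that(2)] that(1)] 
            mod_homD(4)[OF p(1) that(1) s(1)[OF that(2)]] s that by (simp add: X.smult_closed)
      qed
      then show "?D f g \<in> mod_hom R Z Y" by (simp add: E_def)
    next
      fix f f' g assume f: "f \<in> {f \<in> mod_hom R X Y. ?h f = b}" "f' \<in> {f \<in> mod_hom R X Y. ?h f = b}" 
        "g \<in> {f \<in> mod_hom R X Y. ?h f = b}" and De: "?D f g = ?D f' g"
      then have fg: "f \<in> mod_hom R X Y" "f' \<in> mod_hom R X Y" "g \<in> mod_hom R X Y" 
        "?h f = ?h g" "?h f' = ?h g" by auto
      show "f = f'"
      proof (rule mod_hom_eqI[OF fg(1,2)])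
        fix x assume x: "x \<in> carrier X"
        note c = mod_homD(2)[OF fg(1) x] mod_homD(2)[OF fg(2) x] mod_homD(2)[OF fg(3) x]
        have "f x \<ominus>\<^bsub>Y\<^esub> g x = f' x \<ominus>\<^bsub>Y\<^esub> g x"
          using fun_cong[OF De, of "p x"] D[OF fg(1,3,4) x] D[OF fg(2,3,5) x] mod_homD(2)[OF p(1) x] by simp
        then show "f x = f' x" using Y.M.eq_minus_add[OF c(1,3)] Y.M.eq_minus_add[OF c(2,3)] by metis
      qed
    qed
  qed
  also have "card (?h ` mod_hom R X Y) \<le> card (mod_hom R (X\<lparr>carrier := ?S\<rparr>) Y)"
    using mod_hom_restrict_submodule[OF X S] fS fin(2)
    by (intro card_mono finite_mod_hom) auto
  finally show ?thesis by simp
qed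

text \<open>
  Applying \<open>Hom\<close> to the extension of \<open>N\<close> by \<open>S\<close> in both arguments bounds the endomorphisms of \<open>M\<close> by the four
  sets of homomorphisms between \<open>S\<close> and \<open>N\<close>. The bound is strict, because the identity of \<open>N\<close> does not lift
  to \<open>M\<close>. The direct sum of \<open>S\<close> and \<open>N\<close> attains it (see \<open>card_End_direct\<close>), so the direct sum has more
  endomorphisms than any nonsplit extension.
\<close>

lemma card_End_nonsplit:
  assumes M: "left_module R M" and N: "left_module R N"
    and fin: "finite (carrier M)" "finite (carrier N)" 
    and p: "p \<in> mod_hom R M N" "p ` carrier M = carrier N"
    and nonsplit: "\<not> (\<exists>s\<in>mod_hom R N M. \<forall>x\<in>carrier N. p (s x) = x)"
    and S: "S = M\<lparr>carrier := mod_ker M N p\<rparr>"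
  shows "card (mod_hom R M M) < 
    card (mod_hom R S S) * card (mod_hom R S N) * (card (mod_hom R N S) * card (mod_hom R N N))"
proof -
  interpret M: left_module R M by fact
  let ?H = "\<lambda>X Y. card (mod_hom R X Y)"
  have Sm: "left_module R S" unfolding S by (rule M.left_module_submodule[OF submodule_ker[OF p(1) M N]])
  have fS: "finite (carrier S)" using fin by (auto simp: S mod_ker_def)
  let ?I = "\<lambda>X. (\<lambda>f. restrict (\<lambda>x. p (f x)) (carrier X)) ` mod_hom R X M"
  have 1: "?H M M \<le> ?H S M * ?H N M" unfolding S by (rule card_hom_right_exact[OF M M N fin(1,1,2) p])
  have 2: "?H S M \<le> card (?I S) * ?H S S"
    using card_hom_left_exact[OF Sm M N fS fin(1) p(1)] by (simp add: S)
  have "?I S \<subseteq> mod_hom R S N" using mod_hom_comp[OF _ p(1) Sm] by blast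
  then have 3: "card (?I S) \<le> ?H S N" by (rule card_mono[OF finite_mod_hom[OF fS fin(2)]])
  have 4: "?H N M \<le> card (?I N) * ?H N S"
    using card_hom_left_exact[OF N M N fin(2,1) p(1)] by (simp add: S)
  let ?id = "restrict (\<lambda>x. x) (carrier N)"
  have "?I N \<subseteq> mod_hom R N N" using mod_hom_comp[OF _ p(1) N] by blast
  moreover have "?id \<notin> ?I N"
  proof
    assume "?id \<in> ?I N"
    then obtain s where s: "s \<in> mod_hom R N M" "?id = restrict (\<lambda>x. p (s x)) (carrier N)" by blast
    have "p (s x) = x" if "x \<in> carrier N" for x using fun_cong[OF s(2), of x] that by simp
    then show False using nonsplit s(1) by blast
  qed
  ultimately have "?I N \<subset> mod_hom R N N" using mod_hom_id[OF N] by blast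
  then have 5: "card (?I N) < ?H N N" by (rule psubset_card_mono[OF finite_mod_hom[OF fin(2,2)]])
  have pos: "0 < ?H S S" "0 < ?H S N" "0 < ?H N S" using Sm N fS fin by (auto intro!: card_mod_hom_pos)
  have "?H M M \<le> (card (?I S) * ?H S S) * (card (?I N) * ?H N S)"
    using 1 2 4 by (meson le_trans mult_le_mono)
  also have "\<dots> \<le> (?H S N * ?H S S) * (card (?I N) * ?H N S)" using 3 by simp
  also have "\<dots> < (?H S N * ?H S S) * (?H N N * ?H N S)" using 5 pos by simp
  finally show ?thesis by (simp add: mult.commute)
qed

section \<open>Direct decompositions of modules\<close>

definition direct_decomposition :: "'a ring \<Rightarrow> ('a, 'b) module \<Rightarrow> 'b set \<Rightarrow> 'b set \<Rightarrow> bool" where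
  "direct_decomposition R M N N' \<longleftrightarrow> submodule N R M \<and> submodule N' R M \<and>
     N \<inter> N' = {\<zero>\<^bsub>M\<^esub>} \<and> carrier M = {x \<oplus>\<^bsub>M\<^esub> y | x y. x \<in> N \<and> y \<in> N'}"

lemma direct_decomposition_sym:
  assumes "left_module R M" "direct_decomposition R M N N'"
  shows "direct_decomposition R M N' N"
proof -
  interpret M: left_module R M by fact
  have s: "submodule N R M" "submodule N' R M" "N \<inter> N' = {\<zero>\<^bsub>M\<^esub>}" "carrier M = {x \<oplus>\<^bsub>M\<^esub> y | x y. x \<in> N \<and> y \<in> N'}"
    using assms(2) by (auto simp: direct_decomposition_def)
  have c: "x \<oplus>\<^bsub>M\<^esub> y = y \<oplus>\<^bsub>M\<^esub> x" if "x \<in> N" "y \<in> N'" for x y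
    using M.M.a_comm[OF M.submoduleD(3)[OF s(1) that(1)] M.submoduleD(3)[OF s(2) that(2)]] .
  have "{x \<oplus>\<^bsub>M\<^esub> y | x y. x \<in> N \<and> y \<in> N'} = {y \<oplus>\<^bsub>M\<^esub> x | x y. x \<in> N \<and> y \<in> N'}"
    by (rule Collect_cong) (metis c)
  then have "carrier M = {x \<oplus>\<^bsub>M\<^esub> y | x y. x \<in> N' \<and> y \<in> N}" unfolding s(4) by blast
  then show ?thesis using s(1-3) unfolding direct_decomposition_def by (simp add: Int_commute)
qed

lemma projection_exists:
  assumes M: "left_module R M" and d: "direct_decomposition R M N N'"
  obtains \<pi> where "\<pi> \<in> mod_hom R M (M\<lparr>carrier := N\<rparr>)" "\<And>x. x \<in> N \<Longrightarrow> \<pi> x = x"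
    "mod_ker M (M\<lparr>carrier := N\<rparr>) \<pi> = N'" "\<And>x. x \<in> carrier M \<Longrightarrow> x \<ominus>\<^bsub>M\<^esub> \<pi> x \<in> N'"
proof -
  interpret M: left_module R M by fact
  have s: "submodule N R M" "submodule N' R M" "N \<inter> N' = {\<zero>\<^bsub>M\<^esub>}" "carrier M = {x \<oplus>\<^bsub>M\<^esub> y | x y. x \<in> N \<and> y \<in> N'}"
    using d by (auto simp: direct_decomposition_def)
  note N = M.submoduleD[OF s(1)] and N' = M.submoduleD[OF s(2)]
  have uniq: "n = m" if "n \<in> N" "m \<in> N" "x \<in> carrier M" "x \<ominus>\<^bsub>M\<^esub> n \<in> N'" "x \<ominus>\<^bsub>M\<^esub> m \<in> N'" for n m x
  proof -
    have c: "n \<in> carrier M" "m \<in> carrier M" using that N(3) by auto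
    have "(x \<ominus>\<^bsub>M\<^esub> n) \<oplus>\<^bsub>M\<^esub> \<ominus>\<^bsub>M\<^esub> (x \<ominus>\<^bsub>M\<^esub> m) \<in> N'"
      using N'(4)[OF that(4) M.submodule_neg[OF s(2) that(5)]] .
    moreover have "(x \<ominus>\<^bsub>M\<^esub> n) \<oplus>\<^bsub>M\<^esub> \<ominus>\<^bsub>M\<^esub> (x \<ominus>\<^bsub>M\<^esub> m) = m \<ominus>\<^bsub>M\<^esub> n"
      using c that(3) by (simp add: a_minus_def M.M.minus_add M.M.a_ac M.M.r_neg2 M.M.r_neg3)
    moreover have "m \<ominus>\<^bsub>M\<^esub> n \<in> N"
      unfolding a_minus_def by (rule N(4)[OF that(2) M.submodule_neg[OF s(1) that(1)]])
    ultimately have "m \<ominus>\<^bsub>M\<^esub> n = \<zero>\<^bsub>M\<^esub>" using s(3) by auto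
    then show ?thesis using M.M.minus_eq_zeroD[of m n] c by simp
  qed
  define \<pi> where "\<pi> x = (THE n. n \<in> N \<and> x \<ominus>\<^bsub>M\<^esub> n \<in> N')" for x
  have piI: "\<pi> x = n" if xn: "x \<in> carrier M" "n \<in> N" "x \<ominus>\<^bsub>M\<^esub> n \<in> N'" for x n
    unfolding \<pi>_def
  proof (rule the_equality)
    show "m = n" if m: "m \<in> N \<and> x \<ominus>\<^bsub>M\<^esub> m \<in> N'" for m
      using uniq[OF conjunct1[OF m] xn(2,1) conjunct2[OF m] xn(3)] .
  qed (use xn in simp)
  have pi: "\<pi> x \<in> N" "x \<ominus>\<^bsub>M\<^esub> \<pi> x \<in> N'" if xM: "x \<in> carrier M" for x
  proof -
    obtain n n' where n: "n \<in> N" "n' \<in> N'" "x = n \<oplus>\<^bsub>M\<^esub> n'" using xM s(4) by blast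
    have "x \<ominus>\<^bsub>M\<^esub> n = n'"
      using N(3)[OF n(1)] N'(3)[OF n(2)] by (simp add: n(3) a_minus_def M.M.a_assoc M.M.r_neg3)
    then have "\<pi> x = n" using piI[OF xM n(1)] n(2) by simp
    then show "\<pi> x \<in> N" "x \<ominus>\<^bsub>M\<^esub> \<pi> x \<in> N'" using n \<open>x \<ominus>\<^bsub>M\<^esub> n = n'\<close> by simp_all
  qed
  let ?p = "restrict \<pi> (carrier M)"
  have hom: "?p \<in> mod_hom R M (M\<lparr>carrier := N\<rparr>)"
  proof (rule mod_hom_restrictI[OF _ _ _ M])
    show "\<pi> x \<in> carrier (M\<lparr>carrier := N\<rparr>)" if "x \<in> carrier M" for x using pi[OF that] by simp
    fix x y assume x: "x \<in> carrier M" and y: "y \<in> carrier M"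
    note c = x y N(3)[OF pi(1)[OF x]] N(3)[OF pi(1)[OF y]]
    have "(x \<oplus>\<^bsub>M\<^esub> y) \<ominus>\<^bsub>M\<^esub> (\<pi> x \<oplus>\<^bsub>M\<^esub> \<pi> y) = (x \<ominus>\<^bsub>M\<^esub> \<pi> x) \<oplus>\<^bsub>M\<^esub> (y \<ominus>\<^bsub>M\<^esub> \<pi> y)"
      using c by (simp add: a_minus_def M.M.minus_add M.M.a_ac)
    also have "\<dots> \<in> N'" using N'(4) pi x y by simp
    finally show "\<pi> (x \<oplus>\<^bsub>M\<^esub> y) = \<pi> x \<oplus>\<^bsub>M\<lparr>carrier := N\<rparr>\<^esub> \<pi> y"
      using N(4) pi x y by (simp add: piI)
  next
    fix a x assume a: "a \<in> carrier R" and x: "x \<in> carrier M"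
    note c = x N(3)[OF pi(1)[OF x]]
    have "(a \<odot>\<^bsub>M\<^esub> x) \<ominus>\<^bsub>M\<^esub> (a \<odot>\<^bsub>M\<^esub> \<pi> x) = a \<odot>\<^bsub>M\<^esub> (x \<ominus>\<^bsub>M\<^esub> \<pi> x)"
      using c a by (simp add: a_minus_def M.smult_r_distr M.smult_minus)
    also have "\<dots> \<in> N'" using N'(5) pi x a by simp
    finally show "\<pi> (a \<odot>\<^bsub>M\<^esub> x) = a \<odot>\<^bsub>M\<lparr>carrier := N\<rparr>\<^esub> \<pi> x"
      using N(5) pi x a by (simp add: piI M.smult_closed)
  qed
  have id: "?p x = x" if "x \<in> N" for x
    using that N(3)[OF that] N'(2) piI[of x x] by (simp add: a_minus_def M.M.r_neg)
  have m0: "\<ominus>\<^bsub>M\<^esub> \<zero>\<^bsub>M\<^esub> = \<zero>\<^bsub>M\<^esub>" using M.M.minus_equality[of "\<zero>\<^bsub>M\<^esub>" "\<zero>\<^bsub>M\<^esub>"] by simp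
  have ker: "mod_ker M (M\<lparr>carrier := N\<rparr>) ?p = N'"
  proof (intro equalityI subsetI)
      fix x assume "x \<in> mod_ker M (M\<lparr>carrier := N\<rparr>) ?p"
      then have "x \<in> carrier M" "\<pi> x = \<zero>\<^bsub>M\<^esub>" by (auto simp: mod_ker_def)
      then show "x \<in> N'" using pi(2)[of x] by (simp add: a_minus_def m0)
    next
      fix x assume "x \<in> N'"
      then show "x \<in> mod_ker M (M\<lparr>carrier := N\<rparr>) ?p"
        using N'(3)[of x] N(2) piI[of x "\<zero>\<^bsub>M\<^esub>"] by (simp add: mod_ker_def a_minus_def m0)
  qed
  have "x \<ominus>\<^bsub>M\<^esub> ?p x \<in> N'" if "x \<in> carrier M" for x using pi(2)[OF that] that by simp
  from that[OF hom id ker this] show ?thesis .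
qed

text \<open>
  Endomorphisms of a direct sum are matrices of size two.
\<close>

lemma card_End_direct:
  assumes M: "left_module R M" and d: "direct_decomposition R M N' N" and fin: "finite (carrier M)"
    and S: "S = M\<lparr>carrier := N'\<rparr>" and T: "T = M\<lparr>carrier := N\<rparr>"
  shows "card (mod_hom R S S) * card (mod_hom R S T) * (card (mod_hom R T S) * card (mod_hom R T T))
    \<le> card (mod_hom R M M)"
proof -
  interpret M: left_module R M by fact
  have s: "submodule N' R M" "submodule N R M" "N' \<inter> N = {\<zero>\<^bsub>M\<^esub>}"
    using d by (auto simp: direct_decomposition_def)
  note Nd = M.submoduleD[OF s(2)] and Nd' = M.submoduleD[OF s(1)]
  obtain \<pi> where pi: "\<pi> \<in> mod_hom R M T" "\<And>x. x \<in> N \<Longrightarrow> \<pi> x = x" "mod_ker M T \<pi> = N'"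
    by (rule projection_exists[OF M direct_decomposition_sym[OF M d], folded T]) (rule that)
  obtain \<pi>' where pi': "\<pi>' \<in> mod_hom R M S" "\<And>x. x \<in> N' \<Longrightarrow> \<pi>' x = x" "mod_ker M S \<pi>' = N"
    by (rule projection_exists[OF M d, folded S]) (rule that)
  have z: "\<pi> x = \<zero>\<^bsub>M\<^esub>" if "x \<in> N'" for x using that pi(3) T by (auto simp: mod_ker_def)
  have z': "\<pi>' x = \<zero>\<^bsub>M\<^esub>" if "x \<in> N" for x using that pi'(3) S by (auto simp: mod_ker_def)
  have Sm: "left_module R S" "left_module R T" using M.left_module_submodule s by (simp_all add: S T)
  have cS [simp]: "carrier S = N'" "carrier T = N" by (simp_all add: S T)
  have im: "\<pi> x \<in> N" "\<pi>' x \<in> N'" if "x \<in> carrier M" for x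
    using mod_homD(2)[OF pi(1) that] mod_homD(2)[OF pi'(1) that] by simp_all
  define F where "F = (\<lambda>((a, b), (c, d)). restrict (\<lambda>x. (a (\<pi>' x) \<oplus>\<^bsub>M\<^esub> b (\<pi>' x)) \<oplus>\<^bsub>M\<^esub> (c (\<pi> x) \<oplus>\<^bsub>M\<^esub> d (\<pi> x))) (carrier M))"
  let ?D = "(mod_hom R S S \<times> mod_hom R S T) \<times> (mod_hom R T S \<times> mod_hom R T T)"
  have SM: "f \<in> mod_hom R X M" if "f \<in> mod_hom R X S" for f and X :: "('a, 'b) module"
    using mod_hom_into_submodule[OF that[unfolded S] Nd'(1)] .
  have TM: "f \<in> mod_hom R X M" if "f \<in> mod_hom R X T" for f and X :: "('a, 'b) module"
    using mod_hom_into_submodule[OF that[unfolded T] Nd(1)] .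
  have hom: "F ((a, b), (c, d)) \<in> mod_hom R M M"
    if "a \<in> mod_hom R S S" "b \<in> mod_hom R S T" "c \<in> mod_hom R T S" "d \<in> mod_hom R T T" for a b c d
  proof -
    note h = mod_hom_comp[OF pi'(1) SM[OF that(1)] M] mod_hom_comp[OF pi'(1) TM[OF that(2)] M]
      mod_hom_comp[OF pi(1) SM[OF that(3)] M] mod_hom_comp[OF pi(1) TM[OF that(4)] M]
    have "restrict (\<lambda>x. restrict (\<lambda>x. restrict (\<lambda>x. a (\<pi>' x)) (carrier M) x \<oplus>\<^bsub>M\<^esub> restrict (\<lambda>x. b (\<pi>' x)) (carrier M) x) (carrier M) x \<oplus>\<^bsub>M\<^esub>
       restrict (\<lambda>x. restrict (\<lambda>x. c (\<pi> x)) (carrier M) x \<oplus>\<^bsub>M\<^esub> restrict (\<lambda>x. d (\<pi> x)) (carrier M) x) (carrier M) x) (carrier M) \<in> mod_hom R M M"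
      by (intro mod_hom_add h M)
    then show ?thesis by (simp add: F_def cong: restrict_cong)
  qed
  have rec: "\<pi>' (F ((a, b), (c, d)) x) = a x \<and> \<pi> (F ((a, b), (c, d)) x) = b x" 
    if h: "a \<in> mod_hom R S S" "b \<in> mod_hom R S T" "c \<in> mod_hom R T S" "d \<in> mod_hom R T T" and x: "x \<in> N'" for a b c d x
  proof -
    have xM: "x \<in> carrier M" using x Nd' by simp
    have z0: "c \<zero>\<^bsub>M\<^esub> = \<zero>\<^bsub>M\<^esub>" "d \<zero>\<^bsub>M\<^esub> = \<zero>\<^bsub>M\<^esub>"
      using mod_hom_zero[OF h(3) Sm(2,1)] mod_hom_zero[OF h(4) Sm(2,2)] by (simp_all add: S T)
    have ab: "a x \<in> N'" "b x \<in> N" using mod_homD(2)[OF h(1), of x] mod_homD(2)[OF h(2), of x] x by simp_all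
    then have c: "a x \<in> carrier M" "b x \<in> carrier M" using Nd Nd' by auto
    have "F ((a, b), (c, d)) x = a x \<oplus>\<^bsub>M\<^esub> b x"
      using xM c by (simp add: F_def pi'(2)[OF x] z[OF x] z0)
    then show ?thesis
      using mod_homD(3)[OF pi(1) c] mod_homD(3)[OF pi'(1) c] ab c pi(2) pi'(2) z z' by (simp add: S T)
  qed
  have rec': "\<pi>' (F ((a, b), (c, d)) x) = c x \<and> \<pi> (F ((a, b), (c, d)) x) = d x" 
    if h: "a \<in> mod_hom R S S" "b \<in> mod_hom R S T" "c \<in> mod_hom R T S" "d \<in> mod_hom R T T" and x: "x \<in> N" for a b c d x
  proof -
    have xM: "x \<in> carrier M" using x Nd by simp
    have z0: "a \<zero>\<^bsub>M\<^esub> = \<zero>\<^bsub>M\<^esub>" "b \<zero>\<^bsub>M\<^esub> = \<zero>\<^bsub>M\<^esub>"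
      using mod_hom_zero[OF h(1) Sm(1,1)] mod_hom_zero[OF h(2) Sm(1,2)] by (simp_all add: S T)
    have cd: "c x \<in> N'" "d x \<in> N" using mod_homD(2)[OF h(3), of x] mod_homD(2)[OF h(4), of x] x by simp_all
    then have c: "c x \<in> carrier M" "d x \<in> carrier M" using Nd Nd' by auto
    have "F ((a, b), (c, d)) x = c x \<oplus>\<^bsub>M\<^esub> d x"
      using xM c by (simp add: F_def pi(2)[OF x] z'[OF x] z0)
    then show ?thesis
      using mod_homD(3)[OF pi(1) c] mod_homD(3)[OF pi'(1) c] cd c pi(2) pi'(2) z z' by (simp add: S T)
  qed
  have "card ?D \<le> card (mod_hom R M M)"
  proof (rule card_inj_on_le[of F])
    show "F ` ?D \<subseteq> mod_hom R M M" using hom by auto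
    show "finite (mod_hom R M M)" by (rule finite_mod_hom[OF fin fin])
    show "inj_on F ?D"
    proof (rule inj_onI)
      fix u v assume u: "u \<in> ?D" and v: "v \<in> ?D" and e: "F u = F v"
      obtain a b c d where u': "u = ((a, b), (c, d))" by (metis surj_pair)
      obtain a' b' c' d' where v': "v = ((a', b'), (c', d'))" by (metis surj_pair)
      have h: "a \<in> mod_hom R S S" "b \<in> mod_hom R S T" "c \<in> mod_hom R T S" "d \<in> mod_hom R T T"
        "a' \<in> mod_hom R S S" "b' \<in> mod_hom R S T" "c' \<in> mod_hom R T S" "d' \<in> mod_hom R T T"
        using u v u' v' by auto
      have "a x = a' x" "b x = b' x" if "x \<in> carrier S" for x
        using rec[OF h(1-4), of x] rec[OF h(5-8), of x] that e[unfolded u' v'] by simp_all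
      moreover have "c x = c' x" "d x = d' x" if "x \<in> carrier T" for x
        using rec'[OF h(1-4), of x] rec'[OF h(5-8), of x] that e[unfolded u' v'] by simp_all
      ultimately show "u = v"
        using mod_hom_eqI[OF h(1,5)] mod_hom_eqI[OF h(2,6)] mod_hom_eqI[OF h(3,7)] mod_hom_eqI[OF h(4,8)]
        by (simp add: u' v')
    qed
  qed
  then show ?thesis by (simp add: card_cartesian_product mult.assoc)
qed

section \<open>Finite vector spaces\<close>

text \<open>
  A step of the construction of a basis: \<open>W'\<close> is spanned by \<open>W\<close> and the new vector \<open>u\<close>, and a linear map on
  \<open>W'\<close> amounts to a linear map on \<open>W\<close> and an arbitrary value at \<open>u\<close>.
\<close>

lemma vector_space_extend:
  fixes U :: "('k, 'b) module" and V :: "('k, 'c) module"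
  assumes K: "field K" and U: "left_module K U" and V: "left_module K V"
    and W: "submodule W K U" and u: "u \<in> carrier U" "u \<notin> W"
  shows "\<exists>W'. submodule W' K U \<and> W \<subset> W' \<and> card W' = card W * card (carrier K) \<and>
    card (mod_hom K (U\<lparr>carrier := W'\<rparr>) V) = card (mod_hom K (U\<lparr>carrier := W\<rparr>) V) * card (carrier V)"
proof -
  interpret K: field K by fact
  interpret U: left_module K U by fact
  interpret V: left_module K V by fact
  note Wd = U.submoduleD[OF W]
  define j where "j = (\<lambda>(w, c). w \<oplus>\<^bsub>U\<^esub> c \<odot>\<^bsub>U\<^esub> u)"
  define W' where "W' = j ` (W \<times> carrier K)"
  have jc: "j (w, c) \<in> carrier U" if "w \<in> W" "c \<in> carrier K" for w c
    using that Wd(3) u by (simp add: j_def U.smult_closed)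
  have jadd: "j (w, c) \<oplus>\<^bsub>U\<^esub> j (w', c') = j (w \<oplus>\<^bsub>U\<^esub> w', c \<oplus>\<^bsub>K\<^esub> c')"
    if "w \<in> W" "c \<in> carrier K" "w' \<in> W" "c' \<in> carrier K" for w c w' c'
    using that Wd(3) u by (simp add: j_def U.smult_closed U.smult_l_distr U.M.a_ac)
  have jsm: "a \<odot>\<^bsub>U\<^esub> j (w, c) = j (a \<odot>\<^bsub>U\<^esub> w, a \<otimes>\<^bsub>K\<^esub> c)"
    if "w \<in> W" "c \<in> carrier K" "a \<in> carrier K" for w c a
    using that Wd(3) u by (simp add: j_def U.smult_closed U.smult_r_distr U.smult_assoc)
  have j0: "j (w, c) = \<zero>\<^bsub>U\<^esub> \<Longrightarrow> w = \<zero>\<^bsub>U\<^esub> \<and> c = \<zero>\<^bsub>K\<^esub>" if w: "w \<in> W" "c \<in> carrier K" for w c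
  proof -
    assume z: "j (w, c) = \<zero>\<^bsub>U\<^esub>"
    have cu: "c \<odot>\<^bsub>U\<^esub> u = \<ominus>\<^bsub>U\<^esub> w"
    proof -
      have "c \<odot>\<^bsub>U\<^esub> u \<oplus>\<^bsub>U\<^esub> w = \<zero>\<^bsub>U\<^esub>" 
        using z w u Wd(3)[OF w(1)] by (simp add: j_def U.M.a_comm U.smult_closed)
      then show ?thesis using U.M.minus_equality[of "c \<odot>\<^bsub>U\<^esub> u" w] w u Wd(3)[OF w(1)] by (simp add: U.smult_closed)
    qed
    have "c = \<zero>\<^bsub>K\<^esub>"
    proof (rule ccontr)
      assume "c \<noteq> \<zero>\<^bsub>K\<^esub>"
      then have c: "c \<in> Units K" using w K.field_Units by simp
      have "u = (inv\<^bsub>K\<^esub> c \<otimes>\<^bsub>K\<^esub> c) \<odot>\<^bsub>U\<^esub> u" using c u by (simp add: U.smult_one)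
      also have "\<dots> = inv\<^bsub>K\<^esub> c \<odot>\<^bsub>U\<^esub> (\<ominus>\<^bsub>U\<^esub> w)" 
        unfolding cu[symmetric] using w(2) u c by (intro U.smult_assoc) simp_all
      also have "\<dots> \<in> W" using Wd(5) U.submodule_neg[OF W w(1)] c by simp
      finally show False using u by simp
    qed
    then show ?thesis using z u Wd(3)[OF w(1)] by (simp add: j_def)
  qed
  have jinj: "w = w' \<and> c = c'" if h: "w \<in> W" "c \<in> carrier K" "w' \<in> W" "c' \<in> carrier K" "j (w, c) = j (w', c')" for w c w' c'
  proof -
    have n: "\<ominus>\<^bsub>U\<^esub> w' \<in> W" "\<ominus>\<^bsub>K\<^esub> c' \<in> carrier K" using U.submodule_neg[OF W h(3)] h(4) by simp_all
    have "j (w, c) \<oplus>\<^bsub>U\<^esub> j (\<ominus>\<^bsub>U\<^esub> w', \<ominus>\<^bsub>K\<^esub> c') = j (w', c') \<oplus>\<^bsub>U\<^esub> j (\<ominus>\<^bsub>U\<^esub> w', \<ominus>\<^bsub>K\<^esub> c')" using h by simp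
    also have "\<dots> = \<zero>\<^bsub>U\<^esub>" using h n Wd(3)[OF h(3)] u by (simp add: jadd) (simp add: j_def U.M.r_neg K.r_neg)
    finally have "j (w \<ominus>\<^bsub>U\<^esub> w', c \<ominus>\<^bsub>K\<^esub> c') = \<zero>\<^bsub>U\<^esub>"
      unfolding a_minus_def jadd[OF h(1,2) n] .
    then have "w \<ominus>\<^bsub>U\<^esub> w' = \<zero>\<^bsub>U\<^esub>" "c \<ominus>\<^bsub>K\<^esub> c' = \<zero>\<^bsub>K\<^esub>"
      using j0[of "w \<ominus>\<^bsub>U\<^esub> w'" "c \<ominus>\<^bsub>K\<^esub> c'"] h n Wd(4) by (simp_all add: a_minus_def)
    then show ?thesis using U.M.minus_eq_zeroD[of w w'] K.minus_eq_zeroD[of c c'] h Wd(3) by simp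
  qed
  have inj: "inj_on j (W \<times> carrier K)" using jinj by (intro inj_onI) auto
  have W': "submodule W' K U"
    unfolding U.submodule_iff W'_def
  proof (intro conjI ballI)
    show "j ` (W \<times> carrier K) \<subseteq> carrier U" using jc by auto
    have "j (\<zero>\<^bsub>U\<^esub>, \<zero>\<^bsub>K\<^esub>) = \<zero>\<^bsub>U\<^esub>" using u by (simp add: j_def)
    then show "\<zero>\<^bsub>U\<^esub> \<in> j ` (W \<times> carrier K)" using Wd(2) by (metis K.zero_closed SigmaI imageI)
    fix x y assume "x \<in> j ` (W \<times> carrier K)" "y \<in> j ` (W \<times> carrier K)"
    then obtain w c w' c' where "w \<in> W" "c \<in> carrier K" "w' \<in> W" "c' \<in> carrier K" "x = j (w, c)" "y = j (w', c')" by auto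
    then show "x \<oplus>\<^bsub>U\<^esub> y \<in> j ` (W \<times> carrier K)" using Wd(4) by (auto simp: jadd)
  next
    fix a x assume a: "a \<in> carrier K" and "x \<in> j ` (W \<times> carrier K)"
    then obtain w c where "w \<in> W" "c \<in> carrier K" "x = j (w, c)" by auto
    then show "a \<odot>\<^bsub>U\<^esub> x \<in> j ` (W \<times> carrier K)" using Wd(5) a by (auto simp: jsm)
  qed
  have jw: "j (w, \<zero>\<^bsub>K\<^esub>) = w" if "w \<in> W" for w using that Wd(3) u by (simp add: j_def)
  have ju: "j (\<zero>\<^bsub>U\<^esub>, \<one>\<^bsub>K\<^esub>) = u" using u by (simp add: j_def U.smult_one)
  have sub: "W \<subseteq> W'" unfolding W'_def using jw by force
  have uW': "u \<in> W'" unfolding W'_def using ju Wd(2) by force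
  let ?X = "U\<lparr>carrier := W'\<rparr>" and ?Y = "U\<lparr>carrier := W\<rparr>"
  have X: "left_module K ?X" and Y: "left_module K ?Y" using U.left_module_submodule W W' by auto
  have WsubX: "submodule W K ?X"
  proof -
    interpret X: left_module K ?X by (rule X)
    show ?thesis unfolding X.submodule_iff using sub Wd by simp
  qed
  let ?r = "\<lambda>h. (restrict h W, h u)"
  define E where "E = (\<lambda>(g, v). \<lambda>x\<in>W'. g (fst (inv_into (W \<times> carrier K) j x)) \<oplus>\<^bsub>V\<^esub> snd (inv_into (W \<times> carrier K) j x) \<odot>\<^bsub>V\<^esub> v)"
  have Ej: "E (g, v) (j (w, c)) = g w \<oplus>\<^bsub>V\<^esub> c \<odot>\<^bsub>V\<^esub> v" if "w \<in> W" "c \<in> carrier K" for g v w c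
    using that inj by (simp add: E_def W'_def)
  have bij: "bij_betw ?r (mod_hom K ?X V) (mod_hom K ?Y V \<times> carrier V)"
  proof (rule bij_betw_byWitness[where f' = E])
    show "?r ` mod_hom K ?X V \<subseteq> mod_hom K ?Y V \<times> carrier V"
    proof
      fix z assume "z \<in> ?r ` mod_hom K ?X V"
      then obtain h where h: "h \<in> mod_hom K ?X V" "z = ?r h" by blast
      then show "z \<in> mod_hom K ?Y V \<times> carrier V"
        using mod_hom_restrict_submodule[OF X WsubX h(1)] mod_homD(2)[OF h(1), of u] uW' by simp
    qed
    show "E ` (mod_hom K ?Y V \<times> carrier V) \<subseteq> mod_hom K ?X V"
    proof
      fix z assume "z \<in> E ` (mod_hom K ?Y V \<times> carrier V)"
      then obtain g v where gv: "g \<in> mod_hom K ?Y V" "v \<in> carrier V" "z = E (g, v)" by blast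
      have gc: "g w \<in> carrier V" if "w \<in> W" for w using mod_homD(2)[OF gv(1), of w] that by simp
      have "E (g, v) \<in> mod_hom K ?X V"
      proof (rule mod_homI)
        show "E (g, v) \<in> extensional (carrier ?X)" by (simp add: E_def)
        fix x assume "x \<in> carrier ?X"
        then obtain w c where w: "w \<in> W" "c \<in> carrier K" "x = j (w, c)" by (auto simp: W'_def)
        then show "E (g, v) x \<in> carrier V" using gc gv(2) by (simp add: Ej V.smult_closed)
        show "E (g, v) (a \<odot>\<^bsub>?X\<^esub> x) = a \<odot>\<^bsub>V\<^esub> E (g, v) x" if "a \<in> carrier K" for a
          using w that gc[OF w(1)] gv(2) Wd(5) mod_homD(4)[OF gv(1) that, of w] 
          by (simp add: jsm Ej V.smult_r_distr V.smult_assoc V.smult_closed)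
        fix y assume "y \<in> carrier ?X"
        then obtain w' c' where w': "w' \<in> W" "c' \<in> carrier K" "y = j (w', c')" by (auto simp: W'_def)
        then show "E (g, v) (x \<oplus>\<^bsub>?X\<^esub> y) = E (g, v) x \<oplus>\<^bsub>V\<^esub> E (g, v) y"
          using w gc gv(2) Wd(4) mod_homD(3)[OF gv(1), of w w']
          by (simp add: jadd Ej V.smult_l_distr V.smult_closed V.M.a_ac)
      qed
      then show "z \<in> mod_hom K ?X V" using gv by simp
    qed
    show "\<forall>h\<in>mod_hom K ?X V. E (?r h) = h"
    proof
      fix h assume h: "h \<in> mod_hom K ?X V"
      show "E (?r h) = h"
      proof (rule extensionalityI)
        show "E (?r h) \<in> extensional W'" by (simp add: E_def)
        show "h \<in> extensional W'" using mod_homD(1)[OF h] by simp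
        fix x assume "x \<in> W'"
        then obtain w c where w: "w \<in> W" "c \<in> carrier K" "x = j (w, c)" by (auto simp: W'_def)
        have "c \<odot>\<^bsub>U\<^esub> u \<in> W'" using U.submoduleD(5)[OF W' w(2) uW'] .
        then have "h (w \<oplus>\<^bsub>U\<^esub> c \<odot>\<^bsub>U\<^esub> u) = h w \<oplus>\<^bsub>V\<^esub> c \<odot>\<^bsub>V\<^esub> h u"
          using mod_homD(3)[OF h, of w "c \<odot>\<^bsub>U\<^esub> u"] mod_homD(4)[OF h w(2), of u] sub w(1) uW' by auto
        then show "E (?r h) x = h x" using w by (simp add: Ej) (simp add: j_def)
      qed
    qed
    show "\<forall>z\<in>mod_hom K ?Y V \<times> carrier V. ?r (E z) = z"
    proof
      fix z assume "z \<in> mod_hom K ?Y V \<times> carrier V"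
      then obtain g v where gv: "g \<in> mod_hom K ?Y V" "v \<in> carrier V" "z = (g, v)" by blast
      have gc: "g w \<in> carrier V" if "w \<in> W" for w using mod_homD(2)[OF gv(1), of w] that by simp
      have g0: "g \<zero>\<^bsub>U\<^esub> = \<zero>\<^bsub>V\<^esub>" using mod_hom_zero[OF gv(1) Y V] by simp
      have "E (g, v) u = v" using Ej[of "\<zero>\<^bsub>U\<^esub>" "\<one>\<^bsub>K\<^esub>" g v] Wd(2) g0 gv(2) by (simp add: ju V.smult_one)
      moreover have "restrict (E (g, v)) W = g"
      proof (rule extensionalityI)
        show "g \<in> extensional W" using mod_homD(1)[OF gv(1)] by simp
        show "restrict (E (g, v)) W x = g x" if "x \<in> W" for x
          using Ej[of x "\<zero>\<^bsub>K\<^esub>" g v] that gc gv(2) by (simp add: jw)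
      qed simp
      ultimately show "?r (E z) = z" using gv by simp
    qed
  qed
  have "card W' = card W * card (carrier K)"
    unfolding W'_def by (simp add: card_image[OF inj] card_cartesian_product)
  moreover have "card (mod_hom K ?X V) = card (mod_hom K ?Y V) * card (carrier V)"
    using bij_betw_same_card[OF bij] by (simp add: card_cartesian_product)
  moreover have "W \<subset> W'" using sub uW' u by blast
  ultimately show ?thesis using W' by blast
qed

text \<open>
  Both numbers are tracked together along a growing chain of subspaces, with \<open>d\<close> the dimension reached so
  far; a largest subspace for which they are known is the whole space.
\<close>

lemma card_hom_vector_space:
  fixes U :: "('k, 'b) module" and V :: "('k, 'c) module"
  assumes K: "field K" and U: "left_module K U" and V: "left_module K V"
    and fin: "finite (carrier K)" "finite (carrier U)" "finite (carrier V)"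
  shows "\<exists>d. card (carrier U) = card (carrier K) ^ d \<and> card (mod_hom K U V) = card (carrier V) ^ d"
proof -
  interpret U: left_module K U by fact
  interpret V: left_module K V by fact
  define P where "P W \<longleftrightarrow> submodule W K U \<and> (\<exists>d. card W = card (carrier K) ^ d \<and>
    card (mod_hom K (U\<lparr>carrier := W\<rparr>) V) = card (carrier V) ^ d)" for W
  let ?Z = "U\<lparr>carrier := {\<zero>\<^bsub>U\<^esub>}\<rparr>"
  have Z: "left_module K ?Z" by (rule U.left_module_submodule[OF submodule_zero[OF U]])
  have "mod_hom K ?Z V = {restrict (\<lambda>x. \<zero>\<^bsub>V\<^esub>) (carrier ?Z)}"
  proof (intro equalityI subsetI)
    fix h assume h: "h \<in> mod_hom K ?Z V"
    then have "h = restrict (\<lambda>x. \<zero>\<^bsub>V\<^esub>) (carrier ?Z)"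
      using mod_hom_zero[OF h Z V] by (intro mod_hom_eqI[OF h mod_hom_const_zero[OF Z V]]) simp
    then show "h \<in> {restrict (\<lambda>x. \<zero>\<^bsub>V\<^esub>) (carrier ?Z)}" by simp
  qed (use mod_hom_const_zero[OF Z V] in simp)
  then have PZ: "P {\<zero>\<^bsub>U\<^esub>}"
    unfolding P_def using submodule_zero[OF U] by (intro conjI exI[of _ 0]) simp_all
  have bound: "\<forall>W. P W \<longrightarrow> card W \<le> card (carrier U)"
    using fin(2) U.submoduleD(1) by (auto simp: P_def intro: card_mono)
  obtain W where W: "P W" "\<And>W'. P W' \<Longrightarrow> card W' \<le> card W"
    using ex_has_greatest_nat[of P "{\<zero>\<^bsub>U\<^esub>}" card "Suc (card (carrier U))"] PZ bound by (auto simp: less_Suc_eq_le)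
  obtain d where d: "submodule W K U" "card W = card (carrier K) ^ d"
    "card (mod_hom K (U\<lparr>carrier := W\<rparr>) V) = card (carrier V) ^ d" using W(1) by (auto simp: P_def)
  have "W = carrier U"
  proof (rule ccontr)
    assume "W \<noteq> carrier U"
    then obtain u where u: "u \<in> carrier U" "u \<notin> W" using U.submoduleD(1)[OF d(1)] by blast
    obtain W' where W': "submodule W' K U" "W \<subset> W'" "card W' = card W * card (carrier K)"
      "card (mod_hom K (U\<lparr>carrier := W'\<rparr>) V) = card (mod_hom K (U\<lparr>carrier := W\<rparr>) V) * card (carrier V)"
      using vector_space_extend[OF K U V d(1) u] by blast
    have "P W'" unfolding P_def using W' d by (intro conjI exI[of _ "Suc d"]) simp_all
    moreover have "card W < card W'"
      using W'(2) U.submoduleD(1)[OF W'(1)] fin(2) by (meson finite_subset psubset_card_mono)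
    ultimately show False using W(2) by fastforce
  qed
  then show ?thesis using d by auto
qed

lemma card_hom_power:
  fixes U :: "('k, 'b) module" and V :: "('k, 'c) module"
  assumes K: "field K" and U: "left_module K U" and V: "left_module K V"
    and fin: "finite (carrier K)" "finite (carrier U)" "finite (carrier V)"
    and c: "card (carrier U) = card (carrier K) ^ m" "card (carrier V) = card (carrier K) ^ n"
  shows "card (mod_hom K U V) = card (carrier K) ^ (m * n)"
proof -
  interpret field K by fact
  have "card {\<zero>\<^bsub>K\<^esub>, \<one>\<^bsub>K\<^esub>} \<le> card (carrier K)" by (rule card_mono[OF fin(1)]) simp
  then have q: "1 < card (carrier K)" by simp
  obtain d where d: "card (carrier U) = card (carrier K) ^ d" "card (mod_hom K U V) = card (carrier V) ^ d"
    using card_hom_vector_space[OF K U V fin] by blast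
  have "d = m" using c(1) d(1) q power_inject_exp by metis
  then show ?thesis using d(2) c(2) by (simp add: power_mult[symmetric] mult.commute)
qed

lemma mod_hom_cong:
  assumes "carrier X = carrier X'" "carrier Y = carrier Y'"
    "\<And>x y. x \<in> carrier X \<Longrightarrow> y \<in> carrier X \<Longrightarrow> x \<oplus>\<^bsub>X\<^esub> y = x \<oplus>\<^bsub>X'\<^esub> y"
    "\<And>a x. a \<in> carrier R \<Longrightarrow> x \<in> carrier X \<Longrightarrow> a \<odot>\<^bsub>X\<^esub> x = a \<odot>\<^bsub>X'\<^esub> x"
    "\<And>x y. x \<in> carrier Y \<Longrightarrow> y \<in> carrier Y \<Longrightarrow> x \<oplus>\<^bsub>Y\<^esub> y = x \<oplus>\<^bsub>Y'\<^esub> y"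
    "\<And>a x. a \<in> carrier R \<Longrightarrow> x \<in> carrier Y \<Longrightarrow> a \<odot>\<^bsub>Y\<^esub> x = a \<odot>\<^bsub>Y'\<^esub> x"
  shows "mod_hom R X Y = mod_hom R X' Y'"
proof (intro equalityI subsetI)
  fix f assume f: "f \<in> mod_hom R X Y"
  note h = mod_homD[OF f]
  show "f \<in> mod_hom R X' Y'"
    by (rule mod_homI)
      (simp_all add: assms(1,2)[symmetric] h(1,2) assms(3-6)[symmetric] h(3,4))
next
  fix f assume f: "f \<in> mod_hom R X' Y'"
  note h = mod_homD[OF f, folded assms(1,2)]
  show "f \<in> mod_hom R X Y"
    by (rule mod_homI) (simp_all add: h(1,2) assms(3-6) h(3,4))
qed

section \<open>Vanishing of extensions\<close>

context path_alg
begin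

text \<open>
  The space \<open>e\<^sub>u N\<close> of the representation at the vertex \<open>u\<close>, for a submodule \<open>N\<close> of \<open>M\<close>.
\<close>

definition vspace :: "(nat \<times> 'e list \<Rightarrow> int, 'b) module \<Rightarrow> 'b set \<Rightarrow> nat \<Rightarrow> (int, 'b) module" where
  "vspace M N u = (scalars M)\<lparr>carrier := {x \<in> N. idem u \<odot>\<^bsub>M\<^esub> x = x}\<rparr>"

lemma vspace_simps [simp]:
  "carrier (vspace M N u) = {x \<in> N. idem u \<odot>\<^bsub>M\<^esub> x = x}" "\<zero>\<^bsub>vspace M N u\<^esub> = \<zero>\<^bsub>M\<^esub>"
  "x \<oplus>\<^bsub>vspace M N u\<^esub> y = x \<oplus>\<^bsub>M\<^esub> y" "c \<odot>\<^bsub>vspace M N u\<^esub> x = const c \<odot>\<^bsub>M\<^esub> x"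
  by (simp_all add: vspace_def)

context
  fixes M :: "(nat \<times> 'e list \<Rightarrow> int, 'b) module"
  assumes M: "left_module A M"
begin

interpretation M: left_module A M by (rule M)

lemma idem_closed: "u \<in> verts Q \<Longrightarrow> x \<in> carrier M \<Longrightarrow> idem u \<odot>\<^bsub>M\<^esub> x \<in> carrier M"
  by (simp add: M.smult_closed idem_A)

lemma arrow_closed: "a \<in> arcs Q \<Longrightarrow> x \<in> carrier M \<Longrightarrow> arrow a \<odot>\<^bsub>M\<^esub> x \<in> carrier M"
  by (simp add: M.smult_closed arrow_A)

lemma const_smult_comm:
  assumes "c \<in> carrier K" "f \<in> carrier A" "x \<in> carrier M"
  shows "f \<odot>\<^bsub>M\<^esub> (const c \<odot>\<^bsub>M\<^esub> x) = const c \<odot>\<^bsub>M\<^esub> (f \<odot>\<^bsub>M\<^esub> x)"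
  using M.smult_assoc[OF const_A[OF assms(1)] assms(2,3)] M.smult_assoc[OF assms(2) const_A[OF assms(1)] assms(3)]
    const_comm[OF assms(1,2)] by simp

lemma idem_idem:
  assumes "u \<in> verts Q" "v \<in> verts Q" "x \<in> carrier M"
  shows "idem u \<odot>\<^bsub>M\<^esub> (idem v \<odot>\<^bsub>M\<^esub> x) = (if u = v then idem v \<odot>\<^bsub>M\<^esub> x else \<zero>\<^bsub>M\<^esub>)"
  using M.smult_assoc[OF idem_A[OF assms(1)] idem_A[OF assms(2)] assms(3)] assms by (auto simp: mon_mult)

lemma idem_arrow:
  assumes "a \<in> arcs Q" "x \<in> carrier M"
  shows "idem (head Q a) \<odot>\<^bsub>M\<^esub> (arrow a \<odot>\<^bsub>M\<^esub> x) = arrow a \<odot>\<^bsub>M\<^esub> x"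
  using M.smult_assoc[OF idem_A arrow_A[OF assms(1)] assms(2), of "head Q a"] assms by (simp add: mon_mult)

lemma arrow_idem:
  assumes "a \<in> arcs Q" "x \<in> carrier M"
  shows "arrow a \<odot>\<^bsub>M\<^esub> (idem (tail Q a) \<odot>\<^bsub>M\<^esub> x) = arrow a \<odot>\<^bsub>M\<^esub> x"
  using M.smult_assoc[OF arrow_A[OF assms(1)] idem_A assms(2), of "tail Q a"] assms by (simp add: mon_mult)

lemma mon_vertex:
  assumes "c \<in> carrier K" "u \<in> verts Q" "x \<in> carrier M"
  shows "mon c (u, []) \<odot>\<^bsub>M\<^esub> x = const c \<odot>\<^bsub>M\<^esub> (idem u \<odot>\<^bsub>M\<^esub> x)"
  using M.smult_assoc[OF const_A[OF assms(1)] idem_A[OF assms(2)] assms(3)] assms by (simp add: const_mon)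

lemma idem_image:
  assumes "u \<in> verts Q" "submodule N A M"
  shows "(\<lambda>x. idem u \<odot>\<^bsub>M\<^esub> x) ` N = carrier (vspace M N u)"
proof (intro equalityI subsetI)
  fix y assume "y \<in> (\<lambda>x. idem u \<odot>\<^bsub>M\<^esub> x) ` N"
  then show "y \<in> carrier (vspace M N u)"
    using M.submoduleD(5)[OF assms(2) idem_A[OF assms(1)]] M.submoduleD(3)[OF assms(2)] 
    by (auto simp: idem_idem assms(1))
qed force

lemma vspace_submodule:
  assumes "u \<in> verts Q" "submodule N A M"
  shows "submodule (carrier (vspace M N u)) K (scalars M)"
proof -
  interpret S: left_module K "scalars M" by (rule left_module_scalars[OF M])
  note N = M.submoduleD[OF assms(2)]
  show ?thesis unfolding S.submodule_iff
    using N assms(1) by (auto simp: M.smult_r_distr idem_A const_A const_smult_comm)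
qed

lemma vspace_left_module:
  assumes "u \<in> verts Q" "submodule N A M"
  shows "left_module K (vspace M N u)"
proof -
  interpret S: left_module K "scalars M" by (rule left_module_scalars[OF M])
  show ?thesis using S.left_module_submodule[OF vspace_submodule[OF assms]] by (simp add: vspace_def)
qed

end

lemma card_PiE_vector_spaces:
  assumes "finite I" "\<And>i. i \<in> I \<Longrightarrow> left_module K (X i)" "\<And>i. i \<in> I \<Longrightarrow> left_module K (Y i)"
    "\<And>i. i \<in> I \<Longrightarrow> finite (carrier (X i))" "\<And>i. i \<in> I \<Longrightarrow> finite (carrier (Y i))"
    "\<And>i. i \<in> I \<Longrightarrow> card (carrier (X i)) = card (carrier K) ^ m i"
    "\<And>i. i \<in> I \<Longrightarrow> card (carrier (Y i)) = card (carrier K) ^ n i"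
  shows "card (\<Pi>\<^sub>E i\<in>I. mod_hom K (X i) (Y i)) = card (carrier K) ^ (\<Sum>i\<in>I. m i * n i)"
proof -
  have "card (\<Pi>\<^sub>E i\<in>I. mod_hom K (X i) (Y i)) = (\<Prod>i\<in>I. card (carrier K) ^ (m i * n i))"
    unfolding card_PiE[OF assms(1)]
    using assms by (intro prod.cong refl card_hom_power[OF K.field_axioms]) (auto simp: fin_K)
  then show ?thesis by (simp add: power_sum)
qed

lemma q_gt_1: "1 < card (carrier K)"
proof -
  have "card {\<zero>\<^bsub>K\<^esub>, \<one>\<^bsub>K\<^esub>} \<le> card (carrier K)" by (rule card_mono[OF fin_K]) simp
  then show ?thesis by simp
qed

text \<open>
  Here \<open>M\<close> is the direct sum of \<open>N'\<close> and \<open>N\<close> and has the fewest endomorphisms among the modules with the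
  same underlying set and the same idempotents. A cocycle \<open>\<phi>\<close> consists of a linear map from \<open>e\<^sub>i N\<close> to
  \<open>e\<^sub>j N'\<close> for each arrow from \<open>i\<close> to \<open>j\<close>. Adding it to the maps of the arrows gives a module \<open>M2\<close> that
  contains \<open>N'\<close> and has \<open>N\<close> as quotient. If the inequality failed, there would be more cocycles than
  families \<open>\<theta>\<close> of linear maps from \<open>e\<^sub>u N\<close> to \<open>e\<^sub>u N'\<close>, and some \<open>\<phi>\<close> would not be the coboundary \<open>\<delta> \<theta>\<close> of
  any such family. Then \<open>M2\<close> does not split, hence it has fewer endomorphisms than \<open>M\<close>, against the choice
  of \<open>M\<close>.
\<close>

theorem ext_vanishes:
  fixes M :: "(nat \<times> 'e list \<Rightarrow> int, 'b) module"
  assumes M: "left_module A M" and fin: "finite (carrier M)"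
    and d: "direct_decomposition A M N' N"
    and min: "\<And>M2 :: (nat \<times> 'e list \<Rightarrow> int, 'b) module. left_module A M2 \<Longrightarrow> carrier M2 = carrier M \<Longrightarrow>
       (\<And>u x. u \<in> verts Q \<Longrightarrow> x \<in> carrier M \<Longrightarrow> idem u \<odot>\<^bsub>M2\<^esub> x = idem u \<odot>\<^bsub>M\<^esub> x) \<Longrightarrow>
       card (mod_hom A M M) \<le> card (mod_hom A M2 M2)"
    and dims: "\<And>u. u \<in> verts Q \<Longrightarrow> card (carrier (vspace M N u)) = card (carrier K) ^ \<beta> u"
      "\<And>u. u \<in> verts Q \<Longrightarrow> card (carrier (vspace M N' u)) = card (carrier K) ^ \<gamma> u"
  shows "(\<Sum>a\<in>arcs Q. \<beta> (tail Q a) * \<gamma> (head Q a)) \<le> (\<Sum>u\<in>verts Q. \<beta> u * \<gamma> u)"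
proof (rule ccontr)
  assume less: "\<not> ?thesis"
  interpret M: left_module A M by fact
  have sub: "submodule N' A M" "submodule N A M" using d by (auto simp: direct_decomposition_def)
  note N' = M.submoduleD[OF sub(1)] and N = M.submoduleD[OF sub(2)]
  let ?C0 = "\<Pi>\<^sub>E u\<in>verts Q. mod_hom K (vspace M N u) (vspace M N' u)"
  let ?C1 = "\<Pi>\<^sub>E a\<in>arcs Q. mod_hom K (vspace M N (tail Q a)) (vspace M N' (head Q a))"
  define \<delta> where "\<delta> \<theta> = (\<lambda>a\<in>arcs Q. \<lambda>x\<in>carrier (vspace M N (tail Q a)).
    \<theta> (head Q a) (arrow a \<odot>\<^bsub>M\<^esub> x) \<ominus>\<^bsub>M\<^esub> arrow a \<odot>\<^bsub>M\<^esub> \<theta> (tail Q a) x)" for \<theta> :: "nat \<Rightarrow> 'b \<Rightarrow> 'b"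
  have fv: "finite (carrier (vspace M N u))" "finite (carrier (vspace M N' u))" for u
    using N(1) N'(1) fin by (auto intro: finite_subset)
  have lv: "left_module K (vspace M N u)" "left_module K (vspace M N' u)" if "u \<in> verts Q" for u
    using vspace_left_module[OF M that] sub by auto
  have "card ?C0 = card (carrier K) ^ (\<Sum>u\<in>verts Q. \<beta> u * \<gamma> u)"
    by (rule card_PiE_vector_spaces[OF fin_verts lv(1) lv(2) fv(1) fv(2) dims(1) dims(2)])
  moreover have "card ?C1 = card (carrier K) ^ (\<Sum>a\<in>arcs Q. \<beta> (tail Q a) * \<gamma> (head Q a))"
    by (rule card_PiE_vector_spaces[OF fin_arcs lv(1)[OF tail_in_verts] lv(2)[OF head_in_verts] fv(1) fv(2) 
      dims(1)[OF tail_in_verts] dims(2)[OF head_in_verts]])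
  ultimately have lt: "card ?C0 < card ?C1" using less q_gt_1 by simp
  have fC0: "finite ?C0" using fv by (intro finite_PiE fin_verts finite_mod_hom) auto
  have "card (\<delta> ` ?C0) < card ?C1" using card_image_le[OF fC0, of \<delta>] lt by linarith
  then have "\<not> ?C1 \<subseteq> \<delta> ` ?C0" using card_mono[OF finite_imageI[OF fC0], of ?C1 \<delta>] by linarith
  \<comment> \<open>a cocycle that is not a coboundary\<close>
  then obtain \<phi> where \<phi>: "\<phi> \<in> ?C1" "\<phi> \<notin> \<delta> ` ?C0" by blast
  have \<phi>h: "\<phi> a \<in> mod_hom K (vspace M N (tail Q a)) (vspace M N' (head Q a))" if "a \<in> arcs Q" for a
    using \<phi>(1) that by (rule PiE_mem)
  have \<phi>e: "\<phi> \<in> extensional (arcs Q)" using \<phi>(1) by (simp add: PiE_def)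
  obtain \<pi> where pi: "\<pi> \<in> mod_hom A M (M\<lparr>carrier := N\<rparr>)" "\<And>x. x \<in> N \<Longrightarrow> \<pi> x = x"
    "mod_ker M (M\<lparr>carrier := N\<rparr>) \<pi> = N'" "\<And>x. x \<in> carrier M \<Longrightarrow> x \<ominus>\<^bsub>M\<^esub> \<pi> x \<in> N'"
    by (rule projection_exists[OF M direct_decomposition_sym[OF M d]]) (rule that)
  have piN: "\<pi> x \<in> N" "\<pi> x \<in> carrier M" if "x \<in> carrier M" for x
    using mod_homD(2)[OF pi(1) that] N(3) by simp_all
  have pi_add: "\<pi> (x \<oplus>\<^bsub>M\<^esub> y) = \<pi> x \<oplus>\<^bsub>M\<^esub> \<pi> y" if "x \<in> carrier M" "y \<in> carrier M" for x y
    using mod_homD(3)[OF pi(1) that] by simp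
  have pi_smult: "\<pi> (f \<odot>\<^bsub>M\<^esub> x) = f \<odot>\<^bsub>M\<^esub> \<pi> x" if "f \<in> carrier A" "x \<in> carrier M" for f x
    using mod_homD(4)[OF pi(1) that] by simp
  have piN': "\<pi> x = \<zero>\<^bsub>M\<^esub>" if "x \<in> N'" for x using that pi(3) by (auto simp: mod_ker_def)
  \<comment> \<open>\<open>\<phi>\<close>, extended by zero on \<open>N'\<close> and on the other vertices\<close>
  define \<psi> where "\<psi> a x = \<phi> a (idem (tail Q a) \<odot>\<^bsub>M\<^esub> \<pi> x)" for a x
  have tail_in: "idem (tail Q a) \<odot>\<^bsub>M\<^esub> \<pi> x \<in> carrier (vspace M N (tail Q a))" if "a \<in> arcs Q" "x \<in> carrier M" for a x
    using that piN by (simp add: idem_idem[OF M] N(5) idem_A)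
  have \<psi>c: "\<psi> a x \<in> N'" "\<psi> a x \<in> carrier M" "idem (head Q a) \<odot>\<^bsub>M\<^esub> \<psi> a x = \<psi> a x" if "a \<in> arcs Q" "x \<in> carrier M" for a x
    using mod_homD(2)[OF \<phi>h[OF that(1)] tail_in[OF that]] N'(3) by (simp_all add: \<psi>_def)
  have \<psi>_add: "\<psi> a (x \<oplus>\<^bsub>M\<^esub> y) = \<psi> a x \<oplus>\<^bsub>M\<^esub> \<psi> a y" if "a \<in> arcs Q" "x \<in> carrier M" "y \<in> carrier M" for a x y
    using mod_homD(3)[OF \<phi>h[OF that(1)] tail_in[OF that(1,2)] tail_in[OF that(1,3)]] that piN
    by (simp add: \<psi>_def pi_add M.smult_r_distr idem_A)
  have \<psi>_smult: "\<psi> a (const c \<odot>\<^bsub>M\<^esub> x) = const c \<odot>\<^bsub>M\<^esub> \<psi> a x" if "a \<in> arcs Q" "c \<in> carrier K" "x \<in> carrier M" for a c x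
    using mod_homD(4)[OF \<phi>h[OF that(1)] that(2) tail_in[OF that(1,3)]] that piN
    by (simp add: \<psi>_def pi_smult const_A const_smult_comm[OF M] idem_A)
  have \<psi>_idem: "\<psi> a (idem (tail Q a) \<odot>\<^bsub>M\<^esub> x) = \<psi> a x" if "a \<in> arcs Q" "x \<in> carrier M" for a x
    using that piN by (simp add: \<psi>_def pi_smult idem_A idem_idem[OF M])
  have \<psi>N': "\<psi> a x = \<zero>\<^bsub>M\<^esub>" if "a \<in> arcs Q" "x \<in> N'" for a x
    using that mod_hom_zero[OF \<phi>h[OF that(1)] lv] by (simp add: \<psi>_def piN' idem_A)
  \<comment> \<open>the twisted maps of the arrows; the vertices act as before\<close>
  define T where "T a x = arrow a \<odot>\<^bsub>M\<^esub> x \<oplus>\<^bsub>M\<^esub> \<psi> a x" for a x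
  have rep: "quiver_rep Q K (scalars M) (\<lambda>u x. idem u \<odot>\<^bsub>M\<^esub> x) T"
  proof (intro quiver_rep.intro quiver_rep_axioms.intro)
    show "path_alg Q K" by (rule path_alg_axioms)
    show "left_module K (scalars M)" by (rule left_module_scalars[OF M])
  next
    fix x assume "x \<in> carrier (scalars M)" "\<And>u. u \<in> verts Q \<Longrightarrow> idem u \<odot>\<^bsub>M\<^esub> x = \<zero>\<^bsub>scalars M\<^esub>"
    then show "x = \<zero>\<^bsub>scalars M\<^esub>" using idem_sep[OF M, of x] by simp
  qed (simp_all add: T_def idem_closed[OF M] arrow_closed[OF M] M.smult_r_distr idem_A arrow_A const_A
      const_smult_comm[OF M] idem_idem[OF M] idem_arrow[OF M] arrow_idem[OF M] 
      \<psi>c \<psi>_add \<psi>_smult \<psi>_idem M.smult_closed M.M.a_ac)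
  interpret V: quiver_rep Q K "scalars M" "\<lambda>u x. idem u \<odot>\<^bsub>M\<^esub> x" T by (rule rep)
  define M2 where "M2 = V.rep_module"
  have M2: "left_module A M2" unfolding M2_def by (rule V.left_module_rep)
  have M2s [simp]: "carrier M2 = carrier M" "\<zero>\<^bsub>M2\<^esub> = \<zero>\<^bsub>M\<^esub>" "x \<oplus>\<^bsub>M2\<^esub> y = x \<oplus>\<^bsub>M\<^esub> y" for x y
    by (simp_all add: M2_def)
  interpret M2: left_module A M2 by (rule M2)
  have M2_vert: "mon c (u, []) \<odot>\<^bsub>M2\<^esub> x = mon c (u, []) \<odot>\<^bsub>M\<^esub> x" if "c \<in> carrier K" "u \<in> verts Q" "x \<in> carrier M" for c u x
    unfolding M2_def mon_vertex[OF M that] using V.rep_vertex[OF that(1,2), of x] that(3)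
    by (simp del: V.rep_module_simps(4))
  have M2_arrow: "arrow a \<odot>\<^bsub>M2\<^esub> x = T a x" if "a \<in> arcs Q" "x \<in> carrier M" for a x
    unfolding M2_def using V.rep_arrow[OF that(1), of x] that(2)
    by (simp del: V.rep_module_simps(4))
  have same: "\<forall>x\<in>N'. f \<odot>\<^bsub>M2\<^esub> x = f \<odot>\<^bsub>M\<^esub> x" if "f \<in> carrier A" for f
    using that
  proof (induction f rule: A_generated)
    case (mult f g)
    then show ?case by (simp add: M2.smult_assoc M.smult_assoc N'(3,5))
  next
    case (arc a)
    then show ?case by (simp add: M2_arrow T_def N'(3) \<psi>N' arrow_closed[OF M])
  next
    case zero
    then show ?case using M2.smult_l_null N'(3) by simp
  qed (simp_all add: M2_vert N'(3) M2.smult_l_distr M.smult_l_distr)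
  have sub2: "submodule N' A M2"
    unfolding M2.submodule_iff using N' same by simp
  let ?N = "M\<lparr>carrier := N\<rparr>"
  have LN: "left_module A ?N" by (rule M.left_module_submodule[OF sub(2)])
  have pi2: "\<pi> \<in> mod_hom A M2 ?N"
  proof -
    have "restrict \<pi> (carrier M2) \<in> mod_hom A M2 ?N"
    proof (rule path_hom[OF M2 LN])
      fix a x assume a: "a \<in> arcs Q" and x: "x \<in> carrier M2"
      then show "\<pi> (arrow a \<odot>\<^bsub>M2\<^esub> x) = arrow a \<odot>\<^bsub>?N\<^esub> \<pi> x"
        using \<psi>c[OF a, of x] piN[of x] by (simp add: M2_arrow T_def pi_add arrow_closed[OF M] pi_smult arrow_A piN')
    qed (simp_all add: piN pi_add M2_vert pi_smult mon_A)
    then show ?thesis using mod_homD(1)[OF pi(1)] by (simp add: extensional_restrict)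
  qed
  have ker2: "mod_ker M2 ?N \<pi> = N'" using pi(3) by (simp add: mod_ker_def)
  have im2: "\<pi> ` carrier M2 = carrier ?N"
  proof (intro equalityI subsetI)
    fix y assume "y \<in> \<pi> ` carrier M2"
    then show "y \<in> carrier ?N" using piN(1) by auto
  next
    fix y assume y: "y \<in> carrier ?N"
    then have "y \<in> carrier M2" "\<pi> y = y" using N(3)[of y] pi(2)[of y] by simp_all
    then show "y \<in> \<pi> ` carrier M2" by (metis imageI)
  qed
  have nonsplit: "\<not> (\<exists>s\<in>mod_hom A ?N M2. \<forall>x\<in>carrier ?N. \<pi> (s x) = x)"
  proof
    assume "\<exists>s\<in>mod_hom A ?N M2. \<forall>x\<in>carrier ?N. \<pi> (s x) = x"
    then obtain s where s: "s \<in> mod_hom A ?N M2" "\<And>x. x \<in> N \<Longrightarrow> \<pi> (s x) = x" by auto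
    have sc: "s x \<in> carrier M" if "x \<in> N" for x using mod_homD(2)[OF s(1), of x] that by simp
    have s_add: "s (x \<oplus>\<^bsub>M\<^esub> y) = s x \<oplus>\<^bsub>M\<^esub> s y" if "x \<in> N" "y \<in> N" for x y
      using mod_homD(3)[OF s(1), of x y] that by simp
    have s_vert: "s (mon c (u, []) \<odot>\<^bsub>M\<^esub> x) = mon c (u, []) \<odot>\<^bsub>M\<^esub> s x" if "x \<in> N" "c \<in> carrier K" "u \<in> verts Q" for x c u
      using mod_homD(4)[OF s(1), of "mon c (u, [])" x] that sc by (simp add: mon_A M2_vert)
    have s_arrow: "s (arrow a \<odot>\<^bsub>M\<^esub> x) = T a (s x)" if "x \<in> N" "a \<in> arcs Q" for x a
      using mod_homD(4)[OF s(1), of "arrow a" x] that sc by (simp add: arrow_A M2_arrow)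
    \<comment> \<open>a splitting \<open>s\<close> differs from the inclusion of \<open>N\<close> by a family \<open>\<theta>\<close> with \<open>\<delta> \<theta> = \<phi>\<close>\<close>
    define \<theta> where "\<theta> = (\<lambda>u\<in>verts Q. \<lambda>x\<in>carrier (vspace M N u). s x \<ominus>\<^bsub>M\<^esub> x)"
    have diffN': "s x \<ominus>\<^bsub>M\<^esub> x \<in> N'" if "x \<in> N" for x
      using pi(4)[OF sc[OF that]] s(2)[OF that] by simp
    have minus_add: "(x \<oplus>\<^bsub>M\<^esub> y) \<ominus>\<^bsub>M\<^esub> (z \<oplus>\<^bsub>M\<^esub> w) = (x \<ominus>\<^bsub>M\<^esub> z) \<oplus>\<^bsub>M\<^esub> (y \<ominus>\<^bsub>M\<^esub> w)"
      if "x \<in> carrier M" "y \<in> carrier M" "z \<in> carrier M" "w \<in> carrier M" for x y z w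
      using that by (simp add: a_minus_def M.M.minus_add M.M.a_ac)
    have minus_smult: "f \<odot>\<^bsub>M\<^esub> x \<ominus>\<^bsub>M\<^esub> f \<odot>\<^bsub>M\<^esub> y = f \<odot>\<^bsub>M\<^esub> (x \<ominus>\<^bsub>M\<^esub> y)"
      if "x \<in> carrier M" "y \<in> carrier M" "f \<in> carrier A" for x y f
      using that by (simp add: a_minus_def M.smult_r_distr M.smult_minus)
    have \<theta>h: "\<theta> u \<in> mod_hom K (vspace M N u) (vspace M N' u)" if u: "u \<in> verts Q" for u
    proof -
      have "restrict (\<lambda>x. s x \<ominus>\<^bsub>M\<^esub> x) (carrier (vspace M N u)) \<in> mod_hom K (vspace M N u) (vspace M N' u)"
      proof (rule mod_hom_restrictI[OF _ _ _ lv(1)[OF u]])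
        fix x assume "x \<in> carrier (vspace M N u)"
        then have x: "x \<in> N" "idem u \<odot>\<^bsub>M\<^esub> x = x" by auto
        have sx: "idem u \<odot>\<^bsub>M\<^esub> s x = s x" using s_vert[OF x(1) K.one_closed u] x(2) by simp
        have "idem u \<odot>\<^bsub>M\<^esub> (s x \<ominus>\<^bsub>M\<^esub> x) = s x \<ominus>\<^bsub>M\<^esub> x"
          using minus_smult[OF sc[OF x(1)] N(3)[OF x(1)] idem_A[OF u]] x(2) sx by simp
        then show "s x \<ominus>\<^bsub>M\<^esub> x \<in> carrier (vspace M N' u)" using diffN'[OF x(1)] by simp
        show "s (c \<odot>\<^bsub>vspace M N u\<^esub> x) \<ominus>\<^bsub>M\<^esub> c \<odot>\<^bsub>vspace M N u\<^esub> x = c \<odot>\<^bsub>vspace M N' u\<^esub> (s x \<ominus>\<^bsub>M\<^esub> x)"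
          if c: "c \<in> carrier K" for c
        proof -
          have "s (const c \<odot>\<^bsub>M\<^esub> x) = const c \<odot>\<^bsub>M\<^esub> s x"
            using s_vert[OF x(1) c u] mon_vertex[OF M c u N(3)[OF x(1)]] mon_vertex[OF M c u sc[OF x(1)]] x(2) sx 
            by simp
          then show ?thesis using minus_smult[OF sc[OF x(1)] N(3)[OF x(1)] const_A[OF c]] by simp
        qed
        fix y assume "y \<in> carrier (vspace M N u)"
        then have y: "y \<in> N" by simp
        show "s (x \<oplus>\<^bsub>vspace M N u\<^esub> y) \<ominus>\<^bsub>M\<^esub> (x \<oplus>\<^bsub>vspace M N u\<^esub> y) = (s x \<ominus>\<^bsub>M\<^esub> x) \<oplus>\<^bsub>vspace M N' u\<^esub> (s y \<ominus>\<^bsub>M\<^esub> y)"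
          using minus_add[OF sc[OF x(1)] sc[OF y] N(3)[OF x(1)] N(3)[OF y]] s_add[OF x(1) y] by simp
      qed
      then show ?thesis using u by (simp add: \<theta>_def)
    qed
    then have "\<theta> \<in> ?C0" by (simp add: \<theta>_def PiE_iff)
    moreover have "\<phi> = \<delta> \<theta>"
    proof (rule extensionalityI[OF \<phi>e])
      show "\<delta> \<theta> \<in> extensional (arcs Q)" by (simp add: \<delta>_def)
      fix a assume a: "a \<in> arcs Q"
      have "\<phi> a = restrict (\<lambda>x. \<theta> (head Q a) (arrow a \<odot>\<^bsub>M\<^esub> x) \<ominus>\<^bsub>M\<^esub> arrow a \<odot>\<^bsub>M\<^esub> \<theta> (tail Q a) x)
          (carrier (vspace M N (tail Q a)))"
      proof (rule extensionalityI[OF mod_homD(1)[OF \<phi>h[OF a]]])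
        fix x assume xv: "x \<in> carrier (vspace M N (tail Q a))"
        then have x: "x \<in> N" "idem (tail Q a) \<odot>\<^bsub>M\<^esub> x = x" by auto
        note xM = N(3)[OF x(1)]
        have ax: "arrow a \<odot>\<^bsub>M\<^esub> x \<in> N" using N(5) x arrow_A[OF a] by simp
        have "arrow a \<odot>\<^bsub>M\<^esub> x \<in> carrier (vspace M N (head Q a))"
          using ax idem_arrow[OF M a xM] by simp
        then have 1: "\<theta> (head Q a) (arrow a \<odot>\<^bsub>M\<^esub> x) = T a (s x) \<ominus>\<^bsub>M\<^esub> arrow a \<odot>\<^bsub>M\<^esub> x"
          using a s_arrow[OF x(1) a] by (simp add: \<theta>_def)
        have 2: "arrow a \<odot>\<^bsub>M\<^esub> \<theta> (tail Q a) x = arrow a \<odot>\<^bsub>M\<^esub> s x \<ominus>\<^bsub>M\<^esub> arrow a \<odot>\<^bsub>M\<^esub> x"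
          using a xv minus_smult[OF sc[OF x(1)] xM arrow_A[OF a]] by (simp add: \<theta>_def)
        have "\<psi> a (s x) = \<phi> a x" using s(2)[OF x(1)] x(2) by (simp add: \<psi>_def)
        then have 3: "T a (s x) = arrow a \<odot>\<^bsub>M\<^esub> s x \<oplus>\<^bsub>M\<^esub> \<phi> a x" by (simp add: T_def)
        have c: "arrow a \<odot>\<^bsub>M\<^esub> s x \<in> carrier M" "arrow a \<odot>\<^bsub>M\<^esub> x \<in> carrier M" "\<phi> a x \<in> carrier M"
          using arrow_closed[OF M a] sc[OF x(1)] xM mod_homD(2)[OF \<phi>h[OF a] xv] N'(3) by auto
        have "\<phi> a x = \<theta> (head Q a) (arrow a \<odot>\<^bsub>M\<^esub> x) \<ominus>\<^bsub>M\<^esub> arrow a \<odot>\<^bsub>M\<^esub> \<theta> (tail Q a) x"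
          unfolding 1 2 3 using c
          by (simp add: a_minus_def M.M.minus_add M.M.a_ac M.M.r_neg2 M.M.r_neg1 M.M.r_neg3 M.M.r_neg)
        then show "\<phi> a x = restrict (\<lambda>x. \<theta> (head Q a) (arrow a \<odot>\<^bsub>M\<^esub> x) \<ominus>\<^bsub>M\<^esub> arrow a \<odot>\<^bsub>M\<^esub> \<theta> (tail Q a) x)
          (carrier (vspace M N (tail Q a))) x" using xv by simp
      qed simp
      then show "\<phi> a = \<delta> \<theta> a" using a by (simp add: \<delta>_def)
    qed
    ultimately show False using \<phi>(2) by blast
  qed
  let ?S = "M\<lparr>carrier := N'\<rparr>" and ?S2 = "M2\<lparr>carrier := N'\<rparr>"
  have finN: "finite N" using N(1) fin by (rule finite_subset)
  have "card (mod_hom A M2 M2) < card (mod_hom A ?S2 ?S2) * card (mod_hom A ?S2 ?N) * (card (mod_hom A ?N ?S2) * card (mod_hom A ?N ?N))"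
    by (rule card_End_nonsplit[OF M2 LN _ _ pi2 im2 nonsplit]) (simp_all add: fin finN ker2)
  also have "mod_hom A ?S2 ?S2 = mod_hom A ?S ?S" by (rule mod_hom_cong) (simp_all add: same)
  also have "mod_hom A ?S2 ?N = mod_hom A ?S ?N" by (rule mod_hom_cong) (simp_all add: same)
  also have "mod_hom A ?N ?S2 = mod_hom A ?N ?S" by (rule mod_hom_cong) (simp_all add: same)
  also have "card (mod_hom A ?S ?S) * card (mod_hom A ?S ?N) * (card (mod_hom A ?N ?S) * card (mod_hom A ?N ?N)) \<le> card (mod_hom A M M)"
    by (rule card_End_direct[OF M d fin refl refl])
  also have "\<dots> \<le> card (mod_hom A M2 M2)"
    by (rule min[OF M2]) (simp_all add: M2_vert)
  finally show False by simp
qed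

end

section \<open>Indecomposable modules of positive roots\<close>

lemma euler_form_cong:
  assumes "wf_digraph Q" "\<And>i. i \<in> verts Q \<Longrightarrow> x i = x' i" "\<And>i. i \<in> verts Q \<Longrightarrow> y i = y' i"
  shows "euler_form Q x y = euler_form Q x' y'"
proof -
  interpret wf_digraph Q by fact
  show ?thesis using assms(2,3) by (simp add: euler_form_def)
qed

context path_alg
begin

lemma has_dimension_vector_iff:
  "has_dimension_vector Q K M \<alpha> \<longleftrightarrow> finite (carrier M) \<and>
    (\<forall>i\<in>verts Q. card ((\<lambda>x. idem i \<odot>\<^bsub>M\<^esub> x) ` carrier M) = card (carrier K) ^ nat (\<alpha> i))"
  by (simp add: has_dimension_vector_def vertex_idempotent_eq)

lemma simple_module_simps [simp]:
  "carrier (simple_module K i) = carrier K" "\<zero>\<^bsub>simple_module K i\<^esub> = \<zero>\<^bsub>K\<^esub>"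
  "x \<oplus>\<^bsub>simple_module K i\<^esub> y = x \<oplus>\<^bsub>K\<^esub> y" "f \<odot>\<^bsub>simple_module K i\<^esub> x = f (i, []) \<otimes>\<^bsub>K\<^esub> x"
  by (simp_all add: simple_module_def)

lemma left_module_simple:
  assumes i: "i \<in> verts Q" shows "left_module A (simple_module K i)"
proof (rule left_moduleI)
  fix f g x assume f: "f \<in> carrier A" and g: "g \<in> carrier A" and x: "x \<in> carrier (simple_module K i)"
  note v = A_val[OF f] A_val[OF g]
  show "(f \<oplus>\<^bsub>A\<^esub> g) \<odot>\<^bsub>simple_module K i\<^esub> x = f \<odot>\<^bsub>simple_module K i\<^esub> x \<oplus>\<^bsub>simple_module K i\<^esub> g \<odot>\<^bsub>simple_module K i\<^esub> x"
    using x by (simp add: A_add K.l_distr v)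
  show "(f \<otimes>\<^bsub>A\<^esub> g) \<odot>\<^bsub>simple_module K i\<^esub> x = f \<odot>\<^bsub>simple_module K i\<^esub> (g \<odot>\<^bsub>simple_module K i\<^esub> x)"
    using x i by (simp add: A_mult K.m_assoc v)
next
  fix f x assume f: "f \<in> carrier A" and x: "x \<in> carrier (simple_module K i)"
  show "f \<odot>\<^bsub>simple_module K i\<^esub> x \<in> carrier (simple_module K i)" using x by (simp add: A_val[OF f])
  fix y assume "y \<in> carrier (simple_module K i)"
  then show "f \<odot>\<^bsub>simple_module K i\<^esub> (x \<oplus>\<^bsub>simple_module K i\<^esub> y) = f \<odot>\<^bsub>simple_module K i\<^esub> x \<oplus>\<^bsub>simple_module K i\<^esub> f \<odot>\<^bsub>simple_module K i\<^esub> y"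
    using x by (simp add: K.r_distr A_val[OF f])
qed (use i in \<open>simp_all add: A_ring A_zero A_one const_def K.add.m_ac\<close>)

text \<open>
  A direct sum of simple modules, built one summand at a time.
\<close>

lemma exists_module_of_dimension:
  assumes "verts Q \<noteq> {}"
  shows "\<exists>M :: (nat \<times> 'e list \<Rightarrow> int, int) module. left_module A M \<and> has_dimension_vector Q K M (\<lambda>i. int (\<alpha> i))"
proof (induction "\<Sum>i\<in>verts Q. \<alpha> i" arbitrary: \<alpha>)
  case 0
  obtain i where i: "i \<in> verts Q" using assms by blast
  let ?S = "simple_module K i" and ?Z = "(simple_module K i)\<lparr>carrier := {\<zero>\<^bsub>K\<^esub>}\<rparr>"
  interpret S: left_module A ?S by (rule left_module_simple[OF i])
  have "left_module A ?Z" using S.left_module_submodule submodule_zero[OF S.left_module_axioms] by simp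
  moreover have "\<forall>i\<in>verts Q. \<alpha> i = 0" using 0 fin_verts by simp
  ultimately show ?case
    by (intro exI[of _ ?Z]) (simp add: has_dimension_vector_iff)
next
  case (Suc n)
  then obtain i where i: "i \<in> verts Q" "\<alpha> i \<noteq> 0" 
    by (metis (no_types, lifting) nat.distinct(1) sum.neutral)
  define \<beta> where "\<beta> = \<alpha>(i := \<alpha> i - 1)"
  have "(\<Sum>j\<in>verts Q. \<alpha> j) = \<alpha> i + (\<Sum>j\<in>verts Q - {i}. \<alpha> j)"
    "(\<Sum>j\<in>verts Q. \<beta> j) = \<beta> i + (\<Sum>j\<in>verts Q - {i}. \<beta> j)"
    using fin_verts i(1) by (simp_all add: sum.remove)
  moreover have "(\<Sum>j\<in>verts Q - {i}. \<beta> j) = (\<Sum>j\<in>verts Q - {i}. \<alpha> j)"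
    by (intro sum.cong) (auto simp: \<beta>_def)
  ultimately have "n = (\<Sum>j\<in>verts Q. \<beta> j)" using Suc.hyps(2) i(2) by (simp add: \<beta>_def)
  then obtain M :: "(nat \<times> 'e list \<Rightarrow> int, int) module" where M: "left_module A M"
    "finite (carrier M)" "\<And>j. j \<in> verts Q \<Longrightarrow> card ((\<lambda>x. idem j \<odot>\<^bsub>M\<^esub> x) ` carrier M) = card (carrier K) ^ \<beta> j"
    using Suc.hyps(1)[of \<beta>] by (auto simp: has_dimension_vector_iff)
  let ?S = "mod_sum M (simple_module K i)"
  have S: "left_module A ?S" by (rule left_module_mod_sum[OF M(1) left_module_simple[OF i(1)]])
  have finS: "finite (carrier ?S)" using M(2) fin_K by simp
  then obtain \<phi> :: "_ \<Rightarrow> int" where \<phi>: "inj_on \<phi> (carrier ?S)" by (rule finite_inj_int)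
  let ?T = "transport \<phi> ?S"
  interpret M: left_module A M by (rule M(1))
  have "card ((\<lambda>x. idem j \<odot>\<^bsub>?T\<^esub> x) ` carrier ?T) = card (carrier K) ^ \<alpha> j" if j: "j \<in> verts Q" for j
  proof -
    have "(\<lambda>x. idem j \<odot>\<^bsub>?T\<^esub> x) ` carrier ?T = \<phi> ` ((\<lambda>x. idem j \<odot>\<^bsub>?S\<^esub> x) ` carrier ?S)"
      unfolding transport_simps(1)[OF \<phi>] image_image by (rule image_cong) (simp_all only: transport_simps(4)[OF \<phi>])
    moreover have "(\<lambda>x. idem j \<odot>\<^bsub>?S\<^esub> x) ` carrier ?S = (\<lambda>x. idem j \<odot>\<^bsub>M\<^esub> x) ` carrier M \<times> (if j = i then carrier K else {\<zero>\<^bsub>K\<^esub>})"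
    proof (intro equalityI subsetI)
      fix z assume "z \<in> (\<lambda>x. idem j \<odot>\<^bsub>?S\<^esub> x) ` carrier ?S"
      then show "z \<in> (\<lambda>x. idem j \<odot>\<^bsub>M\<^esub> x) ` carrier M \<times> (if j = i then carrier K else {\<zero>\<^bsub>K\<^esub>})"
        by (auto simp: mon_def)
    next
      fix z assume "z \<in> (\<lambda>x. idem j \<odot>\<^bsub>M\<^esub> x) ` carrier M \<times> (if j = i then carrier K else {\<zero>\<^bsub>K\<^esub>})"
      then obtain x c where xc: "x \<in> carrier M" "c \<in> (if j = i then carrier K else {\<zero>\<^bsub>K\<^esub>})" "z = (idem j \<odot>\<^bsub>M\<^esub> x, c)" by blast
      then have c: "c \<in> carrier K" by (auto split: if_splits)
      then have "z = idem j \<odot>\<^bsub>?S\<^esub> (x, c)" using xc by (auto simp: mon_def split: if_splits)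
      moreover have "(x, c) \<in> carrier ?S" using xc(1) c by simp
      ultimately show "z \<in> (\<lambda>x. idem j \<odot>\<^bsub>?S\<^esub> x) ` carrier ?S" by blast
    qed
    moreover have "inj_on \<phi> ((\<lambda>x. idem j \<odot>\<^bsub>?S\<^esub> x) ` carrier ?S)"
    proof (rule inj_on_subset[OF \<phi>])
      interpret S: left_module A ?S by (rule S)
      show "(\<lambda>x. idem j \<odot>\<^bsub>?S\<^esub> x) ` carrier ?S \<subseteq> carrier ?S"
        using S.smult_closed[OF idem_A[OF j]] by (rule image_subsetI)
    qed
    ultimately have "card ((\<lambda>x. idem j \<odot>\<^bsub>?T\<^esub> x) ` carrier ?T) = card ((\<lambda>x. idem j \<odot>\<^bsub>M\<^esub> x) ` carrier M) * card (if j = i then carrier K else {\<zero>\<^bsub>K\<^esub>})"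
      by (simp add: card_image card_cartesian_product)
    also have "\<dots> = card (carrier K) ^ \<alpha> j"
      using M(3)[OF j] i(2) by (cases "\<alpha> i") (auto simp: \<beta>_def)
    finally show ?thesis .
  qed
  moreover have "finite (carrier ?T)" using finS by (simp add: transport_simps[OF \<phi>])
  ultimately show ?case using left_module_transport[OF S \<phi>] 
    by (intro exI[of _ ?T]) (simp add: has_dimension_vector_iff)
qed

lemma vspace_card_power:
  assumes "left_module A M" "finite (carrier M)" "submodule N A M" "u \<in> verts Q"
  shows "\<exists>d. card (carrier (vspace M N u)) = card (carrier K) ^ d"
proof -
  interpret M: left_module A M by fact
  have "finite (carrier (vspace M N u))" 
    using assms(2) M.submoduleD(1)[OF assms(3)] by (auto intro: finite_subset)
  then show ?thesis
    using card_hom_vector_space[OF K.field_axioms vspace_left_module[OF assms(1,4,3)] vspace_left_module[OF assms(1,4,3)] fin_K]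
    by blast
qed

lemma vspace_card_direct:
  assumes M: "left_module A M" and fin: "finite (carrier M)" and d: "direct_decomposition A M N N'" and u: "u \<in> verts Q"
  shows "card (carrier (vspace M (carrier M) u)) = card (carrier (vspace M N u)) * card (carrier (vspace M N' u))"
proof -
  interpret M: left_module A M by fact
  interpret S: left_module K "scalars M" by (rule left_module_scalars[OF M])
  have sub: "submodule N A M" "submodule N' A M" using d by (auto simp: direct_decomposition_def)
  note N = M.submoduleD[OF sub(1)] and N' = M.submoduleD[OF sub(2)]
  obtain \<pi> where pi: "\<pi> \<in> mod_hom A M (M\<lparr>carrier := N\<rparr>)" "\<And>x. x \<in> N \<Longrightarrow> \<pi> x = x"
    "mod_ker M (M\<lparr>carrier := N\<rparr>) \<pi> = N'" by (rule projection_exists[OF M d]) (rule that)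
  have piN: "\<pi> x \<in> N" if "x \<in> carrier M" for x using mod_homD(2)[OF pi(1) that] by simp
  let ?V = "carrier (vspace M (carrier M) u)"
  interpret V: submodule ?V K "scalars M" by (rule vspace_submodule[OF M u submodule_carrier[OF M]])
  have "card ?V = card (\<pi> ` ?V) * card {x \<in> ?V. \<pi> x = \<zero>\<^bsub>scalars M\<^esub>}"
  proof (rule card_eq_image_kernel[OF S.M.abelian_group_axioms S.M.abelian_group_axioms V.subgroup_axioms])
    show "finite ?V" using fin by simp
    show "\<pi> x \<in> carrier (scalars M)" if "x \<in> ?V" for x using piN[of x] N(3) that by simp
    show "\<pi> (x \<oplus>\<^bsub>scalars M\<^esub> y) = \<pi> x \<oplus>\<^bsub>scalars M\<^esub> \<pi> y" if "x \<in> ?V" "y \<in> ?V" for x y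
      using mod_homD(3)[OF pi(1), of x y] that by simp
  qed
  also have "\<pi> ` ?V = carrier (vspace M N u)"
  proof (intro equalityI subsetI)
    fix y assume "y \<in> \<pi> ` ?V"
    then obtain x where x: "x \<in> carrier M" "idem u \<odot>\<^bsub>M\<^esub> x = x" "y = \<pi> x" by auto
    then have "idem u \<odot>\<^bsub>M\<^esub> y = y" using mod_homD(4)[OF pi(1) idem_A[OF u] x(1)] by simp
    then show "y \<in> carrier (vspace M N u)" using piN x by simp
  next
    fix y assume "y \<in> carrier (vspace M N u)"
    then show "y \<in> \<pi> ` ?V" using pi(2)[of y] N(3)[of y] by (intro image_eqI[of _ \<pi> y]) simp_all
  qed
  also have "{x \<in> ?V. \<pi> x = \<zero>\<^bsub>scalars M\<^esub>} = carrier (vspace M N' u)"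
    using pi(3) by (auto simp: mod_ker_def)
  finally show ?thesis .
qed

lemma vspace_nonzero:
  assumes M: "left_module A M" and fin: "finite (carrier M)" and N: "submodule N A M" "N \<noteq> {\<zero>\<^bsub>M\<^esub>}"
    and dims: "\<And>u. u \<in> verts Q \<Longrightarrow> card (carrier (vspace M N u)) = card (carrier K) ^ \<beta> u"
  shows "\<exists>u\<in>verts Q. \<beta> u \<noteq> 0"
proof (rule ccontr)
  assume z: "\<not> ?thesis"
  interpret M: left_module A M by fact
  note Nd = M.submoduleD[OF N(1)]
  obtain x where x: "x \<in> N" "x \<noteq> \<zero>\<^bsub>M\<^esub>" using N(2) Nd(2) by blast
  have "idem u \<odot>\<^bsub>M\<^esub> x = \<zero>\<^bsub>M\<^esub>" if u: "u \<in> verts Q" for u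
  proof -
    have "card (carrier (vspace M N u)) = 1" using dims[OF u] z u by simp
    then obtain y where y: "carrier (vspace M N u) = {y}" by (rule card_1_singletonE)
    have "idem u \<odot>\<^bsub>M\<^esub> x \<in> carrier (vspace M N u)"
      using x(1) Nd(3,5) u by (simp add: idem_A idem_idem[OF M])
    moreover have "\<zero>\<^bsub>M\<^esub> \<in> carrier (vspace M N u)" using Nd(2) u by (simp add: idem_A)
    ultimately show ?thesis unfolding y by simp
  qed
  then show False using idem_sep[OF M Nd(3)[OF x(1)]] x(2) by blast
qed

end

lemma dynkin_path_alg:
  assumes "dynkin_quiver Q" "finite_field K"
  shows "path_alg Q K"
  using assms dynkin_quiver_facts[OF assms(1)] finite_paths[OF assms(1)]
  by (intro path_alg.intro path_alg_axioms.intro) (auto simp: finite_field_def)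

text \<open>
  A module \<open>M\<close> with dimension vector \<open>\<alpha>\<close> and the fewest endomorphisms is indecomposable. If it is the
  direct sum of \<open>N\<close> and \<open>N'\<close> with dimension vectors \<open>\<beta>\<close> and \<open>\<gamma>\<close>, then the mixed terms \<open>\<langle>\<beta>, \<gamma>\<rangle>\<close> and \<open>\<langle>\<gamma>, \<beta>\<rangle>\<close> of
  the Tits form at \<open>\<alpha> = \<beta> + \<gamma>\<close> are nonnegative by \<open>ext_vanishes\<close>, and the other two terms are positive
  integers, so the value at \<open>\<alpha>\<close> is at least \<open>2\<close>. At a root it is \<open>1\<close>.
\<close>

theorem exists_indecomposable_of_root:
  fixes Q :: "(nat, 'e) pre_digraph"
  assumes Q: "dynkin_quiver Q" and K: "finite_field K" and \<alpha>: "\<alpha> \<in> positive_roots Q"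
  shows "\<exists>M :: (nat \<times> 'e list \<Rightarrow> int, int) module.
    indecomposable_module (path_algebra Q K) M \<and> has_dimension_vector Q K M \<alpha>"
proof -
  interpret path_alg Q K by (rule dynkin_path_alg[OF Q K])
  note fin = dynkin_quiver_facts[OF Q]
  have tits: "euler_form Q \<alpha> \<alpha> = 1" and nn: "\<And>i. 0 \<le> \<alpha> i" 
    using \<alpha> tits_root[OF Q] by (auto simp: positive_roots_def)
  let ?P = "\<lambda>M :: (nat \<times> 'e list \<Rightarrow> int, int) module. left_module A M \<and> has_dimension_vector Q K M \<alpha>"
  obtain M0 where "?P M0"
    using exists_module_of_dimension[OF fin(4), of "\<lambda>i. nat (\<alpha> i)"] nn by auto
  then obtain M :: "(nat \<times> 'e list \<Rightarrow> int, int) module" where M: "left_module A M" "has_dimension_vector Q K M \<alpha>" 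
    and min: "\<And>M2. ?P M2 \<Longrightarrow> card (mod_hom A M M) \<le> card (mod_hom A M2 M2)"
    using ex_has_least_nat[of ?P M0 "\<lambda>M. card (mod_hom A M M)"] by auto
  have finM: "finite (carrier M)" and dM: "\<And>u. u \<in> verts Q \<Longrightarrow> card (carrier (vspace M (carrier M) u)) = card (carrier K) ^ nat (\<alpha> u)"
    using M(2) idem_image[OF M(1) _ submodule_carrier[OF M(1)]] by (simp_all add: has_dimension_vector_iff)
  have "\<not> decomposes A M id"
  proof
    assume "decomposes A M id"
    then obtain N N' where d: "direct_decomposition A M N N'" and ne: "N \<noteq> {\<zero>\<^bsub>M\<^esub>}" "N' \<noteq> {\<zero>\<^bsub>M\<^esub>}"
      by (auto simp: decomposes_def direct_decomposition_def)
    have d': "direct_decomposition A M N' N" by (rule direct_decomposition_sym[OF M(1) d])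
    have sub: "submodule N A M" "submodule N' A M" using d by (auto simp: direct_decomposition_def)
    obtain \<beta> where \<beta>: "\<And>u. u \<in> verts Q \<Longrightarrow> card (carrier (vspace M N u)) = card (carrier K) ^ \<beta> u"
      using vspace_card_power[OF M(1) finM sub(1)] by metis
    obtain \<gamma> where \<gamma>: "\<And>u. u \<in> verts Q \<Longrightarrow> card (carrier (vspace M N' u)) = card (carrier K) ^ \<gamma> u"
      using vspace_card_power[OF M(1) finM sub(2)] by metis
    have min': "card (mod_hom A M M) \<le> card (mod_hom A M2 M2)"
      if "left_module A M2" "carrier M2 = carrier M" 
        "\<And>u x. u \<in> verts Q \<Longrightarrow> x \<in> carrier M \<Longrightarrow> idem u \<odot>\<^bsub>M2\<^esub> x = idem u \<odot>\<^bsub>M\<^esub> x"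
      for M2 :: "(nat \<times> 'e list \<Rightarrow> int, int) module"
    proof (rule min)
      show "?P M2" using M(2) that by (simp add: has_dimension_vector_iff cong: image_cong)
    qed
    have 1: "(\<Sum>a\<in>arcs Q. \<beta> (tail Q a) * \<gamma> (head Q a)) \<le> (\<Sum>u\<in>verts Q. \<beta> u * \<gamma> u)"
      by (rule ext_vanishes[OF M(1) finM d' min' \<beta> \<gamma>])
    have 2: "(\<Sum>a\<in>arcs Q. \<gamma> (tail Q a) * \<beta> (head Q a)) \<le> (\<Sum>u\<in>verts Q. \<gamma> u * \<beta> u)"
      by (rule ext_vanishes[OF M(1) finM d min' \<gamma> \<beta>])
    define b c where "b = (\<lambda>u. int (\<beta> u))" and "c = (\<lambda>u. int (\<gamma> u))"
    have 12: "0 \<le> euler_form Q b c" "0 \<le> euler_form Q c b"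
      using 1 2 by (simp_all add: euler_form_def b_def c_def flip: of_nat_mult of_nat_sum)
    have pos: "0 < euler_form Q b b" "0 < euler_form Q c c"
      using vspace_nonzero[OF M(1) finM sub(1) ne(1) \<beta>] vspace_nonzero[OF M(1) finM sub(2) ne(2) \<gamma>]
        tits_pos[OF Q] by (auto simp: b_def c_def)
    have "\<alpha> u = b u + c u" if u: "u \<in> verts Q" for u
    proof -
      have "card (carrier K) ^ nat (\<alpha> u) = card (carrier K) ^ (\<beta> u + \<gamma> u)"
        using vspace_card_direct[OF M(1) finM d u] dM[OF u] \<beta>[OF u] \<gamma>[OF u] by (simp add: power_add)
      then have "nat (\<alpha> u) = \<beta> u + \<gamma> u" using q_gt_1 power_inject_exp by blast
      then show ?thesis using nn[of u] by (simp add: b_def c_def)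
    qed
    then have "euler_form Q \<alpha> \<alpha> = euler_form Q (\<lambda>u. b u + c u) (\<lambda>u. b u + c u)"
      by (intro euler_form_cong[OF fin(1)])
    also have "\<dots> = euler_form Q b b + euler_form Q c c + (euler_form Q b c + euler_form Q c b)"
      by (simp add: euler_form_add_left euler_form_add_right)
    finally show False using tits 12 pos by linarith
  qed
  moreover have "carrier M \<noteq> {\<zero>\<^bsub>M\<^esub>}"
  proof
    assume z: "carrier M = {\<zero>\<^bsub>M\<^esub>}"
    interpret M: left_module A M by (rule M(1))
    have "\<alpha> u = 0" if u: "u \<in> verts Q" for u
    proof -
      have "card (carrier K) ^ nat (\<alpha> u) = card (carrier K) ^ 0"
        using dM[OF u] u z by (simp add: idem_A cong: conj_cong)
      then have "nat (\<alpha> u) = 0" using q_gt_1 power_inject_exp by blast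
      then show ?thesis using nn[of u] by simp
    qed
    then have "euler_form Q \<alpha> \<alpha> = euler_form Q (\<lambda>_. 0) (\<lambda>_. 0)" by (intro euler_form_cong[OF fin(1)])
    then show False using tits by (simp add: euler_form_def)
  qed
  ultimately show ?thesis using M unfolding indecomposable_module_def by blast
qed

section \<open>Cycles and boundaries of complexes\<close>

text \<open>
  Finiteness is included because cycles, boundaries and homology are measured by numbers of elements.
\<close>

definition complex_over :: "'a ring \<Rightarrow> ('a, 'b) cyclic_complex \<Rightarrow> bool" where
  "complex_over R X \<longleftrightarrow> left_module R (fst X) \<and> finite (carrier (fst X)) \<and>
     (\<forall>x\<in>carrier (fst X). snd X x \<in> carrier (fst X) \<and> snd X (snd X x) = \<zero>\<^bsub>fst X\<^esub>) \<and>
     (\<forall>x\<in>carrier (fst X). \<forall>y\<in>carrier (fst X). snd X (x \<oplus>\<^bsub>fst X\<^esub> y) = snd X x \<oplus>\<^bsub>fst X\<^esub> snd X y) \<and>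
     (\<forall>a\<in>carrier R. \<forall>x\<in>carrier (fst X). snd X (a \<odot>\<^bsub>fst X\<^esub> x) = a \<odot>\<^bsub>fst X\<^esub> snd X x)"

lemma complex_overD:
  assumes "complex_over R X"
  shows "left_module R (fst X)" "finite (carrier (fst X))"
    "\<And>x. x \<in> carrier (fst X) \<Longrightarrow> snd X x \<in> carrier (fst X)"
    "\<And>x. x \<in> carrier (fst X) \<Longrightarrow> snd X (snd X x) = \<zero>\<^bsub>fst X\<^esub>"
    "\<And>x y. x \<in> carrier (fst X) \<Longrightarrow> y \<in> carrier (fst X) \<Longrightarrow> snd X (x \<oplus>\<^bsub>fst X\<^esub> y) = snd X x \<oplus>\<^bsub>fst X\<^esub> snd X y"
    "\<And>a x. a \<in> carrier R \<Longrightarrow> x \<in> carrier (fst X) \<Longrightarrow> snd X (a \<odot>\<^bsub>fst X\<^esub> x) = a \<odot>\<^bsub>fst X\<^esub> snd X x"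
  using assms unfolding complex_over_def by auto

lemma complex_d_zero:
  assumes "complex_over R X" shows "snd X \<zero>\<^bsub>fst X\<^esub> = \<zero>\<^bsub>fst X\<^esub>"
proof -
  note X = complex_overD[OF assms]
  interpret X: left_module R "fst X" by (rule X(1))
  show ?thesis using X(6)[of "\<zero>\<^bsub>R\<^esub>" "\<zero>\<^bsub>fst X\<^esub>"] X(3)[of "\<zero>\<^bsub>fst X\<^esub>"] by simp
qed

text \<open>
  For an idempotent \<open>e\<close> this is \<open>e M\<close>. With \<open>e\<close> the idempotent of a vertex it is the space at that vertex,
  and with \<open>e = 1\<close> it is all of \<open>M\<close>, so both counts needed below are instances of the same lemmas.
\<close>

definition fixed :: "('a, 'b) module \<Rightarrow> 'a \<Rightarrow> 'b set" where
  "fixed M e = {x \<in> carrier M. e \<odot>\<^bsub>M\<^esub> x = x}"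

lemma fixed_subgroup:
  assumes "left_module R M" "e \<in> carrier R"
  shows "subgroup (fixed M e) (add_monoid M)"
proof -
  interpret M: left_module R M by fact
  show ?thesis
    by (rule subgroup.intro)
      (auto simp: fixed_def M.smult_r_distr M.smult_minus assms(2) simp flip: a_inv_def)
qed

text \<open>
  The homology of the part \<open>e X\<close> has \<open>cycles_card X e / boundaries_card X e\<close> elements.
\<close>

definition cycles_card :: "('a, 'b) cyclic_complex \<Rightarrow> 'a \<Rightarrow> nat" where
  "cycles_card X e = card {x \<in> fixed (fst X) e. snd X x = \<zero>\<^bsub>fst X\<^esub>}"

definition boundaries_card :: "('a, 'b) cyclic_complex \<Rightarrow> 'a \<Rightarrow> nat" where
  "boundaries_card X e = card (snd X ` fixed (fst X) e)"

lemma card_fixed: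
  assumes "complex_over R X" "e \<in> carrier R"
  shows "card (fixed (fst X) e) = boundaries_card X e * cycles_card X e"
proof -
  note X = complex_overD[OF assms(1)]
  interpret X: left_module R "fst X" by (rule X(1))
  show ?thesis unfolding cycles_card_def boundaries_card_def
    by (rule card_eq_image_kernel[OF X.M.abelian_group_axioms X.M.abelian_group_axioms
      fixed_subgroup[OF X(1) assms(2)]])
      (auto simp: fixed_def X(2,3,5))
qed

lemma boundaries_card_pos:
  assumes "complex_over R X" "e \<in> carrier R"
  shows "0 < boundaries_card X e"
proof -
  note X = complex_overD[OF assms(1)]
  interpret X: left_module R "fst X" by (rule X(1))
  have "\<zero>\<^bsub>fst X\<^esub> \<in> fixed (fst X) e" using assms(2) by (simp add: fixed_def)
  moreover have "finite (fixed (fst X) e)" using X(2) by (simp add: fixed_def)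
  ultimately show ?thesis unfolding boundaries_card_def by (auto simp: card_gt_0_iff)
qed

lemma acyclic_cycles_fixed:
  assumes X: "complex_over R X" and e: "e \<in> carrier R" "e \<otimes>\<^bsub>R\<^esub> e = e" and ac: "acyclic_complex X"
  shows "{x \<in> fixed (fst X) e. snd X x = \<zero>\<^bsub>fst X\<^esub>} = snd X ` fixed (fst X) e"
proof (intro equalityI subsetI)
  note Xd = complex_overD[OF X]
  interpret X: left_module R "fst X" by (rule Xd(1))
  fix x assume "x \<in> {x \<in> fixed (fst X) e. snd X x = \<zero>\<^bsub>fst X\<^esub>}"
  then have x: "x \<in> carrier (fst X)" "e \<odot>\<^bsub>fst X\<^esub> x = x" "snd X x = \<zero>\<^bsub>fst X\<^esub>" by (auto simp: fixed_def)
  then have "x \<in> snd X ` carrier (fst X)" using ac by (auto simp: acyclic_complex_def mod_ker_def)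
  then obtain y where y: "y \<in> carrier (fst X)" "x = snd X y" by blast
  have "x = snd X (e \<odot>\<^bsub>fst X\<^esub> y)" using Xd(6)[OF e(1) y(1)] x(2) y(2) by simp
  moreover have "e \<odot>\<^bsub>fst X\<^esub> y \<in> fixed (fst X) e"
    using X.smult_assoc[OF e(1) e(1) y(1)] e y(1) by (simp add: fixed_def X.smult_closed)
  ultimately show "x \<in> snd X ` fixed (fst X) e" by blast
next
  note Xd = complex_overD[OF X]
  fix x assume "x \<in> snd X ` fixed (fst X) e"
  then obtain y where y: "y \<in> carrier (fst X)" "e \<odot>\<^bsub>fst X\<^esub> y = y" "x = snd X y" by (auto simp: fixed_def)
  then show "x \<in> {x \<in> fixed (fst X) e. snd X x = \<zero>\<^bsub>fst X\<^esub>}"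
    using Xd(3,4)[OF y(1)] Xd(6)[OF e(1) y(1)] by (simp add: fixed_def)
qed

lemma acyclic_cards:
  assumes "complex_over R X" "e \<in> carrier R" "e \<otimes>\<^bsub>R\<^esub> e = e" "acyclic_complex X"
  shows "cycles_card X e = boundaries_card X e"
  unfolding cycles_card_def boundaries_card_def acyclic_cycles_fixed[OF assms] ..

lemma conflationsD:
  assumes "(f, g) \<in> conflations R Y Z X"
  shows "f \<in> mod_hom R (fst Y) (fst Z)" "g \<in> mod_hom R (fst Z) (fst X)"
    "\<And>y. y \<in> carrier (fst Y) \<Longrightarrow> f (snd Y y) = snd Z (f y)"
    "\<And>z. z \<in> carrier (fst Z) \<Longrightarrow> g (snd Z z) = snd X (g z)"
    "inj_on f (carrier (fst Y))" "f ` carrier (fst Y) = mod_ker (fst Z) (fst X) g"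
    "g ` carrier (fst Z) = carrier (fst X)"
  using assms by (auto simp: conflations_def chain_hom_def)

lemma conflation_fixed:
  assumes Y: "complex_over R Y" and Z: "complex_over R Z" and X: "complex_over R X"
    and fg: "(f, g) \<in> conflations R Y Z X" and e: "e \<in> carrier R" "e \<otimes>\<^bsub>R\<^esub> e = e"
  shows "g ` fixed (fst Z) e = fixed (fst X) e"
    "{z \<in> fixed (fst Z) e. g z = \<zero>\<^bsub>fst X\<^esub>} = f ` fixed (fst Y) e"
proof -
  note c = conflationsD[OF fg]
  interpret Y: left_module R "fst Y" by (rule complex_overD(1)[OF Y])
  interpret Z: left_module R "fst Z" by (rule complex_overD(1)[OF Z])
  interpret X: left_module R "fst X" by (rule complex_overD(1)[OF X])
  show "g ` fixed (fst Z) e = fixed (fst X) e"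
  proof (intro equalityI subsetI)
    fix x assume "x \<in> g ` fixed (fst Z) e"
    then obtain z where z: "z \<in> carrier (fst Z)" "e \<odot>\<^bsub>fst Z\<^esub> z = z" "x = g z" by (auto simp: fixed_def)
    then show "x \<in> fixed (fst X) e"
      using mod_homD(2)[OF c(2) z(1)] mod_homD(4)[OF c(2) e(1) z(1)] by (simp add: fixed_def)
  next
    fix x assume "x \<in> fixed (fst X) e"
    then have x: "x \<in> carrier (fst X)" "e \<odot>\<^bsub>fst X\<^esub> x = x" by (auto simp: fixed_def)
    then obtain z where z: "z \<in> carrier (fst Z)" "x = g z" using c(7) by blast
    have "e \<odot>\<^bsub>fst Z\<^esub> z \<in> fixed (fst Z) e"
      using Z.smult_assoc[OF e(1) e(1) z(1)] e z(1) by (simp add: fixed_def Z.smult_closed)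
    moreover have "x = g (e \<odot>\<^bsub>fst Z\<^esub> z)" using mod_homD(4)[OF c(2) e(1) z(1)] x z by simp
    ultimately show "x \<in> g ` fixed (fst Z) e" by blast
  qed
  show "{z \<in> fixed (fst Z) e. g z = \<zero>\<^bsub>fst X\<^esub>} = f ` fixed (fst Y) e"
  proof (intro equalityI subsetI)
    fix z assume "z \<in> {z \<in> fixed (fst Z) e. g z = \<zero>\<^bsub>fst X\<^esub>}"
    then have z: "z \<in> carrier (fst Z)" "e \<odot>\<^bsub>fst Z\<^esub> z = z" "z \<in> f ` carrier (fst Y)"
      unfolding c(6) by (auto simp: fixed_def mod_ker_def)
    then obtain y where y: "y \<in> carrier (fst Y)" "z = f y" by blast
    have "f (e \<odot>\<^bsub>fst Y\<^esub> y) = f y" using mod_homD(4)[OF c(1) e(1) y(1)] z y by simp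
    then have "e \<odot>\<^bsub>fst Y\<^esub> y = y" using inj_onD[OF c(5)] y(1) e(1) by (simp add: Y.smult_closed)
    then show "z \<in> f ` fixed (fst Y) e" using y by (simp add: fixed_def)
  next
    fix z assume "z \<in> f ` fixed (fst Y) e"
    then obtain y where y: "y \<in> carrier (fst Y)" "e \<odot>\<^bsub>fst Y\<^esub> y = y" "z = f y" by (auto simp: fixed_def)
    then have "z \<in> mod_ker (fst Z) (fst X) g" using c(6) by blast
    then show "z \<in> {z \<in> fixed (fst Z) e. g z = \<zero>\<^bsub>fst X\<^esub>}"
      using mod_homD(4)[OF c(1) e(1) y(1)] y by (simp add: fixed_def mod_ker_def)
  qed
qed

lemma conflation_card:
  assumes Y: "complex_over R Y" and Z: "complex_over R Z" and X: "complex_over R X"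
    and fg: "(f, g) \<in> conflations R Y Z X" and e: "e \<in> carrier R" "e \<otimes>\<^bsub>R\<^esub> e = e"
  shows "card (fixed (fst Z) e) = card (fixed (fst X) e) * card (fixed (fst Y) e)"
proof -
  note c = conflationsD[OF fg] and cf = conflation_fixed[OF assms]
  interpret Z: left_module R "fst Z" by (rule complex_overD(1)[OF Z])
  interpret X: left_module R "fst X" by (rule complex_overD(1)[OF X])
  have "card (fixed (fst Z) e) = card (g ` fixed (fst Z) e) * card {z \<in> fixed (fst Z) e. g z = \<zero>\<^bsub>fst X\<^esub>}"
    by (rule card_eq_image_kernel[OF Z.M.abelian_group_axioms X.M.abelian_group_axioms
      fixed_subgroup[OF complex_overD(1)[OF Z] e(1)]])
      (simp_all add: fixed_def complex_overD(2)[OF Z] mod_homD(2,3)[OF c(2)])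
  moreover have "card (f ` fixed (fst Y) e) = card (fixed (fst Y) e)"
    by (rule card_image[OF inj_on_subset[OF c(5)]]) (auto simp: fixed_def)
  ultimately show ?thesis unfolding cf by simp
qed

text \<open>
  The connecting map identifies the homology of \<open>X\<close> with that of \<open>Y\<close> when \<open>Z\<close> is acyclic. Here this is
  obtained by counting the set \<open>G\<close> of the \<open>z\<close> whose boundary comes from \<open>Y\<close> in two ways. The differential
  maps \<open>G\<close> onto the cycles of \<open>Y\<close>, with the cycles of \<open>Z\<close> as kernel; the map \<open>g\<close> sends \<open>G\<close> onto the cycles of \<open>X\<close>,
  with \<open>Y\<close> as kernel. Together with \<open>|Z| = |X| |Y|\<close> this gives the claim.
\<close>

lemma conflation_acyclic_middle:
  assumes Y: "complex_over R Y" and Z: "complex_over R Z" and X: "complex_over R X"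
    and fg: "(f, g) \<in> conflations R Y Z X" and e: "e \<in> carrier R" "e \<otimes>\<^bsub>R\<^esub> e = e"
    and ac: "acyclic_complex Z"
  shows "cycles_card X e * boundaries_card Y e = boundaries_card X e * cycles_card Y e"
proof -
  note c = conflationsD[OF fg] and cf = conflation_fixed[OF assms(1-6)]
  note Yd = complex_overD[OF Y] and Zd = complex_overD[OF Z] and Xd = complex_overD[OF X]
  interpret Y: left_module R "fst Y" by (rule Yd(1))
  interpret Z: left_module R "fst Z" by (rule Zd(1))
  interpret X: left_module R "fst X" by (rule Xd(1))
  let ?G = "{z \<in> fixed (fst Z) e. g (snd Z z) = \<zero>\<^bsub>fst X\<^esub>}"
  let ?kX = "cycles_card X e" and ?kY = "cycles_card Y e" and ?iX = "boundaries_card X e" and ?iY = "boundaries_card Y e"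
    and ?iZ = "boundaries_card Z e"
  have fz: "finite (fixed (fst Z) e)" using Zd(2) by (simp add: fixed_def)
  interpret F: subgroup "fixed (fst Z) e" "add_monoid (fst Z)" by (rule fixed_subgroup[OF Zd(1) e(1)])
  have gd: "g (snd Z (x \<oplus>\<^bsub>fst Z\<^esub> y)) = g (snd Z x) \<oplus>\<^bsub>fst X\<^esub> g (snd Z y)" if "x \<in> carrier (fst Z)" "y \<in> carrier (fst Z)" for x y
    using that by (simp add: Zd(3,5) mod_homD(3)[OF c(2)])
  have G: "subgroup ?G (add_monoid (fst Z))"
  proof (rule subgroup.intro)
    show "?G \<subseteq> carrier (add_monoid (fst Z))" by (auto simp: fixed_def)
    have z0: "g (snd Z \<zero>\<^bsub>fst Z\<^esub>) = \<zero>\<^bsub>fst X\<^esub>" using complex_d_zero[OF Z] mod_hom_zero[OF c(2) Zd(1) Xd(1)] by simp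
    then show "\<one>\<^bsub>add_monoid (fst Z)\<^esub> \<in> ?G" using F.one_closed by simp
    fix x assume x: "x \<in> ?G"
    then have xc: "x \<in> carrier (fst Z)" by (simp add: fixed_def)
    show "inv\<^bsub>add_monoid (fst Z)\<^esub> x \<in> ?G"
    proof -
      have n: "\<ominus>\<^bsub>fst Z\<^esub> x \<in> fixed (fst Z) e" using F.m_inv_closed[of x] x by (simp add: a_inv_def)
      have "g (snd Z (\<ominus>\<^bsub>fst Z\<^esub> x)) \<oplus>\<^bsub>fst X\<^esub> g (snd Z x) = \<zero>\<^bsub>fst X\<^esub>"
        using gd[of "\<ominus>\<^bsub>fst Z\<^esub> x" x] xc z0 by (simp add: Z.M.l_neg)
      then have "g (snd Z (\<ominus>\<^bsub>fst Z\<^esub> x)) = \<zero>\<^bsub>fst X\<^esub>"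
        using x mod_homD(2)[OF c(2)] Zd(3) xc by simp
      then show ?thesis using n by (simp add: a_inv_def)
    qed
    fix y assume y: "y \<in> ?G"
    then have yc: "y \<in> carrier (fst Z)" by (simp add: fixed_def)
    show "x \<otimes>\<^bsub>add_monoid (fst Z)\<^esub> y \<in> ?G" using F.m_closed[of x y] x y gd[OF xc yc] by simp
  qed
  have fG: "finite ?G" using fz by simp
  have 1: "card ?G = card (snd Z ` ?G) * card {z \<in> ?G. snd Z z = \<zero>\<^bsub>fst Z\<^esub>}"
    by (rule card_eq_image_kernel[OF Z.M.abelian_group_axioms Z.M.abelian_group_axioms G fG])
      (simp_all add: fixed_def Zd(3,5))
  have 2: "card ?G = card (g ` ?G) * card {z \<in> ?G. g z = \<zero>\<^bsub>fst X\<^esub>}"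
    by (rule card_eq_image_kernel[OF Z.M.abelian_group_axioms X.M.abelian_group_axioms G fG])
      (simp_all add: fixed_def mod_homD(2,3)[OF c(2)])
  have dz: "g \<zero>\<^bsub>fst Z\<^esub> = \<zero>\<^bsub>fst X\<^esub>" by (rule mod_hom_zero[OF c(2) Zd(1) Xd(1)])
  have "{z \<in> ?G. snd Z z = \<zero>\<^bsub>fst Z\<^esub>} = {z \<in> fixed (fst Z) e. snd Z z = \<zero>\<^bsub>fst Z\<^esub>}" using dz by auto
  then have 3: "card {z \<in> ?G. snd Z z = \<zero>\<^bsub>fst Z\<^esub>} = ?iZ"
    by (simp add: acyclic_cycles_fixed[OF Z e ac] boundaries_card_def)
  have "snd Z ` ?G = f ` {y \<in> fixed (fst Y) e. snd Y y = \<zero>\<^bsub>fst Y\<^esub>}"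
  proof (intro equalityI subsetI)
    fix w assume "w \<in> snd Z ` ?G"
    then obtain z where z: "z \<in> fixed (fst Z) e" "g (snd Z z) = \<zero>\<^bsub>fst X\<^esub>" "w = snd Z z" by blast
    have zc: "z \<in> carrier (fst Z)" using z by (simp add: fixed_def)
    have "snd Z z \<in> fixed (fst Z) e" using z(1) Zd(6)[OF e(1) zc] Zd(3)[OF zc] by (simp add: fixed_def)
    then have "w \<in> f ` fixed (fst Y) e" unfolding cf(2)[symmetric] using z by simp
    then obtain y where y: "y \<in> fixed (fst Y) e" "w = f y" by blast
    have yc: "y \<in> carrier (fst Y)" using y by (simp add: fixed_def)
    have "f (snd Y y) = f \<zero>\<^bsub>fst Y\<^esub>"
      using c(3)[OF yc] y z Zd(4)[OF zc] mod_hom_zero[OF c(1) Yd(1) Zd(1)] by simp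
    then have "snd Y y = \<zero>\<^bsub>fst Y\<^esub>" using inj_onD[OF c(5)] Yd(3)[OF yc] by simp
    then show "w \<in> f ` {y \<in> fixed (fst Y) e. snd Y y = \<zero>\<^bsub>fst Y\<^esub>}" using y by blast
  next
    fix w assume "w \<in> f ` {y \<in> fixed (fst Y) e. snd Y y = \<zero>\<^bsub>fst Y\<^esub>}"
    then obtain y where y: "y \<in> fixed (fst Y) e" "snd Y y = \<zero>\<^bsub>fst Y\<^esub>" "w = f y" by blast
    have yc: "y \<in> carrier (fst Y)" using y by (simp add: fixed_def)
    have "w \<in> {z \<in> fixed (fst Z) e. g z = \<zero>\<^bsub>fst X\<^esub>}" unfolding cf(2) using y by blast
    then have w: "w \<in> fixed (fst Z) e" "g w = \<zero>\<^bsub>fst X\<^esub>" by auto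
    have "snd Z w = \<zero>\<^bsub>fst Z\<^esub>" using c(3)[OF yc] y mod_hom_zero[OF c(1) Yd(1) Zd(1)] by simp
    then have "w \<in> snd Z ` fixed (fst Z) e" unfolding acyclic_cycles_fixed[OF Z e ac, symmetric] using w by simp
    then show "w \<in> snd Z ` ?G" using w by blast
  qed
  then have 4: "card (snd Z ` ?G) = ?kY"
    unfolding cycles_card_def by (simp add: card_image[OF inj_on_subset[OF c(5)]] fixed_def subset_iff)
  have "g ` ?G = {x \<in> fixed (fst X) e. snd X x = \<zero>\<^bsub>fst X\<^esub>}"
  proof (intro equalityI subsetI)
    fix x assume "x \<in> g ` ?G"
    then obtain z where z: "z \<in> fixed (fst Z) e" "g (snd Z z) = \<zero>\<^bsub>fst X\<^esub>" "x = g z" by blast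
    have zc: "z \<in> carrier (fst Z)" using z by (simp add: fixed_def)
    have "x \<in> fixed (fst X) e" using cf(1) z by blast
    then show "x \<in> {x \<in> fixed (fst X) e. snd X x = \<zero>\<^bsub>fst X\<^esub>}" using c(4)[OF zc] z by simp
  next
    fix x assume x: "x \<in> {x \<in> fixed (fst X) e. snd X x = \<zero>\<^bsub>fst X\<^esub>}"
    then obtain z where z: "z \<in> fixed (fst Z) e" "x = g z" using cf(1) by blast
    have zc: "z \<in> carrier (fst Z)" using z by (simp add: fixed_def)
    show "x \<in> g ` ?G" using x z c(4)[OF zc] by auto
  qed
  then have 5: "card (g ` ?G) = ?kX" by (simp add: cycles_card_def)
  have "{z \<in> ?G. g z = \<zero>\<^bsub>fst X\<^esub>} = {z \<in> fixed (fst Z) e. g z = \<zero>\<^bsub>fst X\<^esub>}"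
    using c(4) complex_d_zero[OF X] by (auto simp: fixed_def)
  then have "card {z \<in> ?G. g z = \<zero>\<^bsub>fst X\<^esub>} = card (f ` fixed (fst Y) e)" using cf(2) by simp
  also have "\<dots> = card (fixed (fst Y) e)"
    by (rule card_image[OF inj_on_subset[OF c(5)]]) (auto simp: fixed_def)
  finally have 6: "card {z \<in> ?G. g z = \<zero>\<^bsub>fst X\<^esub>} = ?iY * ?kY" using card_fixed[OF Y e(1)] by simp
  have pos: "0 < ?iZ" "0 < ?iX" "0 < ?iY" 
    using boundaries_card_pos[OF Z e(1)] boundaries_card_pos[OF X e(1)] boundaries_card_pos[OF Y e(1)] .
  have kYpos: "0 < ?kY"
  proof -
    have "\<zero>\<^bsub>fst Y\<^esub> \<in> {x \<in> fixed (fst Y) e. snd Y x = \<zero>\<^bsub>fst Y\<^esub>}" 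
      using complex_d_zero[OF Y] e(1) by (simp add: fixed_def)
    moreover have "finite {x \<in> fixed (fst Y) e. snd Y x = \<zero>\<^bsub>fst Y\<^esub>}" using Yd(2) by (simp add: fixed_def)
    ultimately show ?thesis unfolding cycles_card_def by (auto simp: card_gt_0_iff)
  qed
  \<comment> \<open>cancelling gives \<open>iZ = kX iY\<close>; as \<open>|Z| = iZ\<^sup>2\<close>, also \<open>iZ = iX kY\<close>\<close>
  have "?kY * ?iZ = ?kX * (?iY * ?kY)" by (rule trans[OF sym[OF 1[unfolded 3 4]] 2[unfolded 5 6]])
  then have "?kY * ?iZ = ?kY * (?kX * ?iY)" by (simp only: mult.assoc mult.commute mult.left_commute)
  then have iZ: "?iZ = ?kX * ?iY" using kYpos unfolding mult_cancel1 by simp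
  have "?iZ * ?iZ = (?iX * ?kX) * (?iY * ?kY)"
    using conflation_card[OF assms(1-6)] card_fixed[OF X e(1)] card_fixed[OF Y e(1)] card_fixed[OF Z e(1)]
      acyclic_cards[OF Z e ac] by simp
  then have "(?kX * ?iY) * ?iZ = (?kX * ?iY) * (?iX * ?kY)" using iZ by (simp add: ac_simps)
  moreover have "0 < ?kX * ?iY" using pos(1) iZ by simp
  ultimately have "?iZ = ?iX * ?kY" using mult_cancel1 by (metis less_irrefl)
  then show ?thesis using iZ by simp
qed

section \<open>Direct sums of complexes\<close>

lemma complex_sum_simps:
  "carrier (fst (complex_sum J X)) = (\<Pi>\<^sub>E i\<in>J. carrier (fst (X i)))"
  "\<zero>\<^bsub>fst (complex_sum J X)\<^esub> = (\<lambda>i\<in>J. \<zero>\<^bsub>fst (X i)\<^esub>)"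
  "x \<oplus>\<^bsub>fst (complex_sum J X)\<^esub> y = (\<lambda>i\<in>J. x i \<oplus>\<^bsub>fst (X i)\<^esub> y i)"
  "a \<odot>\<^bsub>fst (complex_sum J X)\<^esub> x = (\<lambda>i\<in>J. a \<odot>\<^bsub>fst (X i)\<^esub> x i)"
  "snd (complex_sum J X) x = (\<lambda>i\<in>J. snd (X i) (x i))"
  by (simp_all add: complex_sum_def)

lemma left_module_complex_sum:
  assumes "ring R" "\<And>i. i \<in> J \<Longrightarrow> left_module R (fst (X i))"
  shows "left_module R (fst (complex_sum J X))"
proof -
  interpret R: ring R by fact
  note lm = assms(2)
  show ?thesis
  proof (rule left_moduleI[OF assms(1)])
    fix x assume "x \<in> carrier (fst (complex_sum J X))"
    then have x: "\<And>i. i \<in> J \<Longrightarrow> x i \<in> carrier (fst (X i))" "x \<in> extensional J" 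
      by (auto simp: complex_sum_simps PiE_def)
    { fix i assume i: "i \<in> J"
      interpret Xi: left_module R "fst (X i)" by (rule lm[OF i])
      note Xi.smult_one[OF x(1)[OF i]] Xi.smult_l_null[OF x(1)[OF i]] Xi.M.l_zero[OF x(1)[OF i]] }
    note f = this
    show "\<zero>\<^bsub>fst (complex_sum J X)\<^esub> \<oplus>\<^bsub>fst (complex_sum J X)\<^esub> x = x"
      "\<one>\<^bsub>R\<^esub> \<odot>\<^bsub>fst (complex_sum J X)\<^esub> x = x"
      by (rule extensionalityI[of _ J]; simp add: complex_sum_simps x(2) f)+
    show "\<zero>\<^bsub>R\<^esub> \<odot>\<^bsub>fst (complex_sum J X)\<^esub> x = \<zero>\<^bsub>fst (complex_sum J X)\<^esub>"
      by (rule extensionalityI[of _ J]; simp add: complex_sum_simps f)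
    fix a assume a: "a \<in> carrier R"
    have sm: "a \<odot>\<^bsub>fst (X i)\<^esub> x i \<in> carrier (fst (X i))" if i: "i \<in> J" for i
      using left_module.smult_closed[OF lm[OF i] a x(1)[OF i]] .
    then show "a \<odot>\<^bsub>fst (complex_sum J X)\<^esub> x \<in> carrier (fst (complex_sum J X))"
      by (simp add: complex_sum_simps)
    fix b assume b: "b \<in> carrier R"
    show "(a \<oplus>\<^bsub>R\<^esub> b) \<odot>\<^bsub>fst (complex_sum J X)\<^esub> x = a \<odot>\<^bsub>fst (complex_sum J X)\<^esub> x \<oplus>\<^bsub>fst (complex_sum J X)\<^esub> b \<odot>\<^bsub>fst (complex_sum J X)\<^esub> x"
      by (rule extensionalityI[of _ J]; simp add: complex_sum_simps left_module.smult_l_distr[OF lm _ _ x(1)] a b)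
    show "(a \<otimes>\<^bsub>R\<^esub> b) \<odot>\<^bsub>fst (complex_sum J X)\<^esub> x = a \<odot>\<^bsub>fst (complex_sum J X)\<^esub> (b \<odot>\<^bsub>fst (complex_sum J X)\<^esub> x)"
      by (rule extensionalityI[of _ J]; simp add: complex_sum_simps left_module.smult_assoc[OF lm _ _ x(1)] a b)
  next
    fix x y assume "x \<in> carrier (fst (complex_sum J X))" "y \<in> carrier (fst (complex_sum J X))"
    then have x: "\<And>i. i \<in> J \<Longrightarrow> x i \<in> carrier (fst (X i))" 
      and y: "\<And>i. i \<in> J \<Longrightarrow> y i \<in> carrier (fst (X i))"
      by (auto simp: complex_sum_simps PiE_def)
    have ag: "abelian_group (fst (X i))" if "i \<in> J" for i using lm[OF that] by (rule left_module.axioms(2))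
    have am: "abelian_monoid (fst (X i))" if "i \<in> J" for i using ag[OF that] by (rule abelian_group.axioms(1))
    show "x \<oplus>\<^bsub>fst (complex_sum J X)\<^esub> y \<in> carrier (fst (complex_sum J X))"
      by (simp add: complex_sum_simps abelian_monoid.a_closed[OF am] x y)
    show "x \<oplus>\<^bsub>fst (complex_sum J X)\<^esub> y = y \<oplus>\<^bsub>fst (complex_sum J X)\<^esub> x"
      by (rule extensionalityI[of _ J]; simp add: complex_sum_simps abelian_monoid.a_comm[OF am x y])
    show "a \<odot>\<^bsub>fst (complex_sum J X)\<^esub> (x \<oplus>\<^bsub>fst (complex_sum J X)\<^esub> y) = a \<odot>\<^bsub>fst (complex_sum J X)\<^esub> x \<oplus>\<^bsub>fst (complex_sum J X)\<^esub> a \<odot>\<^bsub>fst (complex_sum J X)\<^esub> y"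
      if a: "a \<in> carrier R" for a
      by (rule extensionalityI[of _ J]; simp add: complex_sum_simps left_module.smult_r_distr[OF lm a x y])
    fix z assume "z \<in> carrier (fst (complex_sum J X))"
    then have z: "\<And>i. i \<in> J \<Longrightarrow> z i \<in> carrier (fst (X i))" by (auto simp: complex_sum_simps PiE_def)
    show "x \<oplus>\<^bsub>fst (complex_sum J X)\<^esub> y \<oplus>\<^bsub>fst (complex_sum J X)\<^esub> z = x \<oplus>\<^bsub>fst (complex_sum J X)\<^esub> (y \<oplus>\<^bsub>fst (complex_sum J X)\<^esub> z)"
      by (rule extensionalityI[of _ J]; simp add: complex_sum_simps abelian_monoid.a_assoc[OF am x y z])
  next
    show "\<zero>\<^bsub>fst (complex_sum J X)\<^esub> \<in> carrier (fst (complex_sum J X))"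
      by (simp add: complex_sum_simps abelian_monoid.zero_closed abelian_group.axioms(1) left_module.axioms(2)[OF lm])
  qed
qed

text \<open>
  Split off the summand \<open>i\<close>; the summand \<open>j\<close> shows that the complement is nonzero.
\<close>

lemma complex_sum_decomposes:
  assumes R: "ring R" and X: "\<And>i. i \<in> J \<Longrightarrow> complex_over R (X i)"
    and ij: "i \<in> J" "j \<in> J" "i \<noteq> j"
    and nz: "carrier (fst (X i)) \<noteq> {\<zero>\<^bsub>fst (X i)\<^esub>}" "carrier (fst (X j)) \<noteq> {\<zero>\<^bsub>fst (X j)\<^esub>}"
  shows "decomposes R (fst (complex_sum J X)) (snd (complex_sum J X))"
proof -
  let ?S = "fst (complex_sum J X)" and ?d = "snd (complex_sum J X)"
  have lm: "left_module R (fst (X i))" if "i \<in> J" for i using complex_overD(1)[OF X[OF that]] .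
  have ag: "abelian_group (fst (X i))" if "i \<in> J" for i using lm[OF that] by (rule left_module.axioms(2))
  have am: "abelian_monoid (fst (X i))" if "i \<in> J" for i using ag[OF that] by (rule abelian_group.axioms(1))
  have z: "\<zero>\<^bsub>fst (X i)\<^esub> \<in> carrier (fst (X i))" if "i \<in> J" for i using abelian_monoid.zero_closed[OF am[OF that]] .
  have zz: "\<zero>\<^bsub>fst (X i)\<^esub> \<oplus>\<^bsub>fst (X i)\<^esub> \<zero>\<^bsub>fst (X i)\<^esub> = \<zero>\<^bsub>fst (X i)\<^esub>" if "i \<in> J" for i 
    using abelian_monoid.l_zero[OF am[OF that] z[OF that]] .
  have az: "a \<odot>\<^bsub>fst (X i)\<^esub> \<zero>\<^bsub>fst (X i)\<^esub> = \<zero>\<^bsub>fst (X i)\<^esub>" if "i \<in> J" "a \<in> carrier R" for i a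
    using left_module.smult_r_null[OF lm[OF that(1)] that(2)] .
  have dz: "snd (X i) \<zero>\<^bsub>fst (X i)\<^esub> = \<zero>\<^bsub>fst (X i)\<^esub>" if "i \<in> J" for i using complex_d_zero[OF X[OF that]] .
  have nonzero: "\<exists>x\<in>carrier (fst (X i)). x \<noteq> \<zero>\<^bsub>fst (X i)\<^esub>" if "i \<in> J" "carrier (fst (X i)) \<noteq> {\<zero>\<^bsub>fst (X i)\<^esub>}" for i
    using z[OF that(1)] that(2) by blast
  interpret S: left_module R ?S by (rule left_module_complex_sum[OF R lm])
  \<comment> \<open>the elements with zero components at the indices in \<open>I\<close>\<close>
  define N where "N I = {x \<in> carrier ?S. \<forall>k\<in>I. x k = \<zero>\<^bsub>fst (X k)\<^esub>}" for I
  have sub: "submodule (N I) R ?S" if "I \<subseteq> J" for I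
    unfolding S.submodule_iff
  proof (intro conjI ballI)
    show "N I \<subseteq> carrier ?S" by (auto simp: N_def)
    show "\<zero>\<^bsub>?S\<^esub> \<in> N I" using that S.M.zero_closed by (auto simp: N_def complex_sum_simps(2) subset_iff) 
    fix x y assume "x \<in> N I" "y \<in> N I"
    then show "x \<oplus>\<^bsub>?S\<^esub> y \<in> N I" using that S.M.a_closed[of x y] 
      by (auto simp: N_def complex_sum_simps(3) zz subset_iff)
  next
    fix a x assume "a \<in> carrier R" "x \<in> N I"
    then show "a \<odot>\<^bsub>?S\<^esub> x \<in> N I" using that S.smult_closed[of a x] 
      by (auto simp: N_def complex_sum_simps(4) az subset_iff)
  qed
  have dN: "?d ` N I \<subseteq> N I" if "I \<subseteq> J" for I
  proof
    fix y assume "y \<in> ?d ` N I"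
    then obtain x where x: "x \<in> N I" "y = ?d x" by blast
    then have "\<And>k. k \<in> J \<Longrightarrow> x k \<in> carrier (fst (X k))" by (auto simp: N_def complex_sum_simps(1))
    then show "y \<in> N I" using x that complex_overD(3)[OF X] 
      by (auto simp: N_def complex_sum_simps dz subset_iff)
  qed
  have ne: "N (J - {k}) \<noteq> {\<zero>\<^bsub>?S\<^esub>}" if k: "k \<in> J" "carrier (fst (X k)) \<noteq> {\<zero>\<^bsub>fst (X k)\<^esub>}" for k
  proof -
    obtain x where x: "x \<in> carrier (fst (X k))" "x \<noteq> \<zero>\<^bsub>fst (X k)\<^esub>" using nonzero[OF k] by blast
    let ?x = "\<lambda>l\<in>J. if l = k then x else \<zero>\<^bsub>fst (X l)\<^esub>"
    have "?x \<in> N (J - {k})" using x z by (auto simp: N_def complex_sum_simps)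
    moreover have "?x \<noteq> \<zero>\<^bsub>?S\<^esub>" using x k by (auto simp: complex_sum_simps fun_eq_iff)
    ultimately show ?thesis by blast
  qed
  have "N (J - {j}) \<subseteq> N {i}" using ij by (auto simp: N_def)
  moreover have "\<zero>\<^bsub>?S\<^esub> \<in> N (J - {j})" using S.submoduleD(2)[OF sub[of "J - {j}"]] by auto
  ultimately have ne2: "N {i} \<noteq> {\<zero>\<^bsub>?S\<^esub>}" using ne[OF ij(2) nz(2)] by blast
  have int: "N (J - {i}) \<inter> N {i} = {\<zero>\<^bsub>?S\<^esub>}"
  proof (intro equalityI subsetI)
    fix x assume "x \<in> N (J - {i}) \<inter> N {i}"
    then have "x \<in> extensional J" "\<And>k. k \<in> J \<Longrightarrow> x k = \<zero>\<^bsub>fst (X k)\<^esub>"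
      by (auto simp: N_def complex_sum_simps PiE_def)
    then have "x = \<zero>\<^bsub>?S\<^esub>" by (intro extensionalityI[of x J]) (auto simp: complex_sum_simps)
    then show "x \<in> {\<zero>\<^bsub>?S\<^esub>}" by simp
  next
    fix x assume "x \<in> {\<zero>\<^bsub>?S\<^esub>}"
    then show "x \<in> N (J - {i}) \<inter> N {i}" 
      using S.submoduleD(2)[OF sub[of "J - {i}"]] S.submoduleD(2)[OF sub[of "{i}"]] ij by auto
  qed
  have sum: "carrier ?S = {x \<oplus>\<^bsub>?S\<^esub> y | x y. x \<in> N (J - {i}) \<and> y \<in> N {i}}"
  proof (intro equalityI subsetI)
    fix x assume x: "x \<in> carrier ?S"
    then have xk: "x \<in> extensional J" "\<And>k. k \<in> J \<Longrightarrow> x k \<in> carrier (fst (X k))"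
      by (auto simp: complex_sum_simps PiE_def)
    let ?a = "\<lambda>l\<in>J. if l = i then x l else \<zero>\<^bsub>fst (X l)\<^esub>" and ?b = "\<lambda>l\<in>J. if l = i then \<zero>\<^bsub>fst (X l)\<^esub> else x l"
    have "?a \<in> N (J - {i})" "?b \<in> N {i}" using xk z ij by (auto simp: N_def complex_sum_simps)
    moreover have "x = ?a \<oplus>\<^bsub>?S\<^esub> ?b"
      by (rule extensionalityI[OF xk(1)]) 
        (auto simp: complex_sum_simps abelian_monoid.l_zero[OF am xk(2)] abelian_monoid.r_zero[OF am xk(2)])
    ultimately show "x \<in> {x \<oplus>\<^bsub>?S\<^esub> y | x y. x \<in> N (J - {i}) \<and> y \<in> N {i}}" by blast
  next
    fix x assume "x \<in> {x \<oplus>\<^bsub>?S\<^esub> y | x y. x \<in> N (J - {i}) \<and> y \<in> N {i}}"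
    then obtain a b where ab: "x = a \<oplus>\<^bsub>?S\<^esub> b" "a \<in> N (J - {i})" "b \<in> N {i}" by blast
    then have "a \<in> carrier ?S" "b \<in> carrier ?S" by (auto simp: N_def)
    then show "x \<in> carrier ?S" unfolding ab(1) by (rule S.M.a_closed)
  qed
  show ?thesis unfolding decomposes_def
    using sub[of "J - {i}"] sub[of "{i}"] dN[of "J - {i}"] dN[of "{i}"] ne[OF ij(1) nz(1)] ne2 int sum ij(1)
    by (intro exI[of _ "N (J - {i})"] exI[of _ "N {i}"]) auto
qed

lemma complex_sum_empty: "\<not> indecomposable_complex R (complex_sum {} X)"
  by (simp add: indecomposable_complex_def complex_sum_simps restrict_def)

text \<open>
  A sum with one summand consists of functions on a set with one element. It is isomorphic to the
  summand by sending \<open>x\<close> to the constant function \<open>x\<close>, which preserves all quantities of interest.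
\<close>

lemma complex_sum_singleton:
  fixes X :: "'i \<Rightarrow> ('a, 'b) cyclic_complex"
  assumes "complex_over R (X i)"
  shows "complex_over R (complex_sum {i} X)"
    "card (carrier (fst (complex_sum {i} X))) = card (carrier (fst (X i)))"
    "cycles_card (complex_sum {i} X) e = cycles_card (X i) e"
    "boundaries_card (complex_sum {i} X) e = boundaries_card (X i) e"
    "acyclic_complex (X i) \<Longrightarrow> acyclic_complex (complex_sum {i} X)"
proof -
  note Xd = complex_overD[OF assms]
  interpret X: left_module R "fst (X i)" by (rule Xd(1))
  let ?S = "complex_sum {i} X"
  define \<beta> where "\<beta> x = (\<lambda>j\<in>{i}. x)" for x :: 'b
  have inj: "inj_on \<beta> A" for A by (rule inj_onI) (auto simp: \<beta>_def dest: fun_cong[of _ _ i])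
  have car: "carrier (fst ?S) = \<beta> ` carrier (fst (X i))"
  proof (intro equalityI subsetI)
    fix x assume "x \<in> carrier (fst ?S)"
    then have "x i \<in> carrier (fst (X i))" "x \<in> extensional {i}" by (auto simp: complex_sum_simps PiE_def)
    moreover then have "x = \<beta> (x i)" by (auto simp: \<beta>_def extensional_def fun_eq_iff)
    ultimately show "x \<in> \<beta> ` carrier (fst (X i))" by blast
  next
    fix x assume "x \<in> \<beta> ` carrier (fst (X i))"
    then show "x \<in> carrier (fst ?S)" by (auto simp: complex_sum_simps \<beta>_def PiE_iff)
  qed
  have ops: "\<zero>\<^bsub>fst ?S\<^esub> = \<beta> \<zero>\<^bsub>fst (X i)\<^esub>" "\<beta> x \<oplus>\<^bsub>fst ?S\<^esub> \<beta> y = \<beta> (x \<oplus>\<^bsub>fst (X i)\<^esub> y)"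
    "a \<odot>\<^bsub>fst ?S\<^esub> \<beta> x = \<beta> (a \<odot>\<^bsub>fst (X i)\<^esub> x)" "snd ?S (\<beta> x) = \<beta> (snd (X i) x)" for x y a
    by (auto simp: complex_sum_simps \<beta>_def fun_eq_iff)
  have \<beta>_eq: "\<beta> x = \<beta> y \<longleftrightarrow> x = y" for x y using inj[of UNIV] by (auto dest: inj_onD)
  show "complex_over R ?S"
    unfolding complex_over_def car using left_module_complex_sum[OF X.R.ring_axioms, of "{i}" X] Xd(1)
    by (simp add: ops Xd(2-6))
  show "card (carrier (fst ?S)) = card (carrier (fst (X i)))" unfolding car by (rule card_image[OF inj])
  have fx: "fixed (fst ?S) e = \<beta> ` fixed (fst (X i)) e"
    unfolding fixed_def car by (auto simp: ops \<beta>_eq)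
  have "{x \<in> fixed (fst ?S) e. snd ?S x = \<zero>\<^bsub>fst ?S\<^esub>} = \<beta> ` {x \<in> fixed (fst (X i)) e. snd (X i) x = \<zero>\<^bsub>fst (X i)\<^esub>}"
    unfolding fx by (auto simp: ops \<beta>_eq)
  then show "cycles_card ?S e = cycles_card (X i) e"
    unfolding cycles_card_def by (simp add: card_image[OF inj])
  have "snd ?S ` fixed (fst ?S) e = \<beta> ` snd (X i) ` fixed (fst (X i)) e"
    unfolding fx by (simp add: image_image ops)
  then show "boundaries_card ?S e = boundaries_card (X i) e"
    unfolding boundaries_card_def by (simp add: card_image[OF inj])
  show "acyclic_complex ?S" if "acyclic_complex (X i)"
  proof -
    have "mod_ker (fst ?S) (fst ?S) (snd ?S) = \<beta> ` mod_ker (fst (X i)) (fst (X i)) (snd (X i))"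
      unfolding mod_ker_def car by (auto simp: ops \<beta>_eq)
    also have "\<dots> = \<beta> ` snd (X i) ` carrier (fst (X i))" using that by (simp add: acyclic_complex_def)
    also have "\<dots> = snd ?S ` carrier (fst ?S)" unfolding car by (simp add: image_image ops)
    finally show ?thesis by (simp add: acyclic_complex_def)
  qed
qed

section \<open>The complexes of modules and of projective modules\<close>

lemma fixed_mod_sum: "fixed (mod_sum M N) e = fixed M e \<times> fixed N e"
  by (auto simp: fixed_def)

text \<open>
  The cycles of \<open>C\<^sub>M\<close> are the projective cover \<open>P\<close>, the boundaries are \<open>\<Omega>\<close>, and \<open>P / \<Omega>\<close> is \<open>M\<close>. So the second
  part says that the homology of \<open>C\<^sub>M\<close> is \<open>M\<close>.
\<close>

lemma complex_C_props:
  assumes M: "left_module R M" and fin: "finite (carrier R)" "finite (carrier M)"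
  shows "complex_over R (complex_C R M)"
    "e \<in> carrier R \<Longrightarrow> e \<otimes>\<^bsub>R\<^esub> e = e \<Longrightarrow>
      cycles_card (complex_C R M) e = card (fixed M e) * boundaries_card (complex_C R M) e"
    "carrier M \<noteq> {\<zero>\<^bsub>M\<^esub>} \<Longrightarrow> carrier (fst (complex_C R M)) \<noteq> {\<zero>\<^bsub>fst (complex_C R M)\<^esub>}"
proof -
  obtain P p where Pp: "proj_cover R M = (P, p)" "left_module R P" "finite (carrier P)" 
    "p \<in> mod_hom R P M" "p ` carrier P = carrier M"
    by (rule proj_cover[OF assms])
  interpret M: left_module R M by fact
  interpret P: left_module R P by fact
  let ?\<Omega> = "P\<lparr>carrier := mod_ker P M p\<rparr>"
  have sub: "submodule (mod_ker P M p) R P" by (rule submodule_ker[OF Pp(4,2) M])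
  interpret O: left_module R ?\<Omega> by (rule P.left_module_submodule[OF sub])
  note \<Omega> = P.submoduleD[OF sub]
  have C: "complex_C R M = (mod_sum P ?\<Omega>, \<lambda>(x, w). (w, \<zero>\<^bsub>P\<^esub>))"
    by (simp add: complex_C_def Pp(1))
  have fO: "finite (mod_ker P M p)" using Pp(3) \<Omega>(1) by (rule rev_finite_subset)
  show "complex_over R (complex_C R M)"
    unfolding complex_over_def C
    using left_module_mod_sum[OF Pp(2) O.left_module_axioms] Pp(3) fO \<Omega> by auto
  show "carrier (fst (complex_C R M)) \<noteq> {\<zero>\<^bsub>fst (complex_C R M)\<^esub>}" if nz: "carrier M \<noteq> {\<zero>\<^bsub>M\<^esub>}"
  proof -
    obtain y where y: "y \<in> carrier M" "y \<noteq> \<zero>\<^bsub>M\<^esub>" using nz M.zero_closed by blast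
    obtain x where x: "x \<in> carrier P" "y = p x" using y(1) Pp(5) by blast
    have "x \<noteq> \<zero>\<^bsub>P\<^esub>" using mod_hom_zero[OF Pp(4,2) M] x y by auto
    then show ?thesis unfolding C using x(1) \<Omega>(2) by auto
  qed
  assume e: "e \<in> carrier R" "e \<otimes>\<^bsub>R\<^esub> e = e"
  have "{x \<in> fixed (mod_sum P ?\<Omega>) e. (case x of (x, w) \<Rightarrow> (w, \<zero>\<^bsub>P\<^esub>)) = \<zero>\<^bsub>mod_sum P ?\<Omega>\<^esub>} = fixed P e \<times> {\<zero>\<^bsub>P\<^esub>}"
    using \<Omega>(2) e by (auto simp: fixed_mod_sum fixed_def)
  then have 1: "cycles_card (complex_C R M) e = card (fixed P e)"
    unfolding cycles_card_def C by (simp add: card_cartesian_product)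
  have "(\<lambda>(x, w). (w, \<zero>\<^bsub>P\<^esub>)) ` fixed (mod_sum P ?\<Omega>) e = fixed ?\<Omega> e \<times> {\<zero>\<^bsub>P\<^esub>}"
  proof -
    have "\<zero>\<^bsub>P\<^esub> \<in> fixed P e" using e by (simp add: fixed_def)
    then show ?thesis by (force simp: fixed_mod_sum)
  qed
  then have 2: "boundaries_card (complex_C R M) e = card (fixed ?\<Omega> e)"
    unfolding boundaries_card_def C by (simp add: card_cartesian_product)
  have "card (fixed P e) = card (p ` fixed P e) * card {x \<in> fixed P e. p x = \<zero>\<^bsub>M\<^esub>}"
    by (rule card_eq_image_kernel[OF P.M.abelian_group_axioms M.M.abelian_group_axioms fixed_subgroup[OF Pp(2) e(1)]])
      (simp_all add: fixed_def Pp(3) mod_homD(2,3)[OF Pp(4)])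
  also have "{x \<in> fixed P e. p x = \<zero>\<^bsub>M\<^esub>} = fixed ?\<Omega> e" by (auto simp: fixed_def mod_ker_def)
  also have "p ` fixed P e = fixed M e"
  proof (intro equalityI subsetI)
    fix y assume "y \<in> p ` fixed P e"
    then obtain x where x: "x \<in> carrier P" "e \<odot>\<^bsub>P\<^esub> x = x" "y = p x" by (auto simp: fixed_def)
    then show "y \<in> fixed M e" using mod_homD(2)[OF Pp(4) x(1)] mod_homD(4)[OF Pp(4) e(1) x(1)] by (simp add: fixed_def)
  next
    fix y assume "y \<in> fixed M e"
    then have y: "y \<in> carrier M" "e \<odot>\<^bsub>M\<^esub> y = y" by (auto simp: fixed_def)
    then obtain x where x: "x \<in> carrier P" "y = p x" using Pp(5) by blast
    have "y = p (e \<odot>\<^bsub>P\<^esub> x)" using mod_homD(4)[OF Pp(4) e(1) x(1)] x y by simp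
    moreover have "e \<odot>\<^bsub>P\<^esub> x \<in> fixed P e"
      using P.smult_assoc[OF e(1) e(1) x(1)] e x(1) by (simp add: fixed_def P.smult_closed)
    ultimately show "y \<in> p ` fixed P e" by blast
  qed
  finally show "cycles_card (complex_C R M) e = card (fixed M e) * boundaries_card (complex_C R M) e"
    unfolding 1 2 .
qed

lemma complex_K_props:
  assumes P: "left_module R P" and fin: "finite (carrier P)"
  shows "complex_over R (complex_K P)" "acyclic_complex (complex_K P)"
    "carrier P \<noteq> {\<zero>\<^bsub>P\<^esub>} \<Longrightarrow> carrier (fst (complex_K P)) \<noteq> {\<zero>\<^bsub>fst (complex_K P)\<^esub>}"
proof -
  interpret P: left_module R P by fact
  show "complex_over R (complex_K P)"
    unfolding complex_over_def complex_K_def using left_module_mod_sum[OF P P] fin by auto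
  show "acyclic_complex (complex_K P)"
    unfolding acyclic_complex_def complex_K_def mod_ker_def by force
  show "carrier (fst (complex_K P)) \<noteq> {\<zero>\<^bsub>fst (complex_K P)\<^esub>}" if nz: "carrier P \<noteq> {\<zero>\<^bsub>P\<^esub>}"
  proof -
    obtain x where "x \<in> carrier P" "x \<noteq> \<zero>\<^bsub>P\<^esub>" using nz P.zero_closed by blast
    then have "(x, x) \<in> carrier (fst (complex_K P))" "(x, x) \<noteq> \<zero>\<^bsub>fst (complex_K P)\<^esub>" by (simp_all add: complex_K_def)
    then show ?thesis by blast
  qed
qed

section \<open>Indecomposable classes\<close>

text \<open>
  The names of the indecomposable complexes: \<open>Inl \<alpha>\<close> stands for \<open>C\<^sub>M\<close> and \<open>Inr i\<close> for \<open>K\<^sub>P\<close>.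
\<close>

abbreviation labels :: "(nat, 'e) pre_digraph \<Rightarrow> ((nat \<Rightarrow> int) + nat) set" where
  "labels Q \<equiv> Sum_Type.Plus (positive_roots Q) (verts Q)"

definition summand :: "(nat, 'e) pre_digraph \<Rightarrow> int ring \<Rightarrow> ((nat \<Rightarrow> int) + nat) \<times> nat \<Rightarrow> 
    (nat \<times> 'e list \<Rightarrow> int, int \<times> int) cyclic_complex" where
  "summand Q K = (\<lambda>(x, k). case x of
     Inl \<alpha> \<Rightarrow> complex_C (path_algebra Q K) (module_of_root Q K \<alpha>)
   | Inr i \<Rightarrow> complex_K (projective_at Q K i))"

definition indicator_index :: "(nat \<Rightarrow> int) + nat \<Rightarrow> hall_index" where
  "indicator_index x = (\<lambda>y. if y = x then 1 else 0)"

lemma complex_of_index_eq: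
  "complex_of_index Q K \<kappa> = complex_sum {(x, k). x \<in> labels Q \<and> k < \<kappa> x} (summand Q K)"
  by (simp add: complex_of_index_def summand_def)

lemma complex_of_indicator_index:
  assumes "x \<in> labels Q"
  shows "complex_of_index Q K (indicator_index x) = complex_sum {(x, 0)} (summand Q K)"
proof -
  have "{(y, k). y \<in> labels Q \<and> k < indicator_index x y} = {(x, 0)}"
    using assms by (auto simp: indicator_index_def split: if_splits)
  then show ?thesis by (simp add: complex_of_index_eq)
qed

lemma module_of_root:
  assumes "dynkin_quiver Q" "finite_field K" "\<alpha> \<in> positive_roots Q"
  shows "indecomposable_module (path_algebra Q K) (module_of_root Q K \<alpha>)"
    "has_dimension_vector Q K (module_of_root Q K \<alpha>) \<alpha>"
  using someI_ex[OF exists_indecomposable_of_root[OF assms]] by (auto simp: module_of_root_def)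

lemma summand_root:
  assumes Q: "dynkin_quiver Q" and K: "finite_field K" and \<alpha>: "\<alpha> \<in> positive_roots Q"
  shows "complex_over (path_algebra Q K) (summand Q K (Inl \<alpha>, k))"
    "carrier (fst (summand Q K (Inl \<alpha>, k))) \<noteq> {\<zero>\<^bsub>fst (summand Q K (Inl \<alpha>, k))\<^esub>}"
    "i \<in> verts Q \<Longrightarrow> cycles_card (summand Q K (Inl \<alpha>, k)) (vertex_idempotent K i) =
      card (carrier K) ^ nat (\<alpha> i) * boundaries_card (summand Q K (Inl \<alpha>, k)) (vertex_idempotent K i)"
proof -
  interpret path_alg Q K by (rule dynkin_path_alg[OF Q K])
  let ?M = "module_of_root Q K \<alpha>"
  have M: "left_module A ?M" "carrier ?M \<noteq> {\<zero>\<^bsub>?M\<^esub>}" "finite (carrier ?M)"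
    and dim: "\<And>i. i \<in> verts Q \<Longrightarrow> card ((\<lambda>x. idem i \<odot>\<^bsub>?M\<^esub> x) ` carrier ?M) = card (carrier K) ^ nat (\<alpha> i)"
    using module_of_root[OF assms] by (auto simp: indecomposable_module_def has_dimension_vector_iff)
  note C = complex_C_props[OF M(1) A_finite M(3)]
  show "complex_over A (summand Q K (Inl \<alpha>, k))"
    "carrier (fst (summand Q K (Inl \<alpha>, k))) \<noteq> {\<zero>\<^bsub>fst (summand Q K (Inl \<alpha>, k))\<^esub>}"
    using C(1) C(3)[OF M(2)] by (simp_all add: summand_def)
  show "cycles_card (summand Q K (Inl \<alpha>, k)) (vertex_idempotent K i) =
      card (carrier K) ^ nat (\<alpha> i) * boundaries_card (summand Q K (Inl \<alpha>, k)) (vertex_idempotent K i)" if i: "i \<in> verts Q"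
  proof -
    have "fixed ?M (idem i) = (\<lambda>x. idem i \<odot>\<^bsub>?M\<^esub> x) ` carrier ?M"
      unfolding idem_image[OF M(1) i submodule_carrier[OF M(1)]] by (simp add: fixed_def)
    then show ?thesis
      using C(2)[of "idem i"] i dim[OF i] by (simp add: summand_def vertex_idempotent_eq idem_A mon_mult)
  qed
qed

lemma summand_vertex:
  fixes Q :: "(nat, 'e) pre_digraph"
  assumes Q: "dynkin_quiver Q" and K: "finite_field K" and i: "i \<in> verts Q"
  shows "complex_over (path_algebra Q K) (summand Q K (Inr i, k))"
    "carrier (fst (summand Q K (Inr i, k))) \<noteq> {\<zero>\<^bsub>fst (summand Q K (Inr i, k))\<^esub>}"
    "acyclic_complex (summand Q K (Inr i, k))"
proof -
  interpret path_alg Q K by (rule dynkin_path_alg[OF Q K])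
  let ?S = "simple_module K i :: (nat \<times> 'e list \<Rightarrow> int, int) module"
  have S: "left_module A ?S" by (rule left_module_simple[OF i])
  have fS: "finite (carrier ?S)" by (simp add: fin_K)
  obtain P p where Pp: "proj_cover A ?S = (P, p)" "left_module A P" "finite (carrier P)" 
    "p \<in> mod_hom A P ?S" "p ` carrier P = carrier ?S"
    by (rule proj_cover[OF S A_finite fS]) (rule that)
  have "carrier P \<noteq> {\<zero>\<^bsub>P\<^esub>}"
  proof
    assume "carrier P = {\<zero>\<^bsub>P\<^esub>}"
    then have "carrier K = {\<zero>\<^bsub>K\<^esub>}" using Pp(5) mod_hom_zero[OF Pp(4,2) S] by simp
    then show False using K.one_closed K.one_not_zero by auto
  qed
  then show "complex_over A (summand Q K (Inr i, k))"
    "carrier (fst (summand Q K (Inr i, k))) \<noteq> {\<zero>\<^bsub>fst (summand Q K (Inr i, k))\<^esub>}"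
    "acyclic_complex (summand Q K (Inr i, k))"
    using complex_K_props[OF Pp(2,3)] by (simp_all add: summand_def projective_at_def Pp(1))
qed

lemma summand_props:
  assumes Q: "dynkin_quiver Q" and K: "finite_field K" and x: "x \<in> labels Q"
  shows "complex_over (path_algebra Q K) (summand Q K (x, k))"
    "carrier (fst (summand Q K (x, k))) \<noteq> {\<zero>\<^bsub>fst (summand Q K (x, k))\<^esub>}"
  using x summand_root[OF Q K] summand_vertex[OF Q K] by (cases x; auto)+

lemma finite_field_prime:
  assumes "prime p"
  shows "finite_field (residue_ring (int p))" "card (carrier (residue_ring (int p))) = p"
proof -
  interpret residues_prime p "residue_ring (int p)" by (simp_all add: residues_prime_def assms)
  show "finite_field (residue_ring (int p))" using is_field by (simp add: finite_field_def residue_ring_def)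
  show "card (carrier (residue_ring (int p))) = p" by (simp add: residue_ring_def)
qed

text \<open>
  The complex of \<open>\<kappa>\<close> is a sum of nonzero complexes, so over a single field, here the one with two
  elements, indecomposability already leaves room for only one summand.
\<close>

lemma indecomposable_index:
  assumes Q: "dynkin_quiver Q" and \<kappa>: "\<kappa> \<in> indecomposable_indices Q"
  obtains x where "x \<in> labels Q" "\<kappa> = indicator_index x"
proof -
  define K where "K = residue_ring (int 2)"
  have K: "finite_field K" unfolding K_def by (rule finite_field_prime) simp
  interpret path_alg Q K by (rule dynkin_path_alg[OF Q K])
  let ?J = "{(x, k). x \<in> labels Q \<and> k < \<kappa> x}"
  have ind: "indecomposable_complex A (complex_sum ?J (summand Q K))"
    using \<kappa> K by (auto simp: indecomposable_indices_def complex_of_index_eq)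
  have X: "complex_over A (summand Q K j)" "carrier (fst (summand Q K j)) \<noteq> {\<zero>\<^bsub>fst (summand Q K j)\<^esub>}" if j: "j \<in> ?J" for j
  proof -
    obtain y k where yk: "j = (y, k)" by fastforce
    then have "y \<in> labels Q" using j by blast
    then show "complex_over A (summand Q K j)" "carrier (fst (summand Q K j)) \<noteq> {\<zero>\<^bsub>fst (summand Q K j)\<^esub>}"
      unfolding yk by (rule summand_props[OF Q K])+
  qed
  have single: "i = j" if "i \<in> ?J" "j \<in> ?J" for i j
    using complex_sum_decomposes[OF A_ring X(1) that _ X(2)[OF that(1)] X(2)[OF that(2)]] ind
    by (auto simp: indecomposable_complex_def)
  have "?J \<noteq> {}" using ind complex_sum_empty by metis
  then obtain x k where xk: "x \<in> labels Q" "k < \<kappa> x" by blast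
  have "\<kappa> y = indicator_index x y" for y
  proof (cases "y \<in> labels Q")
    case True
    have "\<kappa> x = 1"
    proof (rule ccontr)
      assume "\<kappa> x \<noteq> 1"
      then have "(x, 0) \<in> ?J" "(x, 1) \<in> ?J" using xk by auto
      then show False using single by fastforce
    qed
    moreover have "\<kappa> y = 0" if "y \<noteq> x"
    proof (rule ccontr)
      assume "\<kappa> y \<noteq> 0"
      then have "(y, 0) \<in> ?J" "(x, k) \<in> ?J" using True xk by auto
      then show False using single that by fastforce
    qed
    ultimately show ?thesis by (simp add: indicator_index_def)
  next
    case False
    then have "\<kappa> y = 0" using \<kappa> by (auto simp: indecomposable_indices_def hall_indices_def)
    then show ?thesis using False xk by (auto simp: indicator_index_def)
  qed
  then show ?thesis using that[OF xk(1)] by blast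
qed

lemma root_nonzero:
  assumes Q: "dynkin_quiver Q" and \<alpha>: "\<alpha> \<in> positive_roots Q"
  shows "\<exists>i\<in>verts Q. \<alpha> i \<noteq> 0"
proof (rule ccontr)
  assume "\<not> ?thesis"
  then have "euler_form Q \<alpha> \<alpha> = euler_form Q (\<lambda>_. 0) (\<lambda>_. 0)"
    by (intro euler_form_cong[OF dynkin_quiver_facts(1)[OF Q]]) auto
  then show False using tits_root[OF Q, of \<alpha>] \<alpha> by (simp add: euler_form_def positive_roots_def)
qed

lemma index_complex:
  assumes Q: "dynkin_quiver Q" and K: "finite_field K" and x: "x \<in> labels Q"
  shows "complex_over (path_algebra Q K) (complex_of_index Q K (indicator_index x))"
    "2 \<le> card (carrier (fst (complex_of_index Q K (indicator_index x))))"
proof -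
  note S = summand_props[OF Q K x, of 0]
  note c = complex_sum_singleton[where X = "summand Q K" and i = "(x, 0)", OF S(1)]
  show 1: "complex_over (path_algebra Q K) (complex_of_index Q K (indicator_index x))"
    unfolding complex_of_indicator_index[OF x] by (rule c(1))
  let ?X = "fst (summand Q K (x, 0))"
  interpret X: left_module "path_algebra Q K" ?X by (rule complex_overD(1)[OF S(1)])
  obtain y where y: "y \<in> carrier ?X" "y \<noteq> \<zero>\<^bsub>?X\<^esub>" using S(2) X.M.zero_closed by blast
  have "card {y, \<zero>\<^bsub>?X\<^esub>} \<le> card (carrier ?X)"
    by (rule card_mono[OF complex_overD(2)[OF S(1)]]) (use y in auto)
  then show "2 \<le> card (carrier (fst (complex_of_index Q K (indicator_index x))))"
    unfolding complex_of_indicator_index[OF x] c(2) using y by simp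
qed

lemma root_index_cards:
  assumes Q: "dynkin_quiver Q" and K: "finite_field K" and \<alpha>: "\<alpha> \<in> positive_roots Q" and i: "i \<in> verts Q"
  shows "cycles_card (complex_of_index Q K (indicator_index (Inl \<alpha>))) (vertex_idempotent K i) =
      card (carrier K) ^ nat (\<alpha> i) * boundaries_card (complex_of_index Q K (indicator_index (Inl \<alpha>))) (vertex_idempotent K i)"
proof -
  have x: "Inl \<alpha> \<in> labels Q" using \<alpha> by blast
  note c = complex_sum_singleton[where X = "summand Q K" and i = "(Inl \<alpha>, 0)", OF summand_root(1)[OF Q K \<alpha>, of 0]]
  show ?thesis unfolding complex_of_indicator_index[OF x] c(3,4) by (rule summand_root(3)[OF Q K \<alpha> i])
qed

text \<open>
  The homology is the module of \<open>\<alpha>\<close>, which is nonzero at some vertex.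
\<close>

lemma root_index_not_acyclic:
  assumes Q: "dynkin_quiver Q" and K: "finite_field K" and \<alpha>: "\<alpha> \<in> positive_roots Q"
  shows "\<not> acyclic_complex (complex_of_index Q K (indicator_index (Inl \<alpha>)))"
proof
  let ?X = "complex_of_index Q K (indicator_index (Inl \<alpha>))"
  assume ac: "acyclic_complex ?X"
  interpret path_alg Q K by (rule dynkin_path_alg[OF Q K])
  obtain i where i: "i \<in> verts Q" "\<alpha> i \<noteq> 0" using root_nonzero[OF Q \<alpha>] by blast
  have x: "Inl \<alpha> \<in> labels Q" using \<alpha> by blast
  note X = index_complex(1)[OF Q K x]
  have e: "idem i \<in> carrier A" "idem i \<otimes>\<^bsub>A\<^esub> idem i = idem i" using i by (simp_all add: idem_A mon_mult)
  have "cycles_card ?X (idem i) = boundaries_card ?X (idem i)" by (rule acyclic_cards[OF X e ac])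
  then have "card (carrier K) ^ nat (\<alpha> i) = 1"
    using root_index_cards[OF Q K \<alpha> i(1)] boundaries_card_pos[OF X e(1)] by (simp add: vertex_idempotent_eq)
  then have "nat (\<alpha> i) = 0" using q_gt_1 by (metis one_less_power neq0_conv less_irrefl)
  moreover have "0 \<le> \<alpha> i" using \<alpha> by (simp add: positive_roots_def)
  ultimately show False using i(2) by simp
qed

lemma vertex_index_acyclic:
  assumes Q: "dynkin_quiver Q" and K: "finite_field K" and i: "i \<in> verts Q"
  shows "acyclic_complex (complex_of_index Q K (indicator_index (Inr i)))"
proof -
  have x: "Inr i \<in> labels Q" using i by blast
  show ?thesis unfolding complex_of_indicator_index[OF x]
    by (rule complex_sum_singleton(5)[where X = "summand Q K" and i = "(Inr i, 0)", OF summand_vertex(1,3)[OF Q K i]])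
qed

text \<open>
  By this equivalence the classes of \<open>n_tilde_plus\<close> are labelled by roots, which makes them finite in
  number.
\<close>

lemma nonacyclic_index:
  assumes Q: "dynkin_quiver Q"
  shows "\<kappa> \<in> nonacyclic_indices Q \<longleftrightarrow>
    \<kappa> \<in> indecomposable_indices Q \<and> (\<exists>\<alpha>\<in>positive_roots Q. \<kappa> = indicator_index (Inl \<alpha>))"
proof
  assume \<kappa>: "\<kappa> \<in> nonacyclic_indices Q"
  then have ind: "\<kappa> \<in> indecomposable_indices Q" by (simp add: nonacyclic_indices_def)
  obtain x where x: "x \<in> labels Q" "\<kappa> = indicator_index x"
    by (rule indecomposable_index[OF Q ind])
  have K: "finite_field (residue_ring (int 2))" by (rule finite_field_prime) simp
  have "\<not> acyclic_complex (complex_of_index Q (residue_ring (int 2)) \<kappa>)"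
    using \<kappa> K by (auto simp: nonacyclic_indices_def)
  then have "x \<notin> range Inr" using x vertex_index_acyclic[OF Q K] by auto
  then show "\<kappa> \<in> indecomposable_indices Q \<and> (\<exists>\<alpha>\<in>positive_roots Q. \<kappa> = indicator_index (Inl \<alpha>))"
    using ind x by auto
next
  assume "\<kappa> \<in> indecomposable_indices Q \<and> (\<exists>\<alpha>\<in>positive_roots Q. \<kappa> = indicator_index (Inl \<alpha>))"
  then show "\<kappa> \<in> nonacyclic_indices Q"
    using root_index_not_acyclic[OF Q] by (auto simp: nonacyclic_indices_def)
qed

lemma finite_nonacyclic_indices:
  assumes Q: "dynkin_quiver Q"
  shows "finite (nonacyclic_indices Q)"
proof (rule finite_subset)
  show "nonacyclic_indices Q \<subseteq> (\<lambda>\<alpha>. indicator_index (Inl \<alpha>)) ` positive_roots Q"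
    using nonacyclic_index[OF Q] by blast
  show "finite ((\<lambda>\<alpha>. indicator_index (Inl \<alpha>)) ` positive_roots Q)"
    using finite_roots[OF Q] by (simp add: positive_roots_def)
qed

section \<open>Hall polynomials and structure constants\<close>

text \<open>
  Two such polynomials agree at all primes, since every prime is the order of a finite field.
\<close>

lemma hall_polynomial_unique:
  assumes "is_hall_polynomial Q \<mu> \<nu> \<kappa> \<psi>" "is_hall_polynomial Q \<mu> \<nu> \<kappa> \<psi>'"
  shows "\<psi> = \<psi>'"
proof (rule ccontr)
  assume "\<psi> \<noteq> \<psi>'"
  then have "finite {x. poly (\<psi> - \<psi>') x = 0}" by (intro poly_roots_finite) simp
  moreover have "int ` {p :: nat. prime p} \<subseteq> {x. poly (\<psi> - \<psi>') x = 0}"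
  proof (rule image_subsetI)
    fix p :: nat assume "p \<in> {p. prime p}"
    then have "prime p" by simp
    note K = finite_field_prime[OF this]
    have "(of_int (poly \<psi> (int p)) :: rat) = of_int (poly \<psi>' (int p))"
      using assms[unfolded is_hall_polynomial_def, rule_format, OF K(1)] unfolding K(2) by simp
    then show "int p \<in> {x. poly (\<psi> - \<psi>') x = 0}" by simp
  qed
  ultimately have "finite (int ` {p :: nat. prime p})" by (rule rev_finite_subset)
  then have "finite {p :: nat. prime p}" by (rule finite_imageD) simp
  then show False using primes_infinite by simp
qed

lemma hall_polynomial_nonzero:
  assumes "hall_polynomial Q \<mu> \<nu> \<kappa> \<noteq> 0"
  shows "is_hall_polynomial Q \<mu> \<nu> \<kappa> (hall_polynomial Q \<mu> \<nu> \<kappa>)"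
proof -
  have "\<exists>\<psi>. is_hall_polynomial Q \<mu> \<nu> \<kappa> \<psi>" using assms by (auto simp: hall_polynomial_def split: if_splits)
  moreover then have "\<exists>!\<psi>. is_hall_polynomial Q \<mu> \<nu> \<kappa> \<psi>" using hall_polynomial_unique by blast
  ultimately show ?thesis using theI'[of "is_hall_polynomial Q \<mu> \<nu> \<kappa>"] by (simp add: hall_polynomial_def)
qed

lemma conflation_of_hall_polynomial:
  assumes "poly (hall_polynomial Q \<mu> \<nu> \<kappa>) (int (card (carrier K))) \<noteq> 0" "finite_field K"
  obtains f g where "(f, g) \<in> conflations (path_algebra Q K) (complex_of_index Q K \<nu>) 
    (complex_of_index Q K \<kappa>) (complex_of_index Q K \<mu>)"
proof -
  have "hall_polynomial Q \<mu> \<nu> \<kappa> \<noteq> 0" using assms(1) by auto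
  from hall_polynomial_nonzero[OF this, unfolded is_hall_polynomial_def, rule_format, OF assms(2)]
  have "hall_number (path_algebra Q K) (complex_of_index Q K \<mu>) (complex_of_index Q K \<nu>) (complex_of_index Q K \<kappa>) \<noteq> 0"
    using assms(1) by (metis of_int_eq_0_iff)
  then have "card (conflations (path_algebra Q K) (complex_of_index Q K \<nu>) (complex_of_index Q K \<kappa>) (complex_of_index Q K \<mu>)) \<noteq> 0"
    by (auto simp: hall_number_def)
  then have "conflations (path_algebra Q K) (complex_of_index Q K \<nu>) (complex_of_index Q K \<kappa>) (complex_of_index Q K \<mu>) \<noteq> {}"
    by auto
  then show ?thesis using that by fastforce
qed

text \<open>
  The polynomials have only finitely many roots altogether, so some prime avoids them.
\<close>

lemma exists_good_field:
  assumes "finite \<Psi>" "0 \<notin> \<Psi>"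
  obtains K where "finite_field K" "\<And>\<psi> :: int poly. \<psi> \<in> \<Psi> \<Longrightarrow> poly \<psi> (int (card (carrier K))) \<noteq> 0"
proof -
  let ?B = "\<Union>\<psi>\<in>\<Psi>. {x. poly \<psi> x = 0}"
  have "finite ?B" using assms by (intro finite_UN_I poly_roots_finite) auto
  then have "finite (int -` ?B)" by (rule finite_vimageI) simp
  then obtain p where p: "prime p" "int p \<notin> ?B"
    using primes_infinite by (metis (no_types, lifting) finite_subset mem_Collect_eq subsetI vimageI2)
  show ?thesis
    by (rule that[OF finite_field_prime(1)[OF p(1)]]) (use p(2) finite_field_prime(2)[OF p(1)] in auto)
qed

text \<open>
  The homologies of the two ends have \<open>q\<close> to the power \<open>\<alpha> j\<close> and \<open>q\<close> to the power \<open>\<beta> j\<close> elements at the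
  vertex \<open>j\<close>, and an acyclic middle term identifies them.
\<close>

lemma equal_roots_of_acyclic_middle:
  assumes Q: "dynkin_quiver Q" and K: "finite_field K" 
    and \<alpha>: "\<alpha> \<in> positive_roots Q" and \<beta>: "\<beta> \<in> positive_roots Q" and i: "i \<in> verts Q"
    and c: "(f, g) \<in> conflations (path_algebra Q K) (complex_of_index Q K (indicator_index (Inl \<beta>))) 
    (complex_of_index Q K (indicator_index (Inr i))) (complex_of_index Q K (indicator_index (Inl \<alpha>)))"
  shows "\<alpha> = \<beta>"
proof
  interpret path_alg Q K by (rule dynkin_path_alg[OF Q K])
  fix j
  have x: "Inl \<alpha> \<in> labels Q" "Inl \<beta> \<in> labels Q" "Inr i \<in> labels Q"
    using \<alpha> \<beta> i by auto
  note X = index_complex(1)[OF Q K x(1)] and Y = index_complex(1)[OF Q K x(2)] and Z = index_complex(1)[OF Q K x(3)]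
  show "\<alpha> j = \<beta> j"
  proof (cases "j \<in> verts Q")
    case True
    have e: "idem j \<in> carrier A" "idem j \<otimes>\<^bsub>A\<^esub> idem j = idem j" using True by (simp_all add: idem_A mon_mult)
    have "card (carrier K) ^ nat (\<alpha> j) = card (carrier K) ^ nat (\<beta> j)"
      using conflation_acyclic_middle[OF Y Z X c e vertex_index_acyclic[OF Q K i]]
        root_index_cards[OF Q K \<alpha> True] root_index_cards[OF Q K \<beta> True]
        boundaries_card_pos[OF X e(1)] boundaries_card_pos[OF Y e(1)] 
      by (simp add: vertex_idempotent_eq)
    then have "nat (\<alpha> j) = nat (\<beta> j)" using q_gt_1 power_inject_exp by blast
    moreover have "0 \<le> \<alpha> j" "0 \<le> \<beta> j" using \<alpha> \<beta> by (simp_all add: positive_roots_def)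
    ultimately show ?thesis by simp
  next
    case False
    then show ?thesis using root_support[of \<alpha> Q j] root_support[of \<beta> Q j] \<alpha> \<beta> by (simp add: positive_roots_def)
  qed
qed

text \<open>
  If \<open>\<kappa>\<close> were acyclic, the conflations behind the structure constant would force \<open>\<mu> = \<nu>\<close>, and then the two
  terms of the structure constant cancel.
\<close>

lemma structure_constant_nonacyclic:
  assumes Q: "dynkin_quiver Q" and \<mu>: "\<mu> \<in> nonacyclic_indices Q" and \<nu>: "\<nu> \<in> nonacyclic_indices Q"
    and \<kappa>: "\<kappa> \<in> indecomposable_indices Q" and sc: "structure_constant Q \<mu> \<nu> \<kappa> \<noteq> 0"
  shows "\<kappa> \<in> nonacyclic_indices Q"
proof (rule ccontr)
  assume na: "\<kappa> \<notin> nonacyclic_indices Q"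
  obtain x where x: "x \<in> labels Q" "\<kappa> = indicator_index x"
    by (rule indecomposable_index[OF Q \<kappa>])
  then obtain i where i: "i \<in> verts Q" "\<kappa> = indicator_index (Inr i)"
    using na \<kappa> nonacyclic_index[OF Q] by (cases x) auto
  obtain \<alpha> where \<alpha>: "\<alpha> \<in> positive_roots Q" "\<mu> = indicator_index (Inl \<alpha>)" using \<mu> nonacyclic_index[OF Q] by blast
  obtain \<beta> where \<beta>: "\<beta> \<in> positive_roots Q" "\<nu> = indicator_index (Inl \<beta>)" using \<nu> nonacyclic_index[OF Q] by blast
  have eq: "\<alpha>' = \<beta>'" if h: "hall_polynomial Q (indicator_index (Inl \<alpha>')) (indicator_index (Inl \<beta>')) \<kappa> \<noteq> 0"
    "\<alpha>' \<in> positive_roots Q" "\<beta>' \<in> positive_roots Q" for \<alpha>' \<beta>'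
  proof -
    let ?\<psi> = "hall_polynomial Q (indicator_index (Inl \<alpha>')) (indicator_index (Inl \<beta>')) \<kappa>"
    obtain K where K: "finite_field K" "poly ?\<psi> (int (card (carrier K))) \<noteq> 0"
      using exists_good_field[of "{?\<psi>}"] h(1) by auto
    obtain f g where "(f, g) \<in> conflations (path_algebra Q K) (complex_of_index Q K (indicator_index (Inl \<beta>'))) 
      (complex_of_index Q K \<kappa>) (complex_of_index Q K (indicator_index (Inl \<alpha>')))"
      by (rule conflation_of_hall_polynomial[OF K(2,1)])
    then show ?thesis using equal_roots_of_acyclic_middle[OF Q K(1) h(2,3) i(1)] i(2) by blast
  qed
  have "hall_polynomial Q \<mu> \<nu> \<kappa> \<noteq> 0 \<or> hall_polynomial Q \<nu> \<mu> \<kappa> \<noteq> 0"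
    using sc by (auto simp: structure_constant_def)
  then have "\<mu> = \<nu>" using eq[of \<alpha> \<beta>] eq[of \<beta> \<alpha>] \<alpha> \<beta> by auto
  then show False using sc by (simp add: structure_constant_def)
qed

text \<open>
  The degree of an index is the number of elements of its complex over one field that witnesses all
  nonzero Hall polynomials between the finitely many classes. A structure constant is a difference of
  values at \<open>1\<close>; if it is nonzero, one of the two polynomials is nonzero, hence so is its value at the
  order of that field, and there is a conflation.
\<close>

lemma exists_grading:
  assumes Q: "dynkin_quiver Q"
  obtains d :: "hall_index \<Rightarrow> nat" where "\<And>\<kappa>. \<kappa> \<in> nonacyclic_indices Q \<Longrightarrow> 2 \<le> d \<kappa>"
    "\<And>\<mu> \<nu> \<kappa>. \<mu> \<in> nonacyclic_indices Q \<Longrightarrow> \<nu> \<in> nonacyclic_indices Q \<Longrightarrow> \<kappa> \<in> nonacyclic_indices Q \<Longrightarrow>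
      structure_constant Q \<mu> \<nu> \<kappa> \<noteq> 0 \<Longrightarrow> d \<kappa> = d \<mu> * d \<nu>"
proof -
  let ?F = "nonacyclic_indices Q"
  define \<Psi> where "\<Psi> = (\<lambda>(\<mu>, \<nu>, \<kappa>). hall_polynomial Q \<mu> \<nu> \<kappa>) ` (?F \<times> ?F \<times> ?F) - {0}"
  have "finite \<Psi>" using finite_nonacyclic_indices[OF Q] by (simp add: \<Psi>_def)
  then obtain K where K: "finite_field K" "\<And>\<psi>. \<psi> \<in> \<Psi> \<Longrightarrow> poly \<psi> (int (card (carrier K))) \<noteq> 0"
    by (rule exists_good_field) (auto simp: \<Psi>_def)
  interpret path_alg Q K by (rule dynkin_path_alg[OF Q K(1)])
  interpret AR: ring A by (rule A_ring)
  define d where "d \<kappa> = card (carrier (fst (complex_of_index Q K \<kappa>)))" for \<kappa>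
  have F: "complex_over A (complex_of_index Q K \<kappa>)" "2 \<le> d \<kappa>" if "\<kappa> \<in> ?F" for \<kappa>
    using that nonacyclic_index[OF Q, of \<kappa>] index_complex[OF Q K(1)] by (auto simp: d_def)
  have mult: "d \<kappa> = d \<mu> * d \<nu>" if h: "\<mu> \<in> ?F" "\<nu> \<in> ?F" "\<kappa> \<in> ?F" "hall_polynomial Q \<mu> \<nu> \<kappa> \<noteq> 0" for \<mu> \<nu> \<kappa>
  proof -
    have "hall_polynomial Q \<mu> \<nu> \<kappa> \<in> \<Psi>" using h by (force simp: \<Psi>_def)
    from K(2)[OF this] obtain f g where c: "(f, g) \<in> conflations A (complex_of_index Q K \<nu>) 
      (complex_of_index Q K \<kappa>) (complex_of_index Q K \<mu>)"
      by (rule conflation_of_hall_polynomial[OF _ K(1)])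
    have fx: "fixed (fst X) \<one>\<^bsub>A\<^esub> = carrier (fst X)" if "complex_over A X" for X :: "(_, 'z) cyclic_complex"
      using left_module.smult_one[OF complex_overD(1)[OF that]] by (auto simp: fixed_def)
    show ?thesis
      using conflation_card[OF F(1)[OF h(2)] F(1)[OF h(3)] F(1)[OF h(1)] c AR.one_closed] 
        fx[OF F(1)[OF h(1)]] fx[OF F(1)[OF h(2)]] fx[OF F(1)[OF h(3)]] by (simp add: d_def)
  qed
  have sc: "d \<kappa> = d \<mu> * d \<nu>" if h: "\<mu> \<in> ?F" "\<nu> \<in> ?F" "\<kappa> \<in> ?F" "structure_constant Q \<mu> \<nu> \<kappa> \<noteq> 0" for \<mu> \<nu> \<kappa>
  proof -
    have "hall_polynomial Q \<mu> \<nu> \<kappa> \<noteq> 0 \<or> hall_polynomial Q \<nu> \<mu> \<kappa> \<noteq> 0"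
      using h(4) by (auto simp: structure_constant_def)
    then show ?thesis using mult[OF h(1,2,3)] mult[OF h(2,1,3)] by auto
  qed
  show ?thesis by (rule that[OF F(2) sc])
qed

section \<open>Closure and nilpotency\<close>

lemma lookup_vscale: "Poly_Mapping.lookup (vscale c v) k = c * Poly_Mapping.lookup v k"
  unfolding vscale_def by transfer (simp add: when_def)

lemma vscale_module: "Modules.module vscale"
  by (unfold_locales; rule poly_mapping_eqI; simp add: lookup_vscale lookup_add algebra_simps)

text \<open>
  The span of the basis vectors in \<open>S\<close>. Its description by supports turns statements about brackets
  into statements about structure constants.
\<close>

definition supported :: "'a set \<Rightarrow> ('a \<Rightarrow>\<^sub>0 complex) set" where
  "supported S = {v. Poly_Mapping.keys v \<subseteq> S}"

lemma supported_iff: "v \<in> supported S \<longleftrightarrow> (\<forall>k. k \<notin> S \<longrightarrow> Poly_Mapping.lookup v k = 0)"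
  by (auto simp: supported_def in_keys_iff)

lemma supported_subspace: "Modules.module.subspace vscale (supported S)"
  unfolding module.subspace_def[OF vscale_module] by (auto simp: supported_iff lookup_vscale lookup_add)

lemma single_vscale: "Poly_Mapping.single k c = vscale c (Poly_Mapping.single k (1 :: complex))"
  by (rule poly_mapping_eqI) (simp add: lookup_vscale lookup_single when_def)

lemma span_single:
  assumes "finite S"
  shows "Modules.module.span vscale ((\<lambda>\<mu>. Poly_Mapping.single \<mu> (1 :: complex)) ` S) = supported S"
proof -
  interpret V: Modules.module "vscale :: complex \<Rightarrow> ('a \<Rightarrow>\<^sub>0 complex) \<Rightarrow> _" by (rule vscale_module)
  show ?thesis
  proof (intro equalityI subsetI)
    have "(\<lambda>\<mu>. Poly_Mapping.single \<mu> (1 :: complex)) ` S \<subseteq> supported S"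
      by (auto simp: supported_iff lookup_single when_def)
    then show "v \<in> supported S" if "v \<in> V.span ((\<lambda>\<mu>. Poly_Mapping.single \<mu> 1) ` S)" for v
      using V.span_minimal[OF _ supported_subspace] that by blast
  next
    fix v :: "'a \<Rightarrow>\<^sub>0 complex" assume v: "v \<in> supported S"
    have "v = (\<Sum>k\<in>S. Poly_Mapping.single k (Poly_Mapping.lookup v k))"
    proof (rule poly_mapping_eqI)
      fix k
      have "Poly_Mapping.lookup (\<Sum>k\<in>S. Poly_Mapping.single k (Poly_Mapping.lookup v k)) k = 
        (\<Sum>l\<in>S. if l = k then Poly_Mapping.lookup v k else 0)"
        unfolding lookup_sum by (rule sum.cong) (auto simp: lookup_single when_def)
      then show "Poly_Mapping.lookup v k = Poly_Mapping.lookup (\<Sum>k\<in>S. Poly_Mapping.single k (Poly_Mapping.lookup v k)) k"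
        using v assms by (auto simp: supported_iff)
    qed
    also have "\<dots> \<in> V.span ((\<lambda>\<mu>. Poly_Mapping.single \<mu> 1) ` S)"
      by (rule V.span_sum, subst single_vscale) (auto intro: V.span_scale V.span_base)
    finally show "v \<in> V.span ((\<lambda>\<mu>. Poly_Mapping.single \<mu> 1) ` S)" .
  qed
qed

text \<open>
  The bracket is a linear combination of basis vectors, so only the indices with a nonzero structure
  constant matter.
\<close>

lemma bracket_supported:
  assumes "v \<in> supported S" "w \<in> supported T"
    "\<And>\<mu> \<nu> \<kappa>. \<mu> \<in> S \<Longrightarrow> \<nu> \<in> T \<Longrightarrow> \<kappa> \<in> indecomposable_indices Q \<Longrightarrow> structure_constant Q \<mu> \<nu> \<kappa> \<noteq> 0 \<Longrightarrow> \<kappa> \<in> U"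
  shows "bracket Q v w \<in> supported U"
proof -
  interpret V: Modules.module "vscale :: complex \<Rightarrow> (hall_index \<Rightarrow>\<^sub>0 complex) \<Rightarrow> _" by (rule vscale_module)
  have "basis_bracket Q \<mu> \<nu> \<in> supported U" if "\<mu> \<in> S" "\<nu> \<in> T" for \<mu> \<nu>
    unfolding basis_bracket_def
    by (rule V.subspace_sum[OF supported_subspace])
      (use assms(3)[OF that] in \<open>auto simp: supported_iff lookup_single when_def\<close>)
  then show ?thesis unfolding bracket_def
    using assms(1,2)
    by (intro V.subspace_sum[OF supported_subspace] V.subspace_scale[OF supported_subspace]) (auto simp: supported_def)
qed

text \<open>
  Each bracket with an element of the algebra at least doubles the degree, so the term \<open>k\<close> of the lower
  central series is supported in degrees at least \<open>2\<close> to the power \<open>k + 1\<close>. As the degrees are bounded, some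
  term is supported nowhere.
\<close>

theorem proposition6p1:
  fixes Q :: "(nat, 'e) pre_digraph"
  assumes "dynkin_quiver Q"
  shows "lie_subalgebra vscale (bracket Q) (n_tilde Q) (n_tilde_plus Q) \<and>
         nilpotent vscale (bracket Q) (n_tilde_plus Q)"
proof
  interpret V: Modules.module "vscale :: complex \<Rightarrow> (hall_index \<Rightarrow>\<^sub>0 complex) \<Rightarrow> _" by (rule vscale_module)
  let ?F = "nonacyclic_indices Q"
  have L: "n_tilde_plus Q = supported ?F"
    unfolding n_tilde_plus_def by (rule span_single[OF finite_nonacyclic_indices[OF assms]])
  show "lie_subalgebra vscale (bracket Q) (n_tilde Q) (n_tilde_plus Q)"
    unfolding lie_subalgebra_def
  proof (intro conjI ballI)
    show "n_tilde_plus Q \<subseteq> n_tilde Q"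
      unfolding n_tilde_plus_def n_tilde_def by (intro V.span_mono image_mono) (auto simp: nonacyclic_indices_def)
    show "V.subspace (n_tilde_plus Q)" unfolding L by (rule supported_subspace)
    fix v w assume "v \<in> n_tilde_plus Q" "w \<in> n_tilde_plus Q"
    then show "bracket Q v w \<in> n_tilde_plus Q"
      unfolding L by (rule bracket_supported) (rule structure_constant_nonacyclic[OF assms])
  qed
  obtain d :: "hall_index \<Rightarrow> nat" where d: "\<And>\<kappa>. \<kappa> \<in> ?F \<Longrightarrow> 2 \<le> d \<kappa>"
    "\<And>\<mu> \<nu> \<kappa>. \<mu> \<in> ?F \<Longrightarrow> \<nu> \<in> ?F \<Longrightarrow> \<kappa> \<in> ?F \<Longrightarrow> structure_constant Q \<mu> \<nu> \<kappa> \<noteq> 0 \<Longrightarrow> d \<kappa> = d \<mu> * d \<nu>"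
    by (rule exists_grading[OF assms]) (rule that)
  let ?F' = "\<lambda>k. {\<kappa> \<in> ?F. 2 ^ Suc k \<le> d \<kappa>}"
  have lc: "lower_central vscale (bracket Q) (n_tilde_plus Q) k \<subseteq> supported (?F' k)" for k
  proof (induction k)
    case 0
    have "?F' 0 = ?F" using d(1) by auto
    then show ?case unfolding L by simp
  next
    case (Suc k)
    have "bracket Q v w \<in> supported (?F' (Suc k))" if "v \<in> supported ?F" "w \<in> supported (?F' k)" for v w
      using that
    proof (rule bracket_supported)
      fix \<mu> \<nu> \<kappa> assume h: "\<mu> \<in> ?F" "\<nu> \<in> ?F' k" "\<kappa> \<in> indecomposable_indices Q" "structure_constant Q \<mu> \<nu> \<kappa> \<noteq> 0"
      have \<kappa>: "\<kappa> \<in> ?F" using structure_constant_nonacyclic[OF assms h(1) _ h(3,4)] h(2) by simp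
      have "2 * 2 ^ Suc k \<le> d \<mu> * d \<nu>" using d(1)[OF h(1)] h(2) by (intro mult_le_mono) auto
      then show "\<kappa> \<in> ?F' (Suc k)" using d(2)[OF h(1) _ \<kappa> h(4)] h(2) \<kappa> by simp
    qed
    then have "{bracket Q x y | x y. x \<in> n_tilde_plus Q \<and> y \<in> lower_central vscale (bracket Q) (n_tilde_plus Q) k} \<subseteq> supported (?F' (Suc k))"
      using Suc unfolding L by blast
    then show ?case using V.span_minimal[OF _ supported_subspace] by simp
  qed
  \<comment> \<open>any exponent above all degrees, since \<open>N < 2\<^sup>N\<close>\<close>
  define N where "N = Suc (Max (insert 0 (d ` ?F)))"
  have small: "d \<kappa> < 2 ^ Suc N" if "\<kappa> \<in> ?F" for \<kappa>
  proof -
    have "d \<kappa> \<le> Max (insert 0 (d ` ?F))" using that finite_nonacyclic_indices[OF assms] by (intro Max_ge) auto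
    also have "\<dots> < Suc N" by (simp add: N_def)
    also have "\<dots> < 2 ^ Suc N" by (rule less_exp)
    finally show ?thesis .
  qed
  have "?F' N = {}" using small by fastforce
  moreover have "supported {} = {0 :: hall_index \<Rightarrow>\<^sub>0 complex}" by (auto simp: supported_def)
  ultimately have "lower_central vscale (bracket Q) (n_tilde_plus Q) N \<subseteq> {0}"
    using lc[of N] by metis
  moreover have "0 \<in> lower_central vscale (bracket Q) (n_tilde_plus Q) N"
    by (simp add: N_def V.span_zero)
  ultimately show "nilpotent vscale (bracket Q) (n_tilde_plus Q)"
    unfolding nilpotent_def by blast
qed

end
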